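(* Let $N\ge1$ and let $T$ be an $N$-valid tree with associated set $\tilde E\subset(K_1^+)^\bot$. Let $0<A\le B$ and let $m_0:X\to\mathbb C$ be a measurable function such that: (i) $m_0(\chi)=1$ for all $\chi\in (K_{-N}^+)^\bot$; (ii) for $\chi\in (K_1^+)^\bot$ one has $m_0(\chi)\neq 0$ if and only if $\chi\in\tilde E$; (iii) $A\le |m_0(\chi)|^2\le B$ for all $\chi\in\tilde E$; (iv) $m_0(\chi\,\mathbf r_1^{\bar\alpha_1}\cdots\mathbf r_\nu^{\bar\alpha_\nu})=m_0(\chi)$ for all $\chi\in X$, $\nu\in\mathbb N$, $\bar\alpha_j\in GF(p^s)$. Put $\tilde m_0(\chi)=0$ if $m_0(\chi)=0$ and $\tilde m_0(\chi)=1/\overline{m_0(\chi)}$ if $m_0(\chi)\ne0$. Define $\varphi,\tilde\varphi\in L_2(K)$ by $$\hat\varphi(\chi)=\prod_{n=0}^\infty m_0(\chi\mathcal A^{-n}),\qquad \hat{\tilde\varphi}(\chi)=\prod_{n=0}^\infty\tilde m_0(\chi\mathcal A^{-n}).$$ For $\mathbf l\in GF(p^s)$ put $m_{\mathbf l}(\chi)=m_0(\chi\mathbf r_0^{-\mathbf l})$, $\tilde m_{\mathbf l}(\chi)=\tilde m_0(\chi\mathbf r_0^{-\mathbf l})$, and for $\mathbf l\in GF(p^s)\setminus\{\mathbf 0\}$ define $\psi^{(\mathbf l)},\tilde\psi^{(\mathbf l)}\in L_2(K)$ by $$\hat\psi^{(\mathbf l)}(\chi)=m_{\mathbf l}(\chi)\hat\varphi(\chi\mathcal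 A^{-1}),\qquad \hat{\tilde\psi}^{(\mathbf l)}(\chi)=\tilde m_{\mathbf l}(\chi)\hat{\tilde\varphi}(\chi\mathcal A^{-1}).$$ For $n\in\mathbb Z$, $h\in H_0$ let $\psi^{(\mathbf l)}_{n,h}(x)=p^{\frac{ns}2}\psi^{(\mathbf l)}(\mathcal A^nx\dot-h)$ and $\tilde\psi^{(\mathbf l)}_{n,h}(x)=p^{\frac{ns}2}\tilde\psi^{(\mathbf l)}(\mathcal A^nx\dot-h)$. Then: 1) the collections $(\psi^{(\mathbf l)}_{n,h})$ and $(\tilde\psi^{(\mathbf l)}_{n,h})$, indexed by $\mathbf l\in GF(p^s)\setminus\{\mathbf 0\}$, $n\in\mathbb Z$, $h\in H_0$, are biorthogonal, i.e. $\int_K\psi^{(\mathbf l)}_{n,h}\overline{\tilde\psi^{(\mathbf l')}_{n',h'}}\,d\mu=\delta_{\mathbf l,\mathbf l'}\delta_{n,n'}\delta_{h,h'}$; 2) each of the systems $(\psi^{(\mathbf l)}_{n,h})$ and $(\tilde\psi^{(\mathbf l)}_{n,h})$ is a Riesz basis of $L_2(K)$.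
   Context: Field. Let $p$ be a prime, $s\ge1$, and $K=F^{(s)}$ the local field of characteristic $p$ whose elements are the sequences $a=(\mathbf a_n)_{n\in\mathbb Z}$, $\mathbf a_n\in GF(p^s)$, with $\mathbf a_n=0$ for all sufficiently negative $n$ (identified with Laurent series $\sum_n\mathbf a_nx^n$); addition $\dot+$, subtraction $\dot-$ and multiplication by scalars of $GF(p^s)$ are coordinatewise. $GF(p^s)$ is identified with $GF(p)^s$ as a $GF(p)$-vector space, $\mathbf a=(a^{(0)},\dots,a^{(s-1)})$, with $1=(1,0,\dots,0)$. $K^+$ is the additive group of $K$; $K_n=K_n^+=\{a\in K:\mathbf a_j=0 \text{ for } j<n\}$. $g_n$ is the sequence with $1$ in position $n$ and $0$ elsewhere. The dilation operator is $\mathcal A:\sum_n\lambda_ng_n\mapsto\sum_n\lambda_ng_{n-1}$. $\mu$ is Haar measure on $K^+$ with $\mu(K_0)=1$. $H_0=\{\mathbf a_{-1}g_{-1}\dot+\cdots\dot+\mathbf a_{-\nu}g_{-\nu}:\nu\in\mathbb N,\ \mathbf a_{-j}\in GF(p^s)\}$. Characters. $X$ is the group of characters of $K^+$, $(\chi,x)$ is the value of $\chi$ at $x$. For $k\in\mathbb Z$, $\mathbf u\in GF(p^s)$ the character $\mathbf r_k^{\mathbf u}$ is $(\mathbf r_k^{\mathbf u},a)=\exp\big(\tfrac{2\pi i}{p}\sum_{l=0}^{s-1}u^{(l)}a_k^{(l)}\big)$. Every $\chi\in X$ is uniquely $\prod_{k\in\mathbb Z}\mathbf r_k^{\mathbf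 a_k}$ with $\mathbf a_k=0$ for all large $k$. The annihilator $(K_n^+)^\bot$ is the set of characters trivial on $K_n$, i.e. those with $\mathbf a_k=0$ for $k\ge n$. $\chi\mathcal A$ is defined by $(\chi\mathcal A,x)=(\chi,\mathcal Ax)$, so $\mathbf r_j^{\mathbf u}\mathcal A=\mathbf r_{j+1}^{\mathbf u}$. $\nu$ is Haar measure on $X$ with $\nu((K_0^+)^\bot)=1$. $\hat f(\chi)=\int_Kf(x)\overline{(\chi,x)}\,d\mu(x)$, extended to $L_2$. Riesz bases. A family $(f_j)\subset L_2(K)$ is a Riesz system with constants $A,B>0$ if for every $c=(c_j)\in\ell_2$ the series $\sum c_jf_j$ converges in $L_2(K)$ and $A\|c\|_{\ell_2}^2\le\|\sum c_jf_j\|^2_{L_2(K)}\le B\|c\|^2_{\ell_2}$; it is a Riesz basis of $L_2(K)$ if it is a Riesz system for some constants $A,B>0$ and its closed linear span is $L_2(K)$. $N$-valid trees. An $N$-valid tree is a rooted tree $T$, directed away from the root, whose nodes are labelled by elements of $GF(p^s)$, such that: the root is labelled $\mathbf 0$; for each $j=0,1,\dots,N-1$ level $j$ consists of the single node $\mathbf 0$ (the root is level $0$); every sequence $(\bar\alpha_1,\dots,\bar\alpha_N)\in GF(p^s)^N$ occurs exactly once as the labels of a directed path $\bar\alpha_1\to\cdots\to\bar\alpha_N$ (of length $N-1$) in $T$. The set $\tilde E$ associated with $T$ is the union of $(K_{-N}^+)^\bot$ and all cosets $(K_{-N}^+)^\bot\,\mathbf r_{-N}^{\bar\beta_{-N}}\mathbf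 r_{-N+1}^{\bar\beta_{-N+1}}\cdots\mathbf r_{0}^{\bar\beta_{0}}$, where $\bar\beta_0\to\bar\beta_{-1}\to\cdots\to\bar\beta_{-N}$ runs over all directed paths with $N+1$ nodes in $T$ (directed away from the root). *)

theory Defs
  imports
    "HOL-Analysis.Analysis"
    "HOL-Computational_Algebra.Formal_Laurent_Series"
begin

notation fls_nth (infixl "$$" 75)

section \<open>The local field and its coordinates\<close>

text \<open>
  The finite field \<open>GF(p\<^sup>s)\<close> is a type \<open>'k\<close> of class \<open>{field, finite}\<close> with \<open>p\<^sup>s\<close> elements, and the
  local field is \<^typ>\<open>'k fls\<close> with the library's topology (that of the valuation metric).
  The additive group of the local field is the additive group of \<^typ>\<open>'k fls\<close>, the element \<open>g\<^sub>n\<close>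
  is \<^term>\<open>fls_X_intpow n\<close>, and the power \<open>\<A>\<^sup>n\<close> (for \<open>n \<in> \<int>\<close>) of the dilation operator is
  \<^term>\<open>fls_shift n\<close>, since \<^prop>\<open>fls_shift n a $$ k = a $$ (k + n)\<close>.
\<close>

text \<open>
  An identification of \<open>GF(p\<^sup>s)\<close> with \<open>GF(p)\<^sup>s\<close>: \<^term>\<open>c a l\<close> is the representative in \<open>{0, \<dots>, p - 1}\<close>
  of the \<open>l\<close>-th coordinate of \<open>a\<close>.  An additive map between vector spaces over the prime field
  \<open>GF(p)\<close> is automatically \<open>GF(p)\<close>-linear.
\<close>

definition gf_coords :: "nat \<Rightarrow> nat \<Rightarrow> ('k::field \<Rightarrow> nat \<Rightarrow> nat) \<Rightarrow> bool" where
  "gf_coords p s c \<longleftrightarrow>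
     bij_betw c UNIV ({..<s} \<rightarrow>\<^sub>E {..<p}) \<and>
     (\<forall>a b. \<forall>l<s. c (a + b) l = (c a l + c b l) mod p) \<and>
     (\<forall>l<s. c 1 l = (if l = 0 then 1 else 0))"

definition fls_ball :: "int \<Rightarrow> 'k::field fls set" where
  "fls_ball n = {a. \<forall>j<n. a $$ j = 0}"

definition H0 :: "'k::field fls set" where
  "H0 = {(\<Sum>j=1..\<nu>. fls_const (a j) * fls_X_intpow (- int j)) | \<nu> a. True}"

section \<open>Characters\<close>

typedef (overloaded) 'k character =
  "{\<xi> :: 'k::field fls \<Rightarrow> complex.
      continuous_on UNIV \<xi> \<and> (\<forall>x. cmod (\<xi> x) = 1) \<and> (\<forall>x y. \<xi> (x + y) = \<xi> x * \<xi> y)}"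
  morphisms char_app Abs_character
  by (rule exI[of _ "\<lambda>_. 1"]) simp

setup_lifting type_definition_character

instantiation character :: (field) comm_monoid_mult
begin

lift_definition times_character :: "'a character \<Rightarrow> 'a character \<Rightarrow> 'a character"
  is "\<lambda>\<xi> \<eta> x. \<xi> x * \<eta> x"
  by (auto intro!: continuous_intros simp: norm_mult)

lift_definition one_character :: "'a character" is "\<lambda>_. 1"
  by simp

instance
  by standard (transfer; simp add: algebra_simps)+

end

text \<open>The topology of the dual group is the compact-open topology.\<close>

instantiation character :: (field) topological_space
begin

definition open_character :: "'a character set \<Rightarrow> bool" where
  "open_character =
     generate_topology {{\<xi>. char_app \<xi> ` C \<subseteq> W} | C W. compact C \<and> open W}"

instance
  by standard (auto simp: open_character_def intro: generate_topology.intros)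

end

definition annihilator :: "'k::field fls set \<Rightarrow> 'k character set" where
  "annihilator S = {\<xi>. \<forall>x\<in>S. char_app \<xi> x = 1}"

text \<open>The character \<open>\<r>\<^sub>k\<^sup>u\<close>.\<close>

definition rchar ::
  "nat \<Rightarrow> nat \<Rightarrow> ('k::field \<Rightarrow> nat \<Rightarrow> nat) \<Rightarrow> int \<Rightarrow> 'k \<Rightarrow> 'k character" where
  "rchar p s c k u = Abs_character (\<lambda>a.
     exp (2 * of_real pi * \<i> / of_nat p * of_nat (\<Sum>l<s. c u l * c (a $$ k) l)))"

lemma fls_nth_locally_const:
  fixes a :: "'k::field fls"
  shows "\<exists>d>0. \<forall>b. dist b a < d \<longrightarrow> (\<forall>j\<le>k. b $$ j = a $$ j)"
proof -
  define d :: real where "d = (if k \<ge> 0 then inverse (2 ^ nat k) else 2 ^ nat (- k))"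
  have "b $$ j = a $$ j" if d: "dist b a < d" and j: "j \<le> k" for b j
  proof (cases "b = a")
    case False
    have "fls_subdegree (b - a) > k"
    proof (rule ccontr)
      assume "\<not> fls_subdegree (b - a) > k"
      hence le: "fls_subdegree (b - a) \<le> k" by simp
      consider "fls_subdegree (b - a) \<ge> 0" | "fls_subdegree (b - a) < 0" "k \<ge> 0"
        | "fls_subdegree (b - a) < 0" "k < 0" by linarith
      thus False
      proof cases
        case 1
        have "(2::real) ^ nat (fls_subdegree (b - a)) \<le> 2 ^ nat k"
          using le by (intro power_increasing) auto
        with 1 le d False show False
          by (simp add: d_def dist_fls_def field_simps)
      next
        case 2
        have "inverse ((2::real) ^ nat k) \<le> 1"
          by (simp add: inverse_le_1_iff)
        moreover have "(1::real) \<le> 2 ^ nat (- fls_subdegree (b - a))" by simp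
        moreover have "2 ^ nat (- fls_subdegree (b - a)) < inverse ((2::real) ^ nat k)"
          using 2 d False by (simp add: d_def dist_fls_def)
        ultimately show False by linarith
      next
        case 3
        have "(2::real) ^ nat (- k) \<le> 2 ^ nat (- fls_subdegree (b - a))"
          using le by (intro power_increasing) auto
        with 3 d False show False by (simp add: d_def dist_fls_def)
      qed
    qed
    with j have "(b - a) $$ j = 0" by (intro fls_eq0_below_subdegree) simp
    thus ?thesis by simp
  qed simp
  moreover have "d > 0" by (simp add: d_def)
  ultimately show ?thesis by blast
qed

lemma continuous_on_fls_nth:
  "continuous_on UNIV (\<lambda>a :: 'k::field fls. g (a $$ k) :: complex)"
  unfolding continuous_on_iff
  using fls_nth_locally_const[where k = k] by (metis dist_self order_refl)

lemma continuous_on_fls_shift: "continuous_on UNIV (fls_shift j :: 'k::field fls \<Rightarrow> 'k fls)"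
  unfolding continuous_on_iff
proof (intro ballI allI impI)
  fix x :: "'k fls" and e :: real assume e: "e > 0"
  obtain n where n: "inverse (2 ^ n) < e"
    using real_arch_pow_inv[OF e, of "1/2"] by (auto simp: power_one_over inverse_eq_divide)
  obtain d where d: "d > 0" "\<And>y. dist y x < d \<Longrightarrow> (\<forall>i\<le>int n + j. y $$ i = x $$ i)"
    using fls_nth_locally_const[of x "int n + j"] by blast
  have "dist (fls_shift j y) (fls_shift j x) < e" if "dist y x < d" for y
  proof (cases "fls_shift j y = fls_shift j x")
    case False
    have sub: "fls_subdegree (fls_shift j y - fls_shift j x) > int n"
    proof (rule fls_subdegree_greaterI)
      show "fls_shift j y - fls_shift j x \<noteq> 0" using False by simp
      show "(fls_shift j y - fls_shift j x) $$ i = 0" if "i \<le> int n" for i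
        using d(2)[OF \<open>dist y x < d\<close>] that by simp
    qed
    hence "(2::real) ^ n \<le> 2 ^ nat (fls_subdegree (fls_shift j y - fls_shift j x))"
      by (intro power_increasing) auto
    hence "inverse ((2::real) ^ nat (fls_subdegree (fls_shift j y - fls_shift j x))) \<le> inverse (2 ^ n)"
      by (intro le_imp_inverse_le) auto
    hence "dist (fls_shift j y) (fls_shift j x) \<le> inverse (2 ^ n)"
      using False sub unfolding dist_fls_def by simp
    with n show ?thesis by linarith
  qed (use e in simp)
  with d(1) show "\<exists>d>0. \<forall>y\<in>UNIV. dist y x < d \<longrightarrow> dist (fls_shift j y) (fls_shift j x) < e"
    by blast
qed

lemma char_app_rchar:
  assumes c: "gf_coords p s c" and p: "p > 0"
  shows "char_app (rchar p s c k u) a =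
     exp (2 * of_real pi * \<i> / of_nat p * of_nat (\<Sum>l<s. c u l * c (a $$ k) l))"
proof -
  let ?e = "\<lambda>n :: nat. exp (2 * of_real pi * \<i> / of_nat p * of_nat n)"
  have e_cong: "?e m = ?e n" if "m mod p = n mod p" for m n
  proof -
    have *: "?e n = ?e (n mod p)" for n
    proof -
      have "?e n = ?e (p * (n div p) + n mod p)" by simp
      also have "\<dots> = exp (2 * of_nat (n div p) * of_real pi * \<i>) * ?e (n mod p)"
        unfolding of_nat_add of_nat_mult exp_add[symmetric]
        using p by (intro arg_cong[where f = exp]) (simp add: field_simps)
      also have "exp (2 * of_nat (n div p) * of_real pi * \<i>) = 1"
        using exp_integer_2pi[of "of_nat (n div p)"] by (simp add: mult_ac)
      finally show ?thesis by simp
    qed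
    show ?thesis using *[of m] *[of n] that by simp
  qed
  have add: "?e (\<Sum>l<s. c u l * c ((x + y) $$ k) l) =
      ?e (\<Sum>l<s. c u l * c (x $$ k) l) * ?e (\<Sum>l<s. c u l * c (y $$ k) l)" for x y
  proof -
    have "(\<Sum>l<s. c u l * c ((x + y) $$ k) l) mod p =
          (\<Sum>l<s. (c u l * c ((x + y) $$ k) l) mod p) mod p"
      by (simp add: mod_sum_eq)
    also have "(\<Sum>l<s. (c u l * c ((x + y) $$ k) l) mod p) =
        (\<Sum>l<s. (c u l * c (x $$ k) l + c u l * c (y $$ k) l) mod p)"
      using c by (intro sum.cong refl)
        (simp add: gf_coords_def mod_mult_right_eq distrib_left[symmetric])
    also have "\<dots> mod p = (\<Sum>l<s. c u l * c (x $$ k) l + c u l * c (y $$ k) l) mod p"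
      by (simp add: mod_sum_eq)
    finally have "?e (\<Sum>l<s. c u l * c ((x + y) $$ k) l) =
        ?e ((\<Sum>l<s. c u l * c (x $$ k) l) + (\<Sum>l<s. c u l * c (y $$ k) l))"
      by (intro e_cong) (simp add: sum.distrib)
    thus ?thesis by (simp add: exp_add distrib_left)
  qed
  have cm: "cmod (?e n) = 1" for n
    by (simp add: norm_exp_eq_Re)
  show ?thesis
    unfolding rchar_def
    by (subst Abs_character_inverse)
       (use add cm continuous_on_fls_nth[where k = k and g = "\<lambda>v. ?e (\<Sum>l<s. c u l * c v l)"] in auto)
qed

text \<open>The character \<open>\<xi>\<A>\<^sup>j\<close>, for \<open>j \<in> \<int>\<close>.\<close>

lift_definition char_dilate :: "'k::field character \<Rightarrow> int \<Rightarrow> 'k character"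
  is "\<lambda>\<xi> j x. \<xi> (fls_shift j x)"
  using continuous_on_compose2[OF _ continuous_on_fls_shift] by auto

lemma rchar_dilate:
  assumes "gf_coords p s c" "p > 0"
  shows "char_dilate (rchar p s c k u) 1 = rchar p s c (k + 1) u"
  by (simp add: char_app_inject[symmetric] char_dilate.rep_eq char_app_rchar[OF assms] fun_eq_iff)

section \<open>Haar measures, square-integrable functions and the Fourier transform\<close>

text \<open>
  Haar measure of a group with operation \<open>f\<close>, on the Borel sets.  The groups considered here are
  second countable and locally compact, so regularity is automatic.
\<close>

definition haar_measure :: "('g::topological_space \<Rightarrow> 'g \<Rightarrow> 'g) \<Rightarrow> 'g measure \<Rightarrow> bool" where
  "haar_measure f M \<longleftrightarrow>
     sets M = sets borel \<and> emeasure M UNIV \<noteq> 0 \<and>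
     (\<forall>C\<in>sets borel. compact C \<longrightarrow> emeasure M C < \<infinity>) \<and>
     (\<forall>a. \<forall>S\<in>sets borel. emeasure M (f a ` S) = emeasure M S)"

definition L2 :: "'a measure \<Rightarrow> ('a \<Rightarrow> complex) set" where
  "L2 M = {f \<in> borel_measurable M. integrable M (\<lambda>x. (cmod (f x))\<^sup>2)}"

definition L2_norm :: "'a measure \<Rightarrow> ('a \<Rightarrow> complex) \<Rightarrow> real" where
  "L2_norm M f = sqrt (LINT x|M. (cmod (f x))\<^sup>2)"

definition fourier_L1 ::
  "'k::field fls measure \<Rightarrow> ('k fls \<Rightarrow> complex) \<Rightarrow> 'k character \<Rightarrow> complex" where
  "fourier_L1 \<mu> f \<xi> = (LINT x|\<mu>. f x * cnj (char_app \<xi> x))"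

text \<open>
  \<^term>\<open>F\<close> is (a representative of) the Fourier transform of \<^term>\<open>f \<in> L2 \<mu>\<close>, that is, of the
  extension of \<^const>\<open>fourier_L1\<close> by continuity.
\<close>

definition fourier_L2 ::
  "'k::field fls measure \<Rightarrow> 'k character measure \<Rightarrow>
     ('k fls \<Rightarrow> complex) \<Rightarrow> ('k character \<Rightarrow> complex) \<Rightarrow> bool" where
  "fourier_L2 \<mu> \<nu> f F \<longleftrightarrow>
     f \<in> L2 \<mu> \<and> F \<in> L2 \<nu> \<and>
     (\<exists>g :: nat \<Rightarrow> 'k fls \<Rightarrow> complex.
        (\<forall>n. integrable \<mu> (g n) \<and> g n \<in> L2 \<mu> \<and> fourier_L1 \<mu> (g n) \<in> L2 \<nu>) \<and>
        (\<lambda>n. L2_norm \<mu> (\<lambda>x. g n x - f x)) \<longlonglongrightarrow> 0 \<and>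
        (\<lambda>n. L2_norm \<nu> (\<lambda>\<xi>. fourier_L1 \<mu> (g n) \<xi> - F \<xi>)) \<longlonglongrightarrow> 0)"

section \<open>Riesz bases\<close>

definition L2_has_sum ::
  "'a measure \<Rightarrow> ('i \<Rightarrow> 'a \<Rightarrow> complex) \<Rightarrow> 'i set \<Rightarrow> ('a \<Rightarrow> complex) \<Rightarrow> bool" where
  "L2_has_sum M f I S \<longleftrightarrow>
     S \<in> L2 M \<and>
     ((\<lambda>F. L2_norm M (\<lambda>x. (\<Sum>j\<in>F. f j x) - S x)) \<longlongrightarrow> 0) (finite_subsets_at_top I)"

definition riesz_system ::
  "'a measure \<Rightarrow> real \<Rightarrow> real \<Rightarrow> ('i \<Rightarrow> 'a \<Rightarrow> complex) \<Rightarrow> 'i set \<Rightarrow> bool" where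
  "riesz_system M A B f I \<longleftrightarrow>
     A > 0 \<and> B > 0 \<and> (\<forall>j\<in>I. f j \<in> L2 M) \<and>
     (\<forall>c :: 'i \<Rightarrow> complex. (\<lambda>j. (cmod (c j))\<^sup>2) summable_on I \<longrightarrow>
        (\<exists>S. L2_has_sum M (\<lambda>j x. c j * f j x) I S \<and>
             A * (\<Sum>\<^sub>\<infinity>j\<in>I. (cmod (c j))\<^sup>2) \<le> (L2_norm M S)\<^sup>2 \<and>
             (L2_norm M S)\<^sup>2 \<le> B * (\<Sum>\<^sub>\<infinity>j\<in>I. (cmod (c j))\<^sup>2)))"

definition L2_closed_span ::
  "'a measure \<Rightarrow> ('i \<Rightarrow> 'a \<Rightarrow> complex) \<Rightarrow> 'i set \<Rightarrow> ('a \<Rightarrow> complex) set" where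
  "L2_closed_span M f I =
     {g \<in> L2 M. \<forall>\<epsilon>>0. \<exists>F c. finite F \<and> F \<subseteq> I \<and> L2_norm M (\<lambda>x. g x - (\<Sum>j\<in>F. c j * f j x)) < \<epsilon>}"

definition riesz_basis :: "'a measure \<Rightarrow> ('i \<Rightarrow> 'a \<Rightarrow> complex) \<Rightarrow> 'i set \<Rightarrow> bool" where
  "riesz_basis M f I \<longleftrightarrow> (\<exists>A B. riesz_system M A B f I) \<and> L2_closed_span M f I = L2 M"

definition biorthogonal ::
  "'a measure \<Rightarrow> ('i \<Rightarrow> 'a \<Rightarrow> complex) \<Rightarrow> ('i \<Rightarrow> 'a \<Rightarrow> complex) \<Rightarrow> 'i set \<Rightarrow> bool" where
  "biorthogonal M f g I \<longleftrightarrow>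
     (\<forall>i\<in>I. \<forall>j\<in>I. integrable M (\<lambda>x. f i x * cnj (g j x)) \<and>
        (LINT x|M. f i x * cnj (g j x)) = (if i = j then 1 else 0))"

section \<open>\<open>N\<close>-valid trees\<close>

text \<open>Directed paths are the nonempty lists of successive nodes.\<close>

definition dipath :: "'v set \<Rightarrow> ('v \<times> 'v) set \<Rightarrow> 'v list \<Rightarrow> bool" where
  "dipath V E vs \<longleftrightarrow> vs \<noteq> [] \<and> set vs \<subseteq> V \<and> successively (\<lambda>u v. (u, v) \<in> E) vs"

definition rooted_tree :: "'v set \<Rightarrow> ('v \<times> 'v) set \<Rightarrow> 'v \<Rightarrow> bool" where
  "rooted_tree V E r \<longleftrightarrow>
     r \<in> V \<and> E \<subseteq> V \<times> V \<and> (\<forall>v\<in>V. \<exists>!vs. dipath V E vs \<and> hd vs = r \<and> last vs = v)"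

definition valid_tree ::
  "nat \<Rightarrow> 'v set \<Rightarrow> ('v \<times> 'v) set \<Rightarrow> 'v \<Rightarrow> ('v \<Rightarrow> 'k::field) \<Rightarrow> bool" where
  "valid_tree N V E r lab \<longleftrightarrow>
     rooted_tree V E r \<and> lab r = 0 \<and>
     (\<forall>j<N. \<exists>v. {w \<in> V. (r, w) \<in> E ^^ j} = {v} \<and> lab v = 0) \<and>
     (\<forall>\<alpha>s. length \<alpha>s = N \<longrightarrow> (\<exists>!vs. dipath V E vs \<and> map lab vs = \<alpha>s))"

text \<open>The set \<open>\<tilde>E\<close>; the entry \<^term>\<open>vs ! j\<close> of a path is its node with label \<open>\<beta>\<^sub>-\<^sub>j\<close>.\<close>

definition tree_set ::
  "nat \<Rightarrow> nat \<Rightarrow> ('k::field \<Rightarrow> nat \<Rightarrow> nat) \<Rightarrow> nat \<Rightarrow> 'v set \<Rightarrow> ('v \<times> 'v) set \<Rightarrow>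
     ('v \<Rightarrow> 'k) \<Rightarrow> 'k character set" where
  "tree_set p s c N V E lab =
     annihilator (fls_ball (- int N)) \<union>
     {\<xi> * (\<Prod>j\<le>N. rchar p s c (- int j) (lab (vs ! j))) | \<xi> vs.
        \<xi> \<in> annihilator (fls_ball (- int N)) \<and> dipath V E vs \<and> length vs = N + 1}"

section \<open>Masks, scaling functions and wavelets\<close>

definition dual_mask :: "('k::field character \<Rightarrow> complex) \<Rightarrow> 'k character \<Rightarrow> complex" where
  "dual_mask m \<xi> = (if m \<xi> = 0 then 0 else 1 / cnj (m \<xi>))"

definition scaling_hat :: "('k::field character \<Rightarrow> complex) \<Rightarrow> 'k character \<Rightarrow> complex" where
  "scaling_hat m \<xi> = (\<Prod>n. m (char_dilate \<xi> (- int n)))"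

definition shifted_mask ::
  "nat \<Rightarrow> nat \<Rightarrow> ('k::field \<Rightarrow> nat \<Rightarrow> nat) \<Rightarrow> ('k character \<Rightarrow> complex) \<Rightarrow> 'k \<Rightarrow>
     'k character \<Rightarrow> complex" where
  "shifted_mask p s c m l \<xi> = m (\<xi> * rchar p s c 0 (- l))"

definition wavelet_hat ::
  "nat \<Rightarrow> nat \<Rightarrow> ('k::field \<Rightarrow> nat \<Rightarrow> nat) \<Rightarrow> ('k character \<Rightarrow> complex) \<Rightarrow> 'k \<Rightarrow>
     'k character \<Rightarrow> complex" where
  "wavelet_hat p s c m l \<xi> = shifted_mask p s c m l \<xi> * scaling_hat m (char_dilate \<xi> (- 1))"

text \<open>The functions \<open>\<psi>\<^sup>(\<^sup>l\<^sup>)\<^sub>n\<^sub>,\<^sub>h\<close> and their index set.\<close>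

definition wavelet_system ::
  "nat \<Rightarrow> nat \<Rightarrow> ('k::field \<Rightarrow> 'k fls \<Rightarrow> complex) \<Rightarrow> 'k \<times> int \<times> 'k fls \<Rightarrow>
     'k fls \<Rightarrow> complex" where
  "wavelet_system p s \<psi> = (\<lambda>(l, n, h) x.
     of_real (real p powr (real_of_int n * real s / 2)) * \<psi> l (fls_shift n x - h))"

definition wavelet_index :: "('k::field \<times> int \<times> 'k fls) set" where
  "wavelet_index = (UNIV - {0}) \<times> UNIV \<times> H0"

end

theory Submission
  imports Defs
begin

text \<open>
  The bicharacter given by \<open>\<Prod>\<^sub>k (\<r>\<^sub>k\<^sup>u, x)\<close> with \<open>u = b\<^sub>-\<^sub>1\<^sub>-\<^sub>k\<close> identifies the dual group with the field itself,
  so that Haar measure, dilation and the balls \<open>K\<^sub>n\<close> correspond to each other, and Plancherel's theorem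
  reduces the claim to functions of \<open>b\<close>. In these coordinates the tree is a recursion: \<open>m\<^sub>0(b) \<noteq> 0\<close>
  means that the digit \<open>b\<^sub>-\<^sub>1\<close> is the label of the parent of the node reached by the digits
  \<open>b\<^sub>0, \<dots>, b\<^sub>N\<^sub>-\<^sub>1\<close>. Let \<open>d\<^sub>n(b)\<close> be the defect of the recursion at the digit \<open>b\<^sub>-\<^sub>1\<^sub>-\<^sub>n\<close>. As the tree
  is finite, only \<open>b = 0\<close> has no defect, and the transform of \<open>\<psi>\<^sup>(\<^sup>l\<^sup>)\<^sub>n\<^sub>,\<^sub>h\<close> lives on the set where the
  last nonzero defect is \<open>d\<^sub>n(b) = l\<close>. These sets partition the nonzero \<open>b\<close>, and on the dilate of
  each of them to \<open>n = 0\<close> the digits of nonnegative index are free and determine the others, so the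
  characters given by \<open>h \<in> H\<^sub>0\<close> form an orthonormal basis there. Hence the transforms of the wavelets are an
  orthonormal basis multiplied by a function bounded above and below; passing to the dual mask
  replaces this function by the inverse of its conjugate.
\<close>

section \<open>Square-integrable functions\<close>

text \<open>Characters from \<open>H0\<close> depend only on the digits of nonnegative index, so
  over each support with \<open>n = 0\<close> they integrate exactly as over
  \<open>fls_ball 0\<close>; this is the source of orthonormality. Completeness is the harder half.
  Finite Fourier inversion yields the indicator of every small cylinder inside one support, but of
  no cylinder around 0, because the supports accumulate there. The constants come from a height
  \<open>H\<close>: the paths of the finitely many words of length \<open>N\<close> start at bounded
  depth, so wherever the infinite product is nonzero at most \<open>H + N\<close> of its factors
  differ from 1, and the wavelet has one factor more. On the side of the dual group only a Borel
  isomorphism with the field is established, which is enough to move measures and integrals.\<close>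

lemma borel_measurable_cnj [measurable]:
  "f \<in> borel_measurable M \<Longrightarrow> (\<lambda>x. cnj (f x)) \<in> borel_measurable M"
  by (rule borel_measurable_continuous_on[OF _ , of cnj]) (auto intro!: continuous_intros)

lemma L2_measurable: "f \<in> L2 M \<Longrightarrow> f \<in> borel_measurable M"
  by (simp add: L2_def)

lemma L2_integrable: "f \<in> L2 M \<Longrightarrow> integrable M (\<lambda>x. (cmod (f x))\<^sup>2)"
  by (simp add: L2_def)

lemma L2_norm_nonneg: "L2_norm M f \<ge> 0"
  by (simp add: L2_norm_def)

lemma L2_norm_power2: "(L2_norm M f)\<^sup>2 = (LINT x|M. (cmod (f x))\<^sup>2)"
  by (simp add: L2_norm_def)

lemma L2_norm_le_iff: "a \<ge> 0 \<Longrightarrow> L2_norm M f \<le> a \<longleftrightarrow> (LINT x|M. (cmod (f x))\<^sup>2) \<le> a\<^sup>2"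
  unfolding L2_norm_def by (metis real_le_lsqrt real_sqrt_le_iff real_sqrt_abs abs_of_nonneg)

lemma L2_norm_minus_commute: "L2_norm M (\<lambda>x. f x - g x) = L2_norm M (\<lambda>x. g x - f x)"
  by (simp add: L2_norm_def norm_minus_commute)

lemma L2_dominated:
  assumes "f \<in> borel_measurable M" "g \<in> L2 M" "\<And>x. cmod (f x) \<le> cmod (g x)"
  shows "f \<in> L2 M" "L2_norm M f \<le> L2_norm M g"
proof -
  have *: "(cmod (f x))\<^sup>2 \<le> (cmod (g x))\<^sup>2" for x
    using assms(3) by (intro power_mono) auto
  show f: "f \<in> L2 M"
    unfolding L2_def using assms(1) L2_integrable[OF assms(2)] *
    by (auto intro!: Bochner_Integration.integrable_bound[OF L2_integrable[OF assms(2)]])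
  show "L2_norm M f \<le> L2_norm M g"
    unfolding L2_norm_def
    by (intro real_sqrt_le_mono integral_mono L2_integrable f assms *)
qed

lemma L2_cmult:
  assumes "f \<in> L2 M" shows "(\<lambda>x. a * f x) \<in> L2 M"
  using assms by (auto simp: L2_def norm_mult power_mult_distrib)

lemma L2_norm_cmult: "L2_norm M (\<lambda>x. a * f x) = cmod a * L2_norm M f"
  by (simp add: L2_norm_def norm_mult power_mult_distrib real_sqrt_mult)

lemma L2_bounded_mult:
  assumes "f \<in> L2 M" "g \<in> borel_measurable M" "\<And>x. cmod (g x) \<le> C"
  shows "(\<lambda>x. g x * f x) \<in> L2 M" "L2_norm M (\<lambda>x. g x * f x) \<le> C * L2_norm M f"
proof -
  have C: "C \<ge> 0" using assms(3) norm_ge_zero order_trans by blast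
  have m: "(\<lambda>x. g x * f x) \<in> borel_measurable M"
    using assms L2_measurable by measurable
  have d: "cmod (g x * f x) \<le> cmod (of_real C * f x)" for x
    using assms(3)[of x] C by (simp add: norm_mult mult_right_mono)
  show "(\<lambda>x. g x * f x) \<in> L2 M"
    by (rule L2_dominated(1)[OF m L2_cmult[OF assms(1), of "of_real C"] d])
  show "L2_norm M (\<lambda>x. g x * f x) \<le> C * L2_norm M f"
    using L2_dominated(2)[OF m L2_cmult[OF assms(1), of "of_real C"] d] C
    by (simp add: L2_norm_cmult)
qed

lemma L2_add:
  assumes "f \<in> L2 M" "g \<in> L2 M" shows "(\<lambda>x. f x + g x) \<in> L2 M"
proof -
  have "(cmod (f x + g x))\<^sup>2 \<le> 2 * (cmod (f x))\<^sup>2 + 2 * (cmod (g x))\<^sup>2" for x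
  proof -
    have "(cmod (f x + g x))\<^sup>2 \<le> (cmod (f x) + cmod (g x))\<^sup>2"
      by (intro power_mono norm_triangle_ineq) auto
    also have "\<dots> \<le> 2 * (cmod (f x))\<^sup>2 + 2 * (cmod (g x))\<^sup>2"
      using sum_squares_bound[of "cmod (f x)" "cmod (g x)"] by (simp add: power2_sum)
    finally show ?thesis .
  qed
  moreover have "integrable M (\<lambda>x. 2 * (cmod (f x))\<^sup>2 + 2 * (cmod (g x))\<^sup>2)"
    using L2_integrable[OF assms(1)] L2_integrable[OF assms(2)] by simp
  ultimately show ?thesis
    using L2_measurable[OF assms(1)] L2_measurable[OF assms(2)] unfolding L2_def
    by (auto intro!: Bochner_Integration.integrable_bound[where f = "\<lambda>x. 2 * (cmod (f x))\<^sup>2 + 2 * (cmod (g x))\<^sup>2"])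
qed

lemma L2_diff: "f \<in> L2 M \<Longrightarrow> g \<in> L2 M \<Longrightarrow> (\<lambda>x. f x - g x) \<in> L2 M"
  using L2_add[of f M "\<lambda>x. (-1) * g x"] L2_cmult[of g M "-1"] by simp

lemma L2_zero: "(\<lambda>x. 0) \<in> L2 M"
  by (simp add: L2_def)

lemma L2_sum: "(\<And>i. i \<in> F \<Longrightarrow> f i \<in> L2 M) \<Longrightarrow> (\<lambda>x. \<Sum>i\<in>F. f i x) \<in> L2 M"
  by (induction F rule: infinite_finite_induct) (auto simp: L2_zero L2_add)

lemma L2_mult_integrable:
  assumes "f \<in> L2 M" "g \<in> L2 M"
  shows "integrable M (\<lambda>x. f x * cnj (g x))"
proof -
  have i: "integrable M (\<lambda>x. (cmod (f x))\<^sup>2 + (cmod (g x))\<^sup>2)"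
    using L2_integrable[OF assms(1)] L2_integrable[OF assms(2)] by simp
  have "cmod (f x * cnj (g x)) \<le> norm ((cmod (f x))\<^sup>2 + (cmod (g x))\<^sup>2)" for x
    using sum_squares_bound[of "cmod (f x)" "cmod (g x)"]
      mult_nonneg_nonneg[of "cmod (f x)" "cmod (g x)"]
    by (simp add: norm_mult del: mult_nonneg_nonneg)
  thus ?thesis
    using L2_measurable[OF assms(1)] L2_measurable[OF assms(2)]
    by (intro Bochner_Integration.integrable_bound[OF i]) (auto intro: borel_measurable_cnj)
qed

text \<open>Integrating the square of \<open>cmod (f x) - t * cmod (g x)\<close> gives a quadratic
  inequality in the real parameter \<open>t\<close>. The optimal \<open>t\<close> is the quotient of
  the norms; if one of them is zero, other values of \<open>t\<close> force
  \<open>P = 0\<close>.\<close>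

lemma L2_inner_le:
  assumes f: "f \<in> L2 M" and g: "g \<in> L2 M"
  shows "(LINT x|M. cmod (f x) * cmod (g x)) \<le> L2_norm M f * L2_norm M g"
proof -
  define P where "P = (LINT x|M. cmod (f x) * cmod (g x))"
  have i: "integrable M (\<lambda>x. cmod (f x) * cmod (g x))"
    using integrable_norm[OF L2_mult_integrable[OF f g]] by (simp add: norm_mult)
  have P0: "P \<ge> 0" unfolding P_def by (intro Bochner_Integration.integral_nonneg) auto
  have q: "2 * t * P \<le> (L2_norm M f)\<^sup>2 + t\<^sup>2 * (L2_norm M g)\<^sup>2" for t
  proof -
    have "2 * t * P = (LINT x|M. 2 * t * (cmod (f x) * cmod (g x)))" using i by (simp add: P_def)
    also have "\<dots> \<le> (LINT x|M. (cmod (f x))\<^sup>2 + t\<^sup>2 * (cmod (g x))\<^sup>2)"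
    proof (rule integral_mono)
      fix x show "2 * t * (cmod (f x) * cmod (g x)) \<le> (cmod (f x))\<^sup>2 + t\<^sup>2 * (cmod (g x))\<^sup>2"
        using sum_squares_bound[of "cmod (f x)" "t * cmod (g x)"] by (simp add: power_mult_distrib mult_ac)
    qed (use i L2_integrable[OF f] L2_integrable[OF g] in auto)
    also have "\<dots> = (L2_norm M f)\<^sup>2 + t\<^sup>2 * (L2_norm M g)\<^sup>2"
      using L2_integrable[OF f] L2_integrable[OF g] by (simp add: L2_norm_power2)
    finally show ?thesis .
  qed
  have "P \<le> L2_norm M f * L2_norm M g"
  proof (cases "L2_norm M g = 0")
    case True
    have "P = 0"
    proof (rule ccontr)
      assume "P \<noteq> 0"
      \<comment> \<open>For this \<open>t\<close> the left side is one more than the square of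
        \<open>L2_norm M f\<close>, while the term with \<open>g\<close> vanishes.\<close>
      with q[of "((L2_norm M f)\<^sup>2 + 1) / (2 * P)"] True show False by simp
    qed
    with True show ?thesis by simp
  next
    case False
    hence g0: "L2_norm M g > 0" using L2_norm_nonneg[of M g] by linarith
    show ?thesis
    proof (cases "L2_norm M f = 0")
      case True
      have "2 * t * P \<le> t\<^sup>2 * (L2_norm M g)\<^sup>2" for t using q[of t] True by simp
      from this[of "P / (L2_norm M g)\<^sup>2"] g0 have "P * P \<le> 0"
        by (simp add: power2_eq_square field_simps)
      with True show ?thesis by (auto simp: mult_le_0_iff)
    next
      case False
      hence f0: "L2_norm M f > 0" using L2_norm_nonneg[of M f] by linarith
      from q[of "L2_norm M f / L2_norm M g"] f0 g0 show ?thesis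
        by (simp add: power2_eq_square field_simps)
    qed
  qed
  thus ?thesis by (simp add: P_def)
qed

lemma L2_norm_add_le:
  assumes f: "f \<in> L2 M" and g: "g \<in> L2 M"
  shows "L2_norm M (\<lambda>x. f x + g x) \<le> L2_norm M f + L2_norm M g"
proof -
  have i: "integrable M (\<lambda>x. cmod (f x) * cmod (g x))"
    using integrable_norm[OF L2_mult_integrable[OF f g]] by (simp add: norm_mult)
  note fi = L2_integrable[OF f] and gi = L2_integrable[OF g]
  have "(LINT x|M. (cmod (f x + g x))\<^sup>2)
      \<le> (LINT x|M. (cmod (f x))\<^sup>2 + (2 * (cmod (f x) * cmod (g x)) + (cmod (g x))\<^sup>2))"
  proof (rule integral_mono)
    fix x
    have "(cmod (f x + g x))\<^sup>2 \<le> (cmod (f x) + cmod (g x))\<^sup>2"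
      by (intro power_mono norm_triangle_ineq) auto
    thus "(cmod (f x + g x))\<^sup>2 \<le> (cmod (f x))\<^sup>2 + (2 * (cmod (f x) * cmod (g x)) + (cmod (g x))\<^sup>2)"
      by (simp add: power2_sum)
  qed (use i fi gi L2_integrable[OF L2_add[OF f g]] in auto)
  also have "\<dots> = (L2_norm M f)\<^sup>2 + (2 * (LINT x|M. cmod (f x) * cmod (g x)) + (L2_norm M g)\<^sup>2)"
    using i fi gi by (simp add: L2_norm_power2)
  also have "\<dots> \<le> (L2_norm M f + L2_norm M g)\<^sup>2"
    using L2_inner_le[OF f g] by (simp add: power2_sum)
  finally show ?thesis
    by (simp add: L2_norm_le_iff L2_norm_nonneg)
qed

lemma L2_norm_triangle:
  assumes "f \<in> L2 M" "g \<in> L2 M" "h \<in> L2 M"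
  shows "L2_norm M (\<lambda>x. f x - h x) \<le> L2_norm M (\<lambda>x. f x - g x) + L2_norm M (\<lambda>x. g x - h x)"
  using L2_norm_add_le[OF L2_diff[OF assms(1,2)] L2_diff[OF assms(2,3)]] by simp

lemma L2_norm_diff_ge:
  assumes "f \<in> L2 M" "g \<in> L2 M"
  shows "\<bar>L2_norm M f - L2_norm M g\<bar> \<le> L2_norm M (\<lambda>x. f x - g x)"
  using L2_norm_triangle[OF assms L2_zero] L2_norm_triangle[OF assms(2,1) L2_zero]
  by (simp add: L2_norm_minus_commute[of M f g])

lemma L2_norm_tendsto:
  assumes "\<And>n. g n \<in> L2 M" "f \<in> L2 M"
    and "((\<lambda>n. L2_norm M (\<lambda>x. g n x - f x)) \<longlongrightarrow> 0) F"
  shows "((\<lambda>n. L2_norm M (g n)) \<longlongrightarrow> L2_norm M f) F"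
proof -
  have "((\<lambda>n. L2_norm M (g n) - L2_norm M f) \<longlongrightarrow> 0) F"
    by (rule Lim_null_comparison[OF _ assms(3)])
       (use L2_norm_diff_ge[OF assms(1,2)] in \<open>auto intro!: always_eventually\<close>)
  thus ?thesis by (simp add: LIM_zero_iff)
qed

section \<open>Almost everywhere limits and completeness of L2\<close>

lemma AE_tendsto_of_summable_L2:
  fixes g :: "nat \<Rightarrow> 'a \<Rightarrow> complex"
  assumes g: "\<And>k. g k \<in> L2 M" and d: "\<And>k. L2_norm M (\<lambda>x. g (Suc k) x - g k x) \<le> (1/3) ^ k"
  shows "AE x in M. convergent (\<lambda>k. g k x)"
proof -
  \<comment> \<open>The weights \<open>4 ^ k\<close> are tuned to the rate 1/3: the weighted squares
    of \<open>D k\<close> still have integrals of size \<open>(4/9) ^ k\<close>, and where their sum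
    is finite \<open>D k\<close> is bounded by a multiple of \<open>(1/2) ^ k\<close>, which is
    summable.\<close>
  define D where "D = (\<lambda>k x. g (Suc k) x - g k x)"
  have D: "D k \<in> L2 M" for k unfolding D_def by (intro L2_diff g)
  have meas[measurable]: "D k \<in> borel_measurable M" for k using L2_measurable[OF D] .
  have "(\<integral>\<^sup>+x. (\<Sum>k. ennreal (4 ^ k * (cmod (D k x))\<^sup>2)) \<partial>M) =
      (\<Sum>k. \<integral>\<^sup>+x. ennreal (4 ^ k * (cmod (D k x))\<^sup>2) \<partial>M)"
    by (rule nn_integral_suminf) measurable
  also have "\<dots> \<le> (\<Sum>k. ennreal ((4/9) ^ k))"
  proof (rule suminf_le)
    fix k
    have "(\<integral>\<^sup>+x. ennreal (4 ^ k * (cmod (D k x))\<^sup>2) \<partial>M) = ennreal (LINT x|M. 4 ^ k * (cmod (D k x))\<^sup>2)"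
      using L2_integrable[OF D] by (intro nn_integral_eq_integral) auto
    also have "(LINT x|M. 4 ^ k * (cmod (D k x))\<^sup>2) = 4 ^ k * (L2_norm M (D k))\<^sup>2"
      by (simp add: L2_norm_power2)
    also have "\<dots> \<le> 4 ^ k * ((1/3) ^ k)\<^sup>2"
      using d[of k] L2_norm_nonneg by (intro mult_left_mono power_mono) (auto simp: D_def)
    also have "\<dots> = (4/9) ^ k"
      by (simp only: power2_eq_square power_mult_distrib[symmetric]) simp
    finally show "(\<integral>\<^sup>+x. ennreal (4 ^ k * (cmod (D k x))\<^sup>2) \<partial>M) \<le> ennreal ((4/9) ^ k)"
      by (simp add: ennreal_leI)
  qed auto
  also have "\<dots> < \<infinity>"
    by (simp add: suminf_ennreal2 summable_geometric)
  finally have "AE x in M. (\<Sum>k. ennreal (4 ^ k * (cmod (D k x))\<^sup>2)) \<noteq> \<infinity>"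
    by (intro nn_integral_PInf_AE) auto
  thus ?thesis
  proof (rule AE_mp, intro AE_I2 impI)
    fix x assume fin: "(\<Sum>k. ennreal (4 ^ k * (cmod (D k x))\<^sup>2)) \<noteq> \<infinity>"
    have "summable (\<lambda>k. 4 ^ k * (cmod (D k x))\<^sup>2)"
      by (rule summable_suminf_not_top) (use fin in auto)
    then obtain C where C: "\<And>k. norm (4 ^ k * (cmod (D k x))\<^sup>2) \<le> C"
      using summable_imp_bounded unfolding bounded_iff by blast
    have bd: "cmod (D k x) \<le> sqrt C * (1/2) ^ k" for k
    proof -
      have "(2 ^ k * cmod (D k x))\<^sup>2 \<le> C"
      proof -
        have "(4::real) ^ k = 2 ^ k * 2 ^ k" by (simp only: power_mult_distrib[symmetric]) simp
        thus ?thesis using C[of k] by (simp add: power2_eq_square mult_ac)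
      qed
      hence "2 ^ k * cmod (D k x) \<le> sqrt C" by (simp add: real_le_rsqrt)
      hence "2 ^ k * cmod (D k x) / 2 ^ k \<le> sqrt C / 2 ^ k" by (rule divide_right_mono) simp
      thus ?thesis by (simp add: power_divide)
    qed
    have "summable (\<lambda>k. sqrt C * (1/2) ^ k)"
      by (intro summable_mult summable_geometric) simp
    hence "summable (\<lambda>k. D k x)"
      by (rule summable_comparison_test'[where N = 0]) (rule bd)
    hence "(\<lambda>n. \<Sum>k<n. D k x) \<longlonglongrightarrow> (\<Sum>k. D k x)"
      by (rule summable_LIMSEQ)
    hence "(\<lambda>n. (g n x - g 0 x) + g 0 x) \<longlonglongrightarrow> (\<Sum>k. D k x) + g 0 x"
      unfolding D_def sum_lessThan_telescope[of "\<lambda>n. g n x"] by (intro tendsto_add tendsto_const)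
    thus "convergent (\<lambda>k. g k x)"
      by (auto simp: convergent_def)
  qed
qed

text \<open>Fatou's lemma for the squared moduli; that the limit lies in \<open>L2 M\<close> comes
  out of the same estimate.\<close>

lemma L2_norm_le_of_AE_tendsto:
  fixes g :: "nat \<Rightarrow> 'a \<Rightarrow> complex"
  assumes g: "\<And>k. g k \<in> L2 M" and f: "f \<in> borel_measurable M"
    and lim: "AE x in M. (\<lambda>k. g k x) \<longlonglongrightarrow> f x"
    and le: "\<forall>\<^sub>F k in sequentially. L2_norm M (g k) \<le> C"
  shows "f \<in> L2 M" "L2_norm M f \<le> C"
proof -
  obtain k0 where k0: "\<And>k. k \<ge> k0 \<Longrightarrow> L2_norm M (g k) \<le> C"
    using le by (auto simp: eventually_sequentially)
  have C: "C \<ge> 0" using k0[of k0] L2_norm_nonneg[of M "g k0"] by linarith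
  note [measurable] = f L2_measurable[OF g]
  have "(\<integral>\<^sup>+x. ennreal ((cmod (f x))\<^sup>2) \<partial>M) = (\<integral>\<^sup>+x. liminf (\<lambda>k. ennreal ((cmod (g k x))\<^sup>2)) \<partial>M)"
  proof (rule nn_integral_cong_AE, rule AE_mp[OF lim], intro AE_I2 impI)
    fix x assume "(\<lambda>k. g k x) \<longlonglongrightarrow> f x"
    hence "(\<lambda>k. ennreal ((cmod (g k x))\<^sup>2)) \<longlonglongrightarrow> ennreal ((cmod (f x))\<^sup>2)"
      by (intro tendsto_intros) auto
    thus "ennreal ((cmod (f x))\<^sup>2) = liminf (\<lambda>k. ennreal ((cmod (g k x))\<^sup>2))"
      using lim_imp_Liminf by force
  qed
  also have "\<dots> \<le> liminf (\<lambda>k. \<integral>\<^sup>+x. ennreal ((cmod (g k x))\<^sup>2) \<partial>M)"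
    by (rule nn_integral_liminf) measurable
  also have "\<dots> \<le> limsup (\<lambda>k. \<integral>\<^sup>+x. ennreal ((cmod (g k x))\<^sup>2) \<partial>M)"
    by (rule Liminf_le_Limsup) simp
  also have "\<dots> \<le> ennreal (C\<^sup>2)"
  proof (rule Limsup_bounded)
    show "\<forall>\<^sub>F k in sequentially. (\<integral>\<^sup>+x. ennreal ((cmod (g k x))\<^sup>2) \<partial>M) \<le> ennreal (C\<^sup>2)"
      unfolding eventually_sequentially
    proof (intro exI allI impI)
      fix k assume "k0 \<le> k"
      have "(\<integral>\<^sup>+x. ennreal ((cmod (g k x))\<^sup>2) \<partial>M) = ennreal ((L2_norm M (g k))\<^sup>2)"
        unfolding L2_norm_power2 using L2_integrable[OF g] by (intro nn_integral_eq_integral) auto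
      also have "\<dots> \<le> ennreal (C\<^sup>2)"
        using k0[OF \<open>k0 \<le> k\<close>] L2_norm_nonneg by (intro ennreal_leI power_mono)
      finally show "(\<integral>\<^sup>+x. ennreal ((cmod (g k x))\<^sup>2) \<partial>M) \<le> ennreal (C\<^sup>2)" .
    qed
  qed
  finally have nn: "(\<integral>\<^sup>+x. ennreal ((cmod (f x))\<^sup>2) \<partial>M) \<le> ennreal (C\<^sup>2)" .
  have int: "integrable M (\<lambda>x. (cmod (f x))\<^sup>2)"
    using nn by (intro integrableI_nonneg) (auto intro: le_less_trans)
  thus "f \<in> L2 M" using f by (simp add: L2_def)
  have "ennreal (LINT x|M. (cmod (f x))\<^sup>2) \<le> ennreal (C\<^sup>2)"
    using nn nn_integral_eq_integral[OF int] by simp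
  thus "L2_norm M f \<le> C"
    using C by (simp add: L2_norm_le_iff)
qed

text \<open>Riesz-Fischer: a subsequence with geometrically small steps converges almost everywhere,
  and the Fatou bound for \<open>f n x - f (r k) x\<close>, as \<open>k\<close> tends to infinity,
  turns this into convergence in norm of the whole sequence.\<close>

lemma L2_complete:
  fixes f :: "nat \<Rightarrow> 'a \<Rightarrow> complex"
  assumes f: "\<And>n. f n \<in> L2 M"
    and cauchy: "\<And>\<epsilon>. \<epsilon> > 0 \<Longrightarrow> \<exists>n0. \<forall>m\<ge>n0. \<forall>n\<ge>n0. L2_norm M (\<lambda>x. f m x - f n x) < \<epsilon>"
  shows "\<exists>S\<in>L2 M. (\<lambda>n. L2_norm M (\<lambda>x. f n x - S x)) \<longlonglongrightarrow> 0"
proof -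
  have "\<forall>k. \<exists>n0. \<forall>m\<ge>n0. \<forall>n\<ge>n0. L2_norm M (\<lambda>x. f m x - f n x) < (1/3) ^ k"
    using cauchy by simp
  then obtain r0 where r0: "\<And>k m n. m \<ge> r0 k \<Longrightarrow> n \<ge> r0 k \<Longrightarrow> L2_norm M (\<lambda>x. f m x - f n x) < (1/3) ^ k"
    by metis
  \<comment> \<open>Summing the thresholds \<open>r0\<close> makes the index monotone, and the added
    \<open>k\<close> makes it tend to infinity.\<close>
  define r where "r k = k + (\<Sum>j\<le>k. r0 j)" for k
  have r: "r k \<ge> r0 k" "r k \<ge> k" "r (Suc k) \<ge> r k" for k
    using member_le_sum[of k "{..k}" r0] by (auto simp: r_def)
  have "L2_norm M (\<lambda>x. f (r (Suc k)) x - f (r k) x) \<le> (1/3) ^ k" for k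
    using r0[of k "r (Suc k)" "r k"] r(1)[of k] r(3)[of k] by (simp add: less_imp_le)
  hence ae: "AE x in M. convergent (\<lambda>k. f (r k) x)"
    by (rule AE_tendsto_of_summable_L2[OF f])
  note [measurable] = L2_measurable[OF f]
  define S where "S = (\<lambda>x. lim (\<lambda>k. f (r k) x))"
  have Sm[measurable]: "S \<in> borel_measurable M"
    unfolding S_def by measurable
  have lim: "AE x in M. (\<lambda>k. f (r k) x) \<longlonglongrightarrow> S x"
    using ae by eventually_elim (simp add: S_def convergent_LIMSEQ_iff)
  have *: "(\<lambda>x. f n x - S x) \<in> L2 M \<and> L2_norm M (\<lambda>x. f n x - S x) \<le> \<epsilon>"
    if n: "\<forall>m\<ge>n0. L2_norm M (\<lambda>x. f n x - f m x) < \<epsilon>" for n n0 \<epsilon>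
  proof (intro conjI)
    have ev: "\<forall>\<^sub>F k in sequentially. L2_norm M (\<lambda>x. f n x - f (r k) x) \<le> \<epsilon>"
      unfolding eventually_sequentially using n r(2) by (meson less_imp_le order_trans)
    have l: "AE x in M. (\<lambda>k. f n x - f (r k) x) \<longlonglongrightarrow> f n x - S x"
      using lim by eventually_elim (intro tendsto_intros)
    show "(\<lambda>x. f n x - S x) \<in> L2 M" "L2_norm M (\<lambda>x. f n x - S x) \<le> \<epsilon>"
      by (rule L2_norm_le_of_AE_tendsto[OF L2_diff[OF f f] _ l ev]; simp)+
  qed
  obtain n0 where "\<forall>m\<ge>n0. \<forall>n\<ge>n0. L2_norm M (\<lambda>x. f m x - f n x) < 1"
    using cauchy[of 1] by auto
  hence "(\<lambda>x. f n0 x - S x) \<in> L2 M"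
    using *[of n0 n0 1] by simp
  from L2_diff[OF f[of n0] this] have "S \<in> L2 M" by simp
  moreover have "(\<lambda>n. L2_norm M (\<lambda>x. f n x - S x)) \<longlonglongrightarrow> 0"
  proof (rule LIMSEQ_I)
    fix \<epsilon> :: real assume "\<epsilon> > 0"
    then obtain n0 where n0: "\<forall>m\<ge>n0. \<forall>n\<ge>n0. L2_norm M (\<lambda>x. f m x - f n x) < \<epsilon> / 2"
      using cauchy[of "\<epsilon> / 2"] by auto
    have "norm (L2_norm M (\<lambda>x. f n x - S x) - 0) < \<epsilon>" if "n \<ge> n0" for n
      using *[of n0 n "\<epsilon> / 2"] n0 that \<open>\<epsilon> > 0\<close> L2_norm_nonneg[of M "\<lambda>x. f n x - S x"] by auto
    thus "\<exists>n0. \<forall>n\<ge>n0. norm (L2_norm M (\<lambda>x. f n x - S x) - 0) < \<epsilon>" by blast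
  qed
  ultimately show ?thesis by blast
qed

text \<open>The Cauchy property is inherited from a convergent sequence in another space. This
  serves the Fourier transform and its inverse alike, where Plancherel provides the comparison of
  norms.\<close>

lemma L2_complete_of_tendsto:
  fixes f :: "nat \<Rightarrow> 'a \<Rightarrow> complex" and g :: "nat \<Rightarrow> 'b \<Rightarrow> complex"
  assumes f: "\<And>n. f n \<in> L2 M" and g: "\<And>n. g n \<in> L2 M'" and G: "G \<in> L2 M'"
    and lim: "(\<lambda>n. L2_norm M' (\<lambda>x. g n x - G x)) \<longlonglongrightarrow> 0"
    and le: "\<And>m n. L2_norm M (\<lambda>x. f m x - f n x) \<le> L2_norm M' (\<lambda>x. g m x - g n x)"
  shows "\<exists>S\<in>L2 M. (\<lambda>n. L2_norm M (\<lambda>x. f n x - S x)) \<longlonglongrightarrow> 0"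
proof (rule L2_complete[OF f])
  fix \<epsilon> :: real assume "\<epsilon> > 0"
  then obtain n0 where n0: "\<And>n. n \<ge> n0 \<Longrightarrow> L2_norm M' (\<lambda>x. g n x - G x) < \<epsilon> / 2"
    using LIMSEQ_D[OF lim, of "\<epsilon> / 2"] by fastforce
  have "L2_norm M (\<lambda>x. f m x - f n x) < \<epsilon>" if "m \<ge> n0" "n \<ge> n0" for m n
    using le[of m n] L2_norm_triangle[OF g[of m] G g[of n]] n0[OF that(1)] n0[OF that(2)]
      L2_norm_minus_commute[of M' G "g n"] by linarith
  thus "\<exists>n0. \<forall>m\<ge>n0. \<forall>n\<ge>n0. L2_norm M (\<lambda>x. f m x - f n x) < \<epsilon>" by blast
qed

text \<open>Since the inner product is expressed by norms alone, a linear correspondence that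
  preserves norms preserves inner products.\<close>

lemma L2_inner_polarization:
  assumes "f \<in> L2 M" "g \<in> L2 M"
  shows "(LINT x|M. f x * cnj (g x)) =
    of_real (((L2_norm M (\<lambda>x. f x + g x))\<^sup>2 - (L2_norm M f)\<^sup>2 - (L2_norm M g)\<^sup>2) / 2) +
    \<i> * of_real (((L2_norm M (\<lambda>x. f x + \<i> * g x))\<^sup>2 - (L2_norm M f)\<^sup>2 - (L2_norm M g)\<^sup>2) / 2)"
proof -
  have int: "integrable M (\<lambda>x. f x * cnj (g x))" by (rule L2_mult_integrable[OF assms])
  define R where "R = (\<lambda>x. Re (f x * cnj (g x)))"
  define J where "J = (\<lambda>x. Im (f x * cnj (g x)))"
  have ri: "integrable M R" "integrable M J"
    unfolding R_def J_def by (rule integrable_Re[OF int], rule integrable_Im[OF int])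
  note fi = L2_integrable[OF assms(1)] and gi = L2_integrable[OF assms(2)]
  have 1: "(cmod (a + b))\<^sup>2 = (cmod a)\<^sup>2 + (cmod b)\<^sup>2 + 2 * Re (a * cnj b)" for a b
    by (simp add: cmod_power2 power2_sum)
  have 2: "(cmod (a + \<i> * b))\<^sup>2 = (cmod a)\<^sup>2 + (cmod b)\<^sup>2 + 2 * Im (a * cnj b)" for a b
    by (simp add: cmod_power2 power2_sum power2_diff)
  have "(L2_norm M (\<lambda>x. f x + g x))\<^sup>2 = (L2_norm M f)\<^sup>2 + (L2_norm M g)\<^sup>2 + 2 * (LINT x|M. R x)"
    unfolding L2_norm_power2 1 R_def[THEN fun_cong, symmetric] using fi gi ri by simp
  moreover have "(L2_norm M (\<lambda>x. f x + \<i> * g x))\<^sup>2 = (L2_norm M f)\<^sup>2 + (L2_norm M g)\<^sup>2 + 2 * (LINT x|M. J x)"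
    unfolding L2_norm_power2 2 J_def[THEN fun_cong, symmetric] using fi gi ri by simp
  moreover have "(LINT x|M. R x) = Re (LINT x|M. f x * cnj (g x))"
      "(LINT x|M. J x) = Im (LINT x|M. f x * cnj (g x))"
    unfolding R_def J_def by (rule integral_Re[OF int], rule integral_Im[OF int])
  ultimately show ?thesis
    by (simp add: complex_eq_iff)
qed

section \<open>Orthonormal systems and Riesz bases\<close>

lemma orthonormal_sum_norm:
  assumes e: "\<And>i. i \<in> F \<Longrightarrow> e i \<in> L2 M" and o: "biorthogonal M e e F" and F: "finite F"
  shows "(L2_norm M (\<lambda>x. \<Sum>i\<in>F. c i * e i x))\<^sup>2 = (\<Sum>i\<in>F. (cmod (c i))\<^sup>2)"
proof -
  have "complex_of_real ((L2_norm M (\<lambda>x. \<Sum>i\<in>F. c i * e i x))\<^sup>2) =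
      (LINT x|M. of_real ((cmod (\<Sum>i\<in>F. c i * e i x))\<^sup>2))"
    unfolding L2_norm_power2 by (rule integral_complex_of_real[symmetric])
  also have "\<dots> = (LINT x|M. (\<Sum>i\<in>F. \<Sum>j\<in>F. c i * cnj (c j) * (e i x * cnj (e j x))))"
    by (simp only: complex_norm_square cnj_sum complex_cnj_mult sum_product) (simp only: mult_ac)
  also have "\<dots> = (\<Sum>i\<in>F. \<Sum>j\<in>F. c i * cnj (c j) * (if i = j then 1 else 0))"
    using o F unfolding biorthogonal_def by (subst Bochner_Integration.integral_sum; force)
  also have "\<dots> = of_real (\<Sum>i\<in>F. (cmod (c i))\<^sup>2)"
    using F by (simp add: if_distrib[of "(*) _"] complex_norm_square[symmetric] cong: if_cong)
  finally show ?thesis by (simp only: of_real_eq_iff)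
qed

text \<open>By Pythagoras, the tails of the sum of squared coefficients are the squared norms of
  differences of partial sums. Convergence is along the directed set of finite subsets, so a
  sequence of finite sets \<open>G n\<close> is extracted first and completeness is applied to
  it.\<close>

lemma orthonormal_L2_has_sum:
  assumes e: "\<And>i. i \<in> I \<Longrightarrow> e i \<in> L2 M" and o: "biorthogonal M e e I"
    and c: "(\<lambda>i. (cmod (c i))\<^sup>2) summable_on I"
  shows "\<exists>S. L2_has_sum M (\<lambda>i x. c i * e i x) I S \<and> (L2_norm M S)\<^sup>2 = (\<Sum>\<^sub>\<infinity>i\<in>I. (cmod (c i))\<^sup>2)"
proof -
  define T where "T F = (\<lambda>x. \<Sum>i\<in>F. c i * e i x)" for F
  have T: "T F \<in> L2 M" if "F \<subseteq> I" for F
    unfolding T_def using that e by (intro L2_sum L2_cmult) auto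
  have o': "biorthogonal M e e F" if "F \<subseteq> I" for F
    using o that unfolding biorthogonal_def by blast
  have nT: "(L2_norm M (T F))\<^sup>2 = (\<Sum>i\<in>F. (cmod (c i))\<^sup>2)" if "finite F" "F \<subseteq> I" for F
    unfolding T_def using that e by (intro orthonormal_sum_norm o') auto
  define s where "s = (\<Sum>\<^sub>\<infinity>i\<in>I. (cmod (c i))\<^sup>2)"
  have lim: "((\<lambda>F. \<Sum>i\<in>F. (cmod (c i))\<^sup>2) \<longlongrightarrow> s) (finite_subsets_at_top I)"
    using c unfolding s_def by (simp add: has_sum_infsum has_sum_def[symmetric])
  have le_s: "(\<Sum>i\<in>F. (cmod (c i))\<^sup>2) \<le> s" if "finite F" "F \<subseteq> I" for F
    unfolding s_def using that c by (intro finite_sum_le_infsum) auto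
  have "\<exists>F. finite F \<and> F \<subseteq> I \<and> s - (\<Sum>i\<in>F. (cmod (c i))\<^sup>2) < \<epsilon>" if "\<epsilon> > 0" for \<epsilon>
  proof -
    have "\<forall>\<^sub>F F in finite_subsets_at_top I. (\<Sum>i\<in>F. (cmod (c i))\<^sup>2) > s - \<epsilon>"
      using order_tendstoD(1)[OF lim, of "s - \<epsilon>"] that by simp
    thus ?thesis unfolding eventually_finite_subsets_at_top by force
  qed
  \<comment> \<open>The rate is squared so that \<open>close\<close> below bounds norms, and not
    their squares, by a power of 1/2.\<close>
  hence "\<forall>n. \<exists>F. finite F \<and> F \<subseteq> I \<and> s - (\<Sum>i\<in>F. (cmod (c i))\<^sup>2) < ((1/2) ^ n)\<^sup>2"
    by simp
  then obtain G where G: "\<And>n. finite (G n)" "\<And>n. G n \<subseteq> I"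
      "\<And>n. s - (\<Sum>i\<in>G n. (cmod (c i))\<^sup>2) < ((1/2) ^ n)\<^sup>2"
    by metis
  have close: "L2_norm M (\<lambda>x. T F x - T (G n) x) \<le> (1/2) ^ n"
    if F: "finite F" "F \<subseteq> I" "G n \<subseteq> F" for F n
  proof -
    have "(\<lambda>x. T F x - T (G n) x) = T (F - G n)"
      unfolding T_def using F by (intro ext) (simp add: sum_diff)
    moreover have "(L2_norm M (T (F - G n)))\<^sup>2 \<le> ((1/2) ^ n)\<^sup>2"
    proof -
      have "(L2_norm M (T (F - G n)))\<^sup>2 = (\<Sum>i\<in>F - G n. (cmod (c i))\<^sup>2)"
        using F by (intro nT) auto
      also have "\<dots> = (\<Sum>i\<in>F. (cmod (c i))\<^sup>2) - (\<Sum>i\<in>G n. (cmod (c i))\<^sup>2)"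
        using sum_diff[OF F(1,3)] .
      finally show ?thesis using le_s[OF F(1,2)] G(3)[of n] by linarith
    qed
    ultimately show ?thesis
      by (simp only:) (rule power2_le_imp_le, auto)
  qed
  \<comment> \<open>The sets \<open>G n\<close> need not be nested, so both partial sums are
    compared with the one over the union.\<close>
  have close2: "L2_norm M (\<lambda>x. T (G m) x - T (G n) x) \<le> (1/2) ^ m + (1/2) ^ n" for m n
  proof -
    have "L2_norm M (\<lambda>x. T (G m \<union> G n) x - T (G m) x) \<le> (1/2) ^ m"
         "L2_norm M (\<lambda>x. T (G m \<union> G n) x - T (G n) x) \<le> (1/2) ^ n"
      using G by (auto intro!: close)
    thus ?thesis
      using L2_norm_triangle[OF T[OF G(2)[of m]] T[of "G m \<union> G n"] T[OF G(2)[of n]]] G(2)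
        L2_norm_minus_commute[of M "T (G m)" "T (G m \<union> G n)"] by auto
  qed
  have "\<exists>S\<in>L2 M. (\<lambda>n. L2_norm M (\<lambda>x. T (G n) x - S x)) \<longlonglongrightarrow> 0"
  proof (rule L2_complete)
    fix \<epsilon> :: real assume e: "\<epsilon> > 0"
    obtain n0 where n0: "(1/2) ^ n0 < \<epsilon> / 2"
      using real_arch_pow_inv[of "\<epsilon> / 2" "1/2"] e by auto
    have "L2_norm M (\<lambda>x. T (G m) x - T (G n) x) < \<epsilon>" if "m \<ge> n0" "n \<ge> n0" for m n
    proof -
      have "(1/2) ^ m \<le> (1/2 :: real) ^ n0" "(1/2) ^ n \<le> (1/2 :: real) ^ n0"
        using that by (intro power_decreasing; simp)+
      with close2[of m n] n0 show ?thesis by linarith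
    qed
    thus "\<exists>n0. \<forall>m\<ge>n0. \<forall>n\<ge>n0. L2_norm M (\<lambda>x. T (G m) x - T (G n) x) < \<epsilon>" by blast
  qed (use T G in auto)
  then obtain S where S: "S \<in> L2 M" and Slim: "(\<lambda>n. L2_norm M (\<lambda>x. T (G n) x - S x)) \<longlonglongrightarrow> 0"
    by blast
  have conv: "((\<lambda>F. L2_norm M (\<lambda>x. T F x - S x)) \<longlongrightarrow> 0) (finite_subsets_at_top I)"
  proof (rule tendstoI)
    fix \<epsilon> :: real assume e: "\<epsilon> > 0"
    have "\<forall>\<^sub>F n in sequentially. L2_norm M (\<lambda>x. T (G n) x - S x) < \<epsilon> / 2 \<and> (1/2) ^ n < \<epsilon> / 2"
      using order_tendstoD(2)[OF Slim, of "\<epsilon> / 2"] e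
        order_tendstoD(2)[OF LIMSEQ_realpow_zero[of "1/2"], of "\<epsilon> / 2"]
      by (auto intro: eventually_conj)
    then obtain n where n: "L2_norm M (\<lambda>x. T (G n) x - S x) < \<epsilon> / 2" "(1/2) ^ n < \<epsilon> / 2"
      by (auto simp: eventually_sequentially)
    have "dist (L2_norm M (\<lambda>x. T F x - S x)) 0 < \<epsilon>" if F: "finite F" "G n \<subseteq> F" "F \<subseteq> I" for F
      using L2_norm_triangle[OF T[OF F(3)] T[OF G(2)[of n]] S] close[OF F(1,3,2)] n
        L2_norm_nonneg[of M "\<lambda>x. T F x - S x"] by simp
    thus "\<forall>\<^sub>F F in finite_subsets_at_top I. dist (L2_norm M (\<lambda>x. T F x - S x)) 0 < \<epsilon>"
      unfolding eventually_finite_subsets_at_top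
      by (intro exI[of _ "G n"]) (simp add: G)
  qed
  have "(\<lambda>n. (L2_norm M (T (G n)))\<^sup>2) \<longlonglongrightarrow> (L2_norm M S)\<^sup>2"
    by (intro tendsto_power L2_norm_tendsto Slim S T G)
  moreover have "(\<lambda>n. (L2_norm M (T (G n)))\<^sup>2) \<longlonglongrightarrow> s"
  proof -
    have "(\<lambda>n. s - (L2_norm M (T (G n)))\<^sup>2) \<longlonglongrightarrow> 0"
    proof (rule tendsto_sandwich[of "\<lambda>_. 0" _ _ "\<lambda>n. ((1/2) ^ n)\<^sup>2"])
      show "(\<lambda>n. ((1/2) ^ n :: real)\<^sup>2) \<longlonglongrightarrow> 0"
        using tendsto_power[OF LIMSEQ_realpow_zero[of "1/2"], of 2] by simp
    qed (use nT[OF G(1,2)] le_s[OF G(1,2)] less_imp_le[OF G(3)] in \<open>auto intro!: always_eventually\<close>)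
    from tendsto_diff[OF tendsto_const[of s] this] show ?thesis by simp
  qed
  ultimately have "(L2_norm M S)\<^sup>2 = s" by (rule LIMSEQ_unique)
  with S conv show ?thesis unfolding L2_has_sum_def T_def s_def by blast
qed

text \<open>Multiplication by \<open>G\<close> is a bounded invertible operator on L2, and such an
  operator carries an orthonormal basis to a Riesz basis. The two bounds on \<open>G\<close> become
  the Riesz constants; multiplication by the inverse gives density of the span.\<close>

lemma riesz_basis_orthonormal_mult:
  assumes e: "\<And>i. i \<in> I \<Longrightarrow> e i \<in> L2 M" and o: "biorthogonal M e e I"
    and complete: "L2_closed_span M e I = L2 M"
    and G: "G \<in> borel_measurable M" and A: "A > 0"
    and bd: "\<And>x. A \<le> (cmod (G x))\<^sup>2" "\<And>x. (cmod (G x))\<^sup>2 \<le> B"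
  shows "riesz_basis M (\<lambda>i x. G x * e i x) I"
proof -
  have B: "B > 0" using A bd[of undefined] by linarith
  have cG: "cmod (G x) \<le> sqrt B" for x
    using bd(2)[of x] by (simp add: real_le_rsqrt)
  have GL2: "(\<lambda>x. G x * f x) \<in> L2 M" "L2_norm M (\<lambda>x. G x * f x) \<le> sqrt B * L2_norm M f" if "f \<in> L2 M" for f
    using L2_bounded_mult[OF that G cG] by auto
  have ge: "A * (L2_norm M f)\<^sup>2 \<le> (L2_norm M (\<lambda>x. G x * f x))\<^sup>2"
    if f: "f \<in> L2 M" for f
    unfolding L2_norm_power2
  proof (subst integral_mult_right_zero[symmetric], rule integral_mono)
    show "A * (cmod (f x))\<^sup>2 \<le> (cmod (G x * f x))\<^sup>2" for x
      using bd(1)[of x] by (simp add: norm_mult power_mult_distrib mult_right_mono)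
  qed (use L2_integrable f GL2(1)[OF f] in auto)
  have "riesz_system M A B (\<lambda>i x. G x * e i x) I"
    unfolding riesz_system_def
  proof (intro conjI A B ballI allI impI)
    fix i assume "i \<in> I" thus "(\<lambda>x. G x * e i x) \<in> L2 M" using GL2 e by auto
  next
    fix c :: "'a \<Rightarrow> complex" assume c: "(\<lambda>j. (cmod (c j))\<^sup>2) summable_on I"
    obtain S where S: "S \<in> L2 M"
        "((\<lambda>F. L2_norm M (\<lambda>x. (\<Sum>j\<in>F. c j * e j x) - S x)) \<longlongrightarrow> 0) (finite_subsets_at_top I)"
        "(L2_norm M S)\<^sup>2 = (\<Sum>\<^sub>\<infinity>i\<in>I. (cmod (c i))\<^sup>2)"
      using orthonormal_L2_has_sum[OF e o c] unfolding L2_has_sum_def by auto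
    show "\<exists>S. L2_has_sum M (\<lambda>j x. c j * (G x * e j x)) I S \<and>
             A * (\<Sum>\<^sub>\<infinity>j\<in>I. (cmod (c j))\<^sup>2) \<le> (L2_norm M S)\<^sup>2 \<and>
             (L2_norm M S)\<^sup>2 \<le> B * (\<Sum>\<^sub>\<infinity>j\<in>I. (cmod (c j))\<^sup>2)"
    proof (intro exI[of _ "\<lambda>x. G x * S x"] conjI)
      show "L2_has_sum M (\<lambda>j x. c j * (G x * e j x)) I (\<lambda>x. G x * S x)"
        unfolding L2_has_sum_def
      proof (intro conjI GL2 S)
        have "((\<lambda>F. sqrt B * L2_norm M (\<lambda>x. (\<Sum>j\<in>F. c j * e j x) - S x)) \<longlongrightarrow> 0) (finite_subsets_at_top I)"
          using tendsto_mult[OF tendsto_const S(2), of "sqrt B"] by simp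
        moreover have "\<forall>\<^sub>F F in finite_subsets_at_top I.
            norm (L2_norm M (\<lambda>x. (\<Sum>j\<in>F. c j * (G x * e j x)) - G x * S x))
            \<le> sqrt B * L2_norm M (\<lambda>x. (\<Sum>j\<in>F. c j * e j x) - S x)"
        proof (rule eventually_finite_subsets_at_top_weakI)
          fix F assume "finite F" "F \<subseteq> I"
          hence "(\<lambda>x. (\<Sum>j\<in>F. c j * e j x) - S x) \<in> L2 M"
            using e by (intro L2_diff S L2_sum L2_cmult) auto
          from GL2(2)[OF this]
          show "norm (L2_norm M (\<lambda>x. (\<Sum>j\<in>F. c j * (G x * e j x)) - G x * S x))
            \<le> sqrt B * L2_norm M (\<lambda>x. (\<Sum>j\<in>F. c j * e j x) - S x)"
            by (simp add: algebra_simps sum_distrib_left L2_norm_nonneg)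
        qed
        ultimately show "((\<lambda>F. L2_norm M (\<lambda>x. (\<Sum>j\<in>F. c j * (G x * e j x)) - G x * S x)) \<longlongrightarrow> 0)
            (finite_subsets_at_top I)"
          by (rule Lim_null_comparison[rotated])
      qed
      show "A * (\<Sum>\<^sub>\<infinity>j\<in>I. (cmod (c j))\<^sup>2) \<le> (L2_norm M (\<lambda>x. G x * S x))\<^sup>2"
        using ge[OF S(1)] S(3) by simp
      have "(L2_norm M (\<lambda>x. G x * S x))\<^sup>2 \<le> (sqrt B * L2_norm M S)\<^sup>2"
        using GL2(2)[OF S(1)] by (intro power_mono L2_norm_nonneg)
      thus "(L2_norm M (\<lambda>x. G x * S x))\<^sup>2 \<le> B * (\<Sum>\<^sub>\<infinity>j\<in>I. (cmod (c j))\<^sup>2)"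
        using B S(3) by (simp add: power_mult_distrib)
    qed
  qed
  moreover have "L2_closed_span M (\<lambda>i x. G x * e i x) I = L2 M"
  proof (intro equalityI subsetI)
    fix f assume f: "f \<in> L2 M"
    have G0: "G x \<noteq> 0" for x using bd(1)[of x] A by auto
    have f': "(\<lambda>x. inverse (G x) * f x) \<in> L2 M"
    proof (rule L2_bounded_mult(1)[OF f])
      show "cmod (inverse (G x)) \<le> inverse (sqrt A)" for x
      proof -
        have "sqrt A \<le> cmod (G x)" using bd(1)[of x] by (intro real_le_lsqrt) auto
        thus ?thesis using A by (simp add: norm_inverse le_imp_inverse_le)
      qed
    qed (use G in measurable)
    show "f \<in> L2_closed_span M (\<lambda>i x. G x * e i x) I"
      unfolding L2_closed_span_def
    proof (intro CollectI conjI f allI impI)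
      fix \<epsilon> :: real assume "\<epsilon> > 0"
      hence "\<epsilon> / sqrt B > 0" using B by simp
      moreover have "\<forall>\<delta>>0. \<exists>F c. finite F \<and> F \<subseteq> I \<and>
          L2_norm M (\<lambda>x. inverse (G x) * f x - (\<Sum>j\<in>F. c j * e j x)) < \<delta>"
        using f'[folded complete] by (simp add: L2_closed_span_def)
      ultimately obtain F c where F: "finite F" "F \<subseteq> I"
        and lt: "L2_norm M (\<lambda>x. inverse (G x) * f x - (\<Sum>j\<in>F. c j * e j x)) < \<epsilon> / sqrt B"
        by metis
      have "(\<lambda>x. inverse (G x) * f x - (\<Sum>j\<in>F. c j * e j x)) \<in> L2 M"
        using F e by (intro L2_diff f' L2_sum L2_cmult) auto
      from GL2(2)[OF this]
      have "L2_norm M (\<lambda>x. f x - (\<Sum>j\<in>F. c j * (G x * e j x)))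
          \<le> sqrt B * L2_norm M (\<lambda>x. inverse (G x) * f x - (\<Sum>j\<in>F. c j * e j x))"
        using G0 by (simp add: right_diff_distrib sum_distrib_left mult.left_commute mult.assoc[symmetric])
      also have "\<dots> < \<epsilon>"
        using lt B by (simp add: field_simps)
      finally show "\<exists>F c. finite F \<and> F \<subseteq> I \<and> L2_norm M (\<lambda>x. f x - (\<Sum>j\<in>F. c j * (G x * e j x))) < \<epsilon>"
        using F by blast
    qed
  qed (auto simp: L2_closed_span_def)
  ultimately show ?thesis unfolding riesz_basis_def by blast
qed

section \<open>Self-duality of the local field\<close>

lemma char_app_add: "char_app \<xi> (x + y) = char_app \<xi> x * char_app \<xi> y"
  and norm_char_app: "cmod (char_app \<xi> x) = 1"
  and continuous_on_char_app: "continuous_on UNIV (char_app \<xi>)"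
  using char_app[of \<xi>] by auto

lemma char_app_0 [simp]: "char_app \<xi> 0 = 1"
proof -
  have "char_app \<xi> 0 * char_app \<xi> 0 = char_app \<xi> 0" using char_app_add[of \<xi> 0 0] by simp
  moreover have "char_app \<xi> 0 \<noteq> 0" using norm_char_app[of \<xi> 0] by auto
  ultimately show ?thesis by simp
qed

lemma character_eqI: "(\<And>x. char_app \<xi> x = char_app \<eta> x) \<Longrightarrow> \<xi> = \<eta>"
  by (simp add: char_app_inject[symmetric] fun_eq_iff)

definition fls_monom :: "int \<Rightarrow> 'k::field \<Rightarrow> 'k fls" where
  "fls_monom k u = fls_const u * fls_X_intpow k"

lemma fls_monom_nth [simp]: "fls_monom k u $$ j = (if j = k then u else 0)"
  by (auto simp: fls_monom_def)

lemma Abs_fls_nth: "(\<And>j. j < k \<Longrightarrow> f j = 0) \<Longrightarrow> Abs_fls f $$ j = f j"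
  by (rule nth_Abs_fls_lower_bound[of k]) auto

lemma mem_fls_ball: "x \<in> fls_ball n \<longleftrightarrow> (\<forall>j<n. x $$ j = 0)"
  by (simp add: fls_ball_def)

text \<open>The coset of \<open>fls_ball m\<close> through \<open>a\<close>. Haar measure, integrals
  of characters and Fourier transforms are first computed on such cosets.\<close>

definition cyl :: "'k::field fls \<Rightarrow> int \<Rightarrow> 'k fls set" where
  "cyl a m = {x. \<forall>j<m. x $$ j = a $$ j}"

lemma mem_cyl: "x \<in> cyl a m \<longleftrightarrow> (\<forall>j<m. x $$ j = a $$ j)"
  by (simp add: cyl_def)

lemma cyl_dist_lt:
  assumes "e > 0" shows "\<exists>n. \<forall>x :: 'k::field fls. \<forall>y\<in>cyl x (int n). dist y x < e"
proof -
  obtain n where n: "inverse (2 ^ n) < e"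
    using real_arch_pow_inv[OF assms, of "1/2"] by (auto simp: power_one_over inverse_eq_divide)
  have "dist y x < e" if "y \<in> cyl x (int n)" for x y :: "'k fls"
  proof (cases "y = x")
    case False
    have sub: "fls_subdegree (y - x) \<ge> int n"
      by (rule fls_subdegree_geI) (use that False in \<open>auto simp: mem_cyl\<close>)
    hence "(2::real) ^ n \<le> 2 ^ nat (fls_subdegree (y - x))" by (intro power_increasing) auto
    hence "inverse ((2::real) ^ nat (fls_subdegree (y - x))) \<le> inverse (2 ^ n)"
      by (intro le_imp_inverse_le) auto
    hence "dist y x \<le> inverse (2 ^ n)"
      using False sub unfolding dist_fls_def by simp
    with n show ?thesis by linarith
  qed (use assms in simp)
  thus ?thesis by blast
qed

lemma sum_fls_nth: "(\<Sum>i\<in>A. f i) $$ j = (\<Sum>i\<in>A. f i $$ j :: 'k::field)"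
  by (induction A rule: infinite_finite_induct) auto

section \<open>Characters of the finite field\<close>

locale gf_coordinates =
  fixes p s :: nat and c :: "'k::{field,finite} \<Rightarrow> nat \<Rightarrow> nat"
  assumes prime: "prime p" and card: "CARD('k) = p ^ s" and coords: "gf_coords p s c"
begin

definition q :: real where "q = real p ^ s"

lemma of_nat_card: "q > 0" "real CARD('k) = q"
  using prime by (auto simp: card q_def prime_gt_0_nat)

definition gf_pair :: "'k \<Rightarrow> 'k \<Rightarrow> complex" where
  "gf_pair u a = exp (2 * of_real pi * \<i> / of_nat p * of_nat (\<Sum>l<s. c u l * c a l))"

lemma p_pos: "p > 0" "p > 1"
  using prime prime_gt_1_nat by (auto simp: prime_gt_0_nat)

lemma char_app_rchar': "char_app (rchar p s c k u) x = gf_pair u (x $$ k)"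
  unfolding gf_pair_def by (rule char_app_rchar[OF coords p_pos(1)])

lemma gf_pair_commute: "gf_pair u a = gf_pair a u"
  by (simp add: gf_pair_def mult.commute)

lemma gf_pair_add: "gf_pair u (a + b) = gf_pair u a * gf_pair u b"
  using char_app_add[of "rchar p s c 0 u" "fls_const a" "fls_const b"]
  by (simp add: char_app_rchar')

lemma gf_pair_add_left: "gf_pair (u + v) a = gf_pair u a * gf_pair v a"
  using gf_pair_add by (metis gf_pair_commute)

lemma norm_gf_pair: "cmod (gf_pair u a) = 1"
  using norm_char_app[of "rchar p s c 0 u" "fls_const a"] by (simp add: char_app_rchar')

lemma gf_pair_0 [simp]: "gf_pair u 0 = 1" "gf_pair 0 u = 1"
proof -
  show "gf_pair u 0 = 1" using gf_pair_add[of u 0 0] norm_gf_pair[of u 0] by auto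
  thus "gf_pair 0 u = 1" by (simp add: gf_pair_commute)
qed

text \<open>Some coordinate \<open>l\<close> of \<open>u\<close> is nonzero. Pairing with the
  element whose only nonzero coordinate is a 1 at \<open>l\<close> gives a power of the primitive
  root of unity with exponent strictly between 0 and \<open>p\<close>.\<close>

lemma gf_pair_nondegenerate:
  assumes "u \<noteq> 0" shows "\<exists>a. gf_pair u a \<noteq> 1"
proof -
  have bij: "bij_betw c UNIV ({..<s} \<rightarrow>\<^sub>E {..<p})"
    and add: "\<And>a b l. l < s \<Longrightarrow> c (a + b) l = (c a l + c b l) mod p"
    using coords by (auto simp: gf_coords_def)
  have lt: "c a l < p" if "l < s" for a l
    using bij that by (auto simp: bij_betw_def PiE_iff)
  have c0: "c 0 l = 0" if "l < s" for l
  proof -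
    have "c 0 l = (c 0 l + c 0 l) mod p" using add[OF that, of 0 0] by simp
    thus ?thesis using lt[OF that, of 0]
      by (cases "c 0 l + c 0 l < p") (auto simp: le_mod_geq)
  qed
  obtain l where l: "l < s" "c u l \<noteq> 0"
  proof -
    have "c u \<noteq> c 0" using bij assms by (auto simp: bij_betw_def inj_def)
    moreover have "c u \<in> extensional {..<s}" "c 0 \<in> extensional {..<s}"
      using bij by (auto simp: bij_betw_def PiE_def)
    ultimately obtain l where "l < s" "c u l \<noteq> c 0 l"
      by (metis extensionalityI lessThan_iff)
    with c0 that show thesis by auto
  qed
  have "(\<lambda>j\<in>{..<s}. if j = l then 1 else 0) \<in> {..<s} \<rightarrow>\<^sub>E {..<p}"
    using p_pos by auto
  then obtain a where a: "c a = (\<lambda>j\<in>{..<s}. if j = l then 1 else 0)"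
    using bij unfolding bij_betw_def by (metis imageE)
  have "(\<Sum>j<s. c u j * c a j) = c u l"
    using l by (simp add: a if_distrib[of "(*) _"] cong: if_cong)
  hence e: "gf_pair u a = exp (2 * of_real pi * \<i> / of_nat p * of_nat (c u l))"
    by (simp add: gf_pair_def)
  have "gf_pair u a \<noteq> 1"
  proof
    assume "gf_pair u a = 1"
    then obtain n :: int where n: "Im (2 * of_real pi * \<i> / of_nat p * of_nat (c u l)) = of_int (2 * n) * pi"
      unfolding e exp_eq_1 by auto
    have "2 * pi * real (c u l) / real p = of_int (2 * n) * pi"
      using n by (simp add: Im_divide_of_nat)
    hence "real (c u l) = of_int n * real p"
      using p_pos by (simp add: field_simps)
    hence "real_of_int (int (c u l)) = real_of_int (n * int p)" by simp
    hence "int (c u l) = n * int p" by (simp only: of_int_eq_iff)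
    hence "int p dvd int (c u l)" by simp
    hence "p dvd c u l" by simp
    with l lt[OF l(1), of u] show False by (auto dest: dvd_imp_le)
  qed
  thus ?thesis by blast
qed

lemma gf_pair_eq_iff: "(\<forall>a. gf_pair u a = gf_pair v a) \<longleftrightarrow> u = v"
proof
  assume *: "\<forall>a. gf_pair u a = gf_pair v a"
  have "gf_pair (u - v) a = 1" for a
  proof -
    have "gf_pair u a = gf_pair (u - v) a * gf_pair v a"
      using gf_pair_add_left[of "u - v" v a] by simp
    moreover have "gf_pair u a \<noteq> 0" using norm_gf_pair[of u a] by auto
    ultimately show ?thesis using * by auto
  qed
  thus "u = v" using gf_pair_nondegenerate[of "u - v"] by auto
qed auto

lemma sum_gf_pair: "(\<Sum>a\<in>UNIV. gf_pair u a) = (if u = 0 then of_real q else 0)"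
proof (cases "u = 0")
  case True
  have "(of_nat CARD('k) :: complex) = of_real q"
    by (metis of_nat_card(2) of_real_of_nat_eq)
  with True show ?thesis by simp
next
  case False
  then obtain b where b: "gf_pair u b \<noteq> 1" using gf_pair_nondegenerate by blast
  have "(\<Sum>a\<in>UNIV. gf_pair u a) = (\<Sum>a\<in>UNIV. gf_pair u (a + b))"
    by (rule sum.reindex_bij_witness[of _ "\<lambda>a. a + b" "\<lambda>a. a - b"]) auto
  also have "\<dots> = gf_pair u b * (\<Sum>a\<in>UNIV. gf_pair u a)"
    by (simp add: gf_pair_add sum_distrib_left mult.commute)
  finally show ?thesis using b False by simp
qed

text \<open>A character \<open>\<theta>\<close> different from all pairings would be orthogonal to
  each of them; summing these relations over \<open>u\<close> isolates the term \<open>a = 0\<close>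
  and gives \<open>q = 0\<close>.\<close>

lemma gf_character_eq_gf_pair:
  assumes add: "\<And>a b. \<theta> (a + b) = \<theta> a * \<theta> b" and 0: "\<theta> 0 = 1"
  shows "\<exists>u. \<forall>a. \<theta> a = gf_pair u a"
proof (rule ccontr)
  assume no: "\<not> ?thesis"
  have S: "(\<Sum>a\<in>UNIV. \<theta> a * cnj (gf_pair u a)) = 0" for u
  proof -
    obtain b where b: "\<theta> b \<noteq> gf_pair u b" using no by blast
    have "gf_pair u b * cnj (gf_pair u b) = 1"
      using norm_gf_pair[of u b] by (simp add: complex_norm_square[symmetric])
    with b have b1: "\<theta> b * cnj (gf_pair u b) \<noteq> 1"
      by (metis mult.assoc mult.commute mult.right_neutral)
    have "(\<Sum>a\<in>UNIV. \<theta> a * cnj (gf_pair u a)) = (\<Sum>a\<in>UNIV. \<theta> (a + b) * cnj (gf_pair u (a + b)))"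
      by (rule sum.reindex_bij_witness[of _ "\<lambda>a. a + b" "\<lambda>a. a - b"]) auto
    also have "\<dots> = \<theta> b * cnj (gf_pair u b) * (\<Sum>a\<in>UNIV. \<theta> a * cnj (gf_pair u a))"
      by (simp add: add gf_pair_add sum_distrib_left mult_ac)
    finally show ?thesis using b1 by simp
  qed
  have "0 = (\<Sum>u\<in>UNIV. \<Sum>a\<in>UNIV. \<theta> a * cnj (gf_pair u a))" by (simp add: S)
  also have "\<dots> = (\<Sum>a\<in>UNIV. \<theta> a * cnj (\<Sum>u\<in>UNIV. gf_pair a u))"
    by (subst sum.swap) (simp add: sum_distrib_left gf_pair_commute)
  also have "\<dots> = of_real q"
    by (simp add: sum_gf_pair if_distrib[of "(*) _"] if_distrib[of cnj] 0 cong: if_cong)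
  finally show False using of_nat_card by simp
qed

text \<open>The product runs over the finitely many indices where both digits are nonzero, so no
  convergence question arises. The reflection \<open>-1 - j\<close> makes the pairing symmetric in
  its two arguments.\<close>

definition pair :: "'k fls \<Rightarrow> 'k fls \<Rightarrow> complex" where
  "pair b x = (\<Prod>j | b $$ (-1 - j) \<noteq> 0 \<and> x $$ j \<noteq> 0. gf_pair (b $$ (-1 - j)) (x $$ j))"

lemma pair_eq_prod:
  assumes "finite J" "\<And>j. j \<notin> J \<Longrightarrow> b $$ (-1 - j) = 0 \<or> x $$ j = 0"
  shows "pair b x = (\<Prod>j\<in>J. gf_pair (b $$ (-1 - j)) (x $$ j))"
  unfolding pair_def using assms by (intro prod.mono_neutral_left) auto

lemma pair_eq_prod_interval:
  assumes "m \<le> fls_subdegree x" "k \<le> fls_subdegree b"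
  shows "pair b x = (\<Prod>j\<in>{m..-1-k}. gf_pair (b $$ (-1 - j)) (x $$ j))"
proof (rule pair_eq_prod)
  fix j assume "j \<notin> {m..-1-k}"
  hence "j < fls_subdegree x \<or> -1 - j < fls_subdegree b" using assms by auto
  thus "b $$ (-1 - j) = 0 \<or> x $$ j = 0" by auto
qed auto

lemma pair_commute: "pair b x = pair x b"
proof -
  let ?m = "fls_subdegree x" and ?k = "fls_subdegree b"
  have "pair b x = (\<Prod>j\<in>{?m..-1-?k}. gf_pair (b $$ (-1 - j)) (x $$ j))"
    by (rule pair_eq_prod_interval) auto
  also have "\<dots> = (\<Prod>j\<in>{?k..-1-?m}. gf_pair (x $$ (-1 - j)) (b $$ j))"
    by (rule prod.reindex_bij_witness[of _ "\<lambda>j. -1 - j" "\<lambda>j. -1 - j"]) (auto simp: gf_pair_commute)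
  also have "\<dots> = pair x b"
    by (rule pair_eq_prod_interval[symmetric]) auto
  finally show ?thesis .
qed

lemma pair_add: "pair b (x + y) = pair b x * pair b y"
proof -
  let ?m = "min (fls_subdegree (x + y)) (min (fls_subdegree x) (fls_subdegree y))"
  have "pair b z = (\<Prod>j\<in>{?m..-1-fls_subdegree b}. gf_pair (b $$ (-1 - j)) (z $$ j))"
    if "z \<in> {x, y, x + y}" for z
    by (rule pair_eq_prod_interval) (use that in auto)
  thus ?thesis by (simp add: gf_pair_add prod.distrib)
qed

lemma pair_add_left: "pair (b + d) x = pair b x * pair d x"
  using pair_add by (metis pair_commute)

lemma norm_pair: "cmod (pair b x) = 1"
  unfolding pair_def by (simp add: prod_norm[symmetric] norm_gf_pair)

lemma pair_0 [simp]: "pair b 0 = 1" "pair 0 x = 1"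
  by (simp_all add: pair_def)

lemma pair_nonzero [simp]: "pair b x \<noteq> 0"
  using norm_pair[of b x] by auto

lemma cnj_pair: "cnj (pair b x) = pair b (- x)" "cnj (pair b x) = pair (- b) x"
proof -
  have 1: "pair b x * cnj (pair b x) = 1"
    using norm_pair[of b x] by (simp add: complex_norm_square[symmetric])
  have "pair b x * pair b (- x) = 1" "pair b x * pair (- b) x = 1"
    using pair_add[of b x "- x"] pair_add_left[of b "- b" x] by simp_all
  with 1 show "cnj (pair b x) = pair b (- x)" "cnj (pair b x) = pair (- b) x"
    by (metis mult_cancel_left pair_nonzero)+
qed

lemma pair_diff: "pair b (x - y) = pair b x * cnj (pair b y)"
  using pair_add[of b x "- y"] by (simp add: cnj_pair)

lemma pair_cong: "(\<And>j. b $$ (-1 - j) \<noteq> 0 \<Longrightarrow> x $$ j = y $$ j) \<Longrightarrow> pair b x = pair b y"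
  unfolding pair_def by (rule prod.cong) auto

lemma pair_cong_left: "(\<And>j. x $$ (-1 - j) \<noteq> 0 \<Longrightarrow> b $$ j = d $$ j) \<Longrightarrow> pair b x = pair d x"
  using pair_cong[of x b d] by (simp add: pair_commute)

lemma pair_eq_1: "(\<And>j. b $$ (-1 - j) = 0 \<or> x $$ j = 0) \<Longrightarrow> pair b x = 1"
  using pair_eq_prod[of "{}" b x] by simp

lemma pair_monom: "pair b (fls_monom k a) = gf_pair (b $$ (-1 - k)) a"
  using pair_eq_prod[of "{k}" b "fls_monom k a"] by simp

text \<open>Dilation is self-adjoint for the pairing, by a shift of the product index. Hence
  dilating a character again amounts to shifting its digits.\<close>

lemma pair_shift: "pair (fls_shift n b) x = pair b (fls_shift n x)"
proof -
  let ?J = "{j. b $$ (-1 - j) \<noteq> 0 \<and> x $$ (j + n) \<noteq> 0}"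
  have e: "-1 - (a + n) + n = -1 - a" "-1 - (a - n) = -1 - a + n" for a :: int by auto
  have f: "finite ?J"
    by (rule finite_subset[of _ "{fls_subdegree x - n .. -1 - fls_subdegree b}"])
       (auto dest!: fls_subdegree_leI)
  have "pair b (fls_shift n x) = (\<Prod>j\<in>?J. gf_pair (b $$ (-1 - j)) (x $$ (j + n)))"
    by (simp add: pair_def)
  also have "\<dots> = (\<Prod>j | b $$ (-1 - j + n) \<noteq> 0 \<and> x $$ j \<noteq> 0. gf_pair (b $$ (-1 - j + n)) (x $$ j))"
    by (rule prod.reindex_bij_witness[of _ "\<lambda>j. j - n" "\<lambda>j. j + n"]) (auto simp: e)
  also have "\<dots> = pair (fls_shift n b) x"
    by (simp add: pair_def)
  finally show ?thesis ..
qed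

lemma continuous_on_pair: "continuous_on UNIV (pair b)"
  unfolding continuous_on_iff
proof (intro ballI allI impI)
  fix x :: "'k fls" and e :: real assume "e > 0"
  obtain d where d: "d > 0" "\<And>y. dist y x < d \<Longrightarrow> \<forall>j\<le>-1 - fls_subdegree b. y $$ j = x $$ j"
    using fls_nth_locally_const by metis
  have *: "pair b y = pair b x" if "dist y x < d" for y
  proof (rule pair_cong)
    fix j assume "b $$ (-1 - j) \<noteq> 0"
    hence "fls_subdegree b \<le> -1 - j" by (rule fls_subdegree_leI)
    thus "y $$ j = x $$ j" using d(2)[OF that] by simp
  qed
  show "\<exists>d>0. \<forall>y\<in>UNIV. dist y x < d \<longrightarrow> dist (pair b y) (pair b x) < e"
  proof (intro exI[of _ d] conjI ballI impI d(1))
    fix y assume "dist y x < d"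
    from *[OF this] \<open>e > 0\<close> show "dist (pair b y) (pair b x) < e" by simp
  qed
qed

text \<open>The index reflection \<open>k \<mapsto> -1 - k\<close> makes the dual group a copy of the local field in which
  the annihilator of \<open>K\<^sub>0\<close> corresponds to \<open>K\<^sub>0\<close> and the dilation to the dilation.\<close>

definition to_char :: "'k fls \<Rightarrow> 'k character" where
  "to_char b = Abs_character (pair b)"

lemma char_app_to_char [simp]: "char_app (to_char b) = pair b"
  unfolding to_char_def
  by (rule Abs_character_inverse) (simp add: continuous_on_pair norm_pair pair_add)

lemma to_char_add: "to_char (b + d) = to_char b * to_char d"
  by (rule character_eqI) (simp add: times_character.rep_eq pair_add_left)

lemma to_char_0: "to_char 0 = 1"
  by (rule character_eqI) (simp add: one_character.rep_eq)

lemma to_char_sum: "to_char (\<Sum>i\<in>A. f i) = (\<Prod>i\<in>A. to_char (f i))"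
  by (induction A rule: infinite_finite_induct) (simp_all add: to_char_0 to_char_add)

lemma to_char_monom: "to_char (fls_monom (-1 - k) u) = rchar p s c k u"
  by (rule character_eqI) (simp add: char_app_rchar' pair_commute[of "fls_monom _ _"] pair_monom gf_pair_commute)

lemma char_dilate_to_char: "char_dilate (to_char b) n = to_char (fls_shift n b)"
  by (rule character_eqI) (simp add: char_dilate.rep_eq pair_shift)

lemma inj_to_char: "inj to_char"
proof (rule injI)
  fix b d assume "to_char b = to_char d"
  hence "char_app (to_char b) = char_app (to_char d)" by simp
  hence *: "pair b x = pair d x" for x by simp
  show "b = d"
  proof (rule fls_eqI)
    fix j
    have "gf_pair (b $$ j) a = gf_pair (d $$ j) a" for a
      using *[of "fls_monom (-1 - j) a"] by (simp add: pair_monom)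
    thus "b $$ j = d $$ j" using gf_pair_eq_iff by blast
  qed
qed

text \<open>The digit of \<open>b\<close> at \<open>j\<close> meets the digit of \<open>x\<close> at
  \<open>-1 - j\<close>, and \<open>j < - n\<close> means \<open>-1 - j \<ge> n\<close>. Testing on
  monomials isolates one digit at a time.\<close>

lemma to_char_in_annihilator: "to_char b \<in> annihilator (fls_ball n) \<longleftrightarrow> b \<in> fls_ball (- n)"
proof
  assume *: "to_char b \<in> annihilator (fls_ball n)"
  show "b \<in> fls_ball (- n)"
    unfolding mem_fls_ball
  proof (intro allI impI)
    fix j assume "j < - n"
    have "gf_pair (b $$ j) a = gf_pair 0 a" for a
    proof -
      have "fls_monom (-1 - j) a \<in> fls_ball n" using \<open>j < - n\<close> by (auto simp: mem_fls_ball)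
      hence "pair b (fls_monom (-1 - j) a) = 1" using * by (simp add: annihilator_def)
      thus ?thesis by (simp add: pair_monom)
    qed
    thus "b $$ j = 0" using gf_pair_eq_iff by blast
  qed
next
  assume *: "b \<in> fls_ball (- n)"
  have "pair b x = 1" if x: "x \<in> fls_ball n" for x
  proof (rule pair_eq_1)
    fix j show "b $$ (-1 - j) = 0 \<or> x $$ j = 0"
      using * x by (cases "j < n") (auto simp: mem_fls_ball)
  qed
  thus "to_char b \<in> annihilator (fls_ball n)" by (simp add: annihilator_def)
qed

end


text \<open>The circle has no small nontrivial subgroup. If all powers of \<open>z\<close> stay
  within distance 1 of 1, their real parts are at least 1/2, so passing from \<open>w\<close> to its
  square multiplies the distance to 1 by \<open>cmod (w + 1)\<close>, which is at least 3/2, and the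
  distance would become unbounded.\<close>

lemma root_of_unity_near_1:
  fixes z :: complex
  assumes "cmod z = 1" and "\<And>n::nat. dist (z ^ n) 1 < 1"
  shows "z = 1"
proof (rule ccontr)
  assume "z \<noteq> 1"
  define \<delta> where "\<delta> = cmod (z - 1)"
  have d: "\<delta> > 0" using \<open>z \<noteq> 1\<close> by (simp add: \<delta>_def)
  have Re: "Re (z ^ n) \<ge> 1/2" for n
  proof -
    have "cmod (z ^ n - 1) < 1" using assms(2)[of n] by (simp add: dist_norm)
    hence "(cmod (z ^ n - 1))\<^sup>2 < 1" by (simp add: power_less_one_iff abs_square_less_1)
    moreover have "(cmod (z ^ n))\<^sup>2 = 1" using assms(1) by (simp add: norm_power)
    ultimately show ?thesis
      by (simp add: cmod_power2 power2_diff)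
  qed
  have grow: "cmod (z ^ (2 ^ k) - 1) \<ge> (3/2) ^ k * \<delta>" for k
  proof (induction k)
    case (Suc k)
    have "Re (z ^ (2 ^ k) + 1) \<ge> 3/2" using Re[of "2 ^ k"] by simp
    hence "cmod (z ^ (2 ^ k) + 1) \<ge> 3/2" using complex_Re_le_cmod[of "z ^ (2 ^ k) + 1"] by linarith
    moreover have "z ^ (2 ^ Suc k) - 1 = (z ^ (2 ^ k) + 1) * (z ^ (2 ^ k) - 1)"
      by (simp add: algebra_simps power_add[symmetric] mult_2)
    ultimately show ?case
      using mult_mono[of "3/2" "cmod (z ^ (2 ^ k) + 1)" "(3/2) ^ k * \<delta>" "cmod (z ^ (2 ^ k) - 1)"] Suc d
      by (simp only: norm_mult power_Suc mult.assoc norm_ge_zero) simp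
  qed (simp add: \<delta>_def)
  obtain k where "1 / \<delta> < (3/2) ^ k" using real_arch_pow[of "3/2" "1 / \<delta>"] by auto
  hence "1 < (3/2) ^ k * \<delta>" using d by (simp add: field_simps)
  with grow[of k] assms(2)[of "2 ^ k"] show False by (simp add: dist_norm)
qed

text \<open>Continuity sends a small ball into the disc of radius 1 around 1. The ball is a
  subgroup, so all powers of such a value stay in the disc and the value is 1.\<close>

lemma char_app_trivial_on_ball: "\<exists>n. \<forall>x\<in>fls_ball n. char_app (\<xi> :: 'k::field character) x = 1"
proof -
  obtain e where e: "e > 0" "\<And>x. dist x 0 < e \<Longrightarrow> dist (char_app \<xi> x) (char_app \<xi> 0) < 1"
    using continuous_on_char_app[of \<xi>] unfolding continuous_on_iff
    by (elim ballE[of _ _ 0] allE[of _ 1]) auto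
  obtain n where "\<And>x y :: 'k fls. y \<in> cyl x (int n) \<Longrightarrow> dist y x < e"
    using cyl_dist_lt[OF e(1)] by blast
  hence small: "dist x 0 < e" if "x \<in> fls_ball (int n)" for x :: "'k fls"
    using that by (auto simp: mem_cyl mem_fls_ball)
  have "char_app \<xi> x = 1" if x: "x \<in> fls_ball (int n)" for x
  proof (rule root_of_unity_near_1[OF norm_char_app])
    fix m :: nat
    have "char_app \<xi> x ^ m = char_app \<xi> (of_nat m * x)"
      by (induction m) (simp_all add: char_app_add distrib_right)
    moreover have "of_nat m * x \<in> fls_ball (int n)"
    proof -
      have "(of_nat m * x) $$ j = of_nat m * x $$ j" for j
        by (induction m) (simp_all add: distrib_right)
      thus ?thesis using x by (simp add: mem_fls_ball)
    qed
    ultimately show "dist (char_app \<xi> x ^ m) 1 < 1"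
      using e(2)[OF small] by simp
  qed
  thus ?thesis by blast
qed

context gf_coordinates
begin

text \<open>Being trivial on some ball, a character is determined by its restrictions to the
  one-digit subgroups outside it, and each of these is the pairing with some \<open>u k\<close>. The
  cut-off at \<open>- n\<close> makes these digits a Laurent series.\<close>

lemma surj_to_char: "surj to_char"
proof -
  have "\<exists>b. \<xi> = to_char b" for \<xi>
  proof -
    obtain n where n: "\<And>x. x \<in> fls_ball n \<Longrightarrow> char_app \<xi> x = 1"
      using char_app_trivial_on_ball by metis
    have "\<exists>u. \<forall>a. char_app \<xi> (fls_monom k a) = gf_pair u a" for k
    proof (rule gf_character_eq_gf_pair)
      fix a b :: 'k
      have "fls_monom k (a + b) = fls_monom k a + fls_monom k b" by (rule fls_eqI) simp
      thus "char_app \<xi> (fls_monom k (a + b)) = char_app \<xi> (fls_monom k a) * char_app \<xi> (fls_monom k b)"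
        by (simp add: char_app_add)
    qed (simp add: fls_monom_def)
    then obtain u where u: "\<And>k a. char_app \<xi> (fls_monom k a) = gf_pair (u k) a" by metis
    define b where "b = Abs_fls (\<lambda>j. if j < - n then 0 else u (-1 - j))"
    have b: "b $$ j = (if j < - n then 0 else u (-1 - j))" for j
      unfolding b_def by (rule Abs_fls_nth[of "- n"]) auto
    have "char_app \<xi> x = pair b x" for x
    proof -
      let ?m = "fls_subdegree x"
      define y where "y = x - (\<Sum>k\<in>{?m..<n}. fls_monom k (x $$ k))"
      have nth: "(\<Sum>k\<in>{?m..<n}. fls_monom k (x $$ k)) $$ j = (if j < n then x $$ j else 0)" for j
        by (auto simp: sum_fls_nth if_distrib[of "\<lambda>z. _ = z"] sum.delta)
      have y: "y \<in> fls_ball n" by (simp add: y_def nth mem_fls_ball)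
      have sum: "char_app \<xi> (\<Sum>k\<in>A. f k) = (\<Prod>k\<in>A. char_app \<xi> (f k))" for A and f :: "int \<Rightarrow> 'k fls"
        by (induction A rule: infinite_finite_induct) (simp_all add: char_app_add)
      have "char_app \<xi> x = char_app \<xi> (y + (\<Sum>k\<in>{?m..<n}. fls_monom k (x $$ k)))"
        by (simp add: y_def)
      also have "\<dots> = (\<Prod>k\<in>{?m..<n}. gf_pair (u k) (x $$ k))"
        by (simp add: char_app_add n[OF y] sum u)
      also have "\<dots> = (\<Prod>k\<in>{?m..<n}. gf_pair (b $$ (-1 - k)) (x $$ k))"
        by (rule prod.cong) (auto simp: b)
      also have "\<dots> = pair b x"
        by (rule pair_eq_prod[symmetric]) (auto simp: b)
      finally show ?thesis .
    qed
    thus ?thesis by (intro exI[of _ b] character_eqI) simp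
  qed
  thus ?thesis by (metis surjI)
qed

end

section \<open>Haar measure of cylinders\<close>

lemma cyl_refl [simp]: "x \<in> cyl x m"
  by (simp add: mem_cyl)

lemma cyl_mono: "m \<le> n \<Longrightarrow> y \<in> cyl x m \<Longrightarrow> cyl y n \<subseteq> cyl x m"
  by (auto simp: mem_cyl)

lemma cyl_eq: "y \<in> cyl x m \<Longrightarrow> cyl y m = cyl x m"
  by (auto simp: mem_cyl)

lemma cyl_0: "cyl 0 m = fls_ball m"
  by (auto simp: mem_cyl mem_fls_ball)

lemma fls_ball_absorb: "i \<le> n \<Longrightarrow> x \<in> fls_ball i \<Longrightarrow> y \<in> cyl x n \<Longrightarrow> y \<in> fls_ball i"
  by (auto simp: mem_cyl mem_fls_ball)

lemma open_cyl: "open (cyl (a :: 'k::field fls) m)"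
  unfolding open_dist
proof
  fix x assume "x \<in> cyl a m"
  obtain d where d: "d > 0" "\<forall>y. dist y x < d \<longrightarrow> (\<forall>j\<le>m. y $$ j = x $$ j)"
    using fls_nth_locally_const[of x m] by blast
  show "\<exists>e>0. \<forall>y. dist y x < e \<longrightarrow> y \<in> cyl a m"
  proof (intro exI[of _ d] conjI allI impI d(1))
    fix y assume "dist y x < d"
    hence "\<forall>j\<le>m. y $$ j = x $$ j" using d(2) by blast
    with \<open>x \<in> cyl a m\<close> show "y \<in> cyl a m" by (simp add: mem_cyl)
  qed
qed

lemma open_fls_ball: "open (fls_ball n :: 'k::field fls set)"
  using open_cyl[of 0 n] by (simp add: cyl_0)

lemma open_fls_iff: "open U \<longleftrightarrow> (\<forall>x\<in>U. \<exists>n::nat. cyl (x :: 'k::field fls) (int n) \<subseteq> U)"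
proof
  assume U: "open U"
  show "\<forall>x\<in>U. \<exists>n::nat. cyl x (int n) \<subseteq> U"
  proof
    fix x assume "x \<in> U"
    then obtain e where e: "e > 0" "\<forall>y. dist y x < e \<longrightarrow> y \<in> U"
      using U unfolding open_dist by blast
    obtain n where "\<forall>y\<in>cyl x (int n). dist y x < e" using cyl_dist_lt[OF e(1)] by blast
    with e show "\<exists>n::nat. cyl x (int n) \<subseteq> U" by blast
  qed
next
  assume *: "\<forall>x\<in>U. \<exists>n::nat. cyl x (int n) \<subseteq> U"
  have "U = \<Union>{cyl x (int n) | x n. cyl x (int n) \<subseteq> U}"
  proof (intro equalityI subsetI)
    fix x assume "x \<in> U"
    then obtain n where "cyl x (int n) \<subseteq> U" using * by blast
    thus "x \<in> \<Union>{cyl x (int n) | x n. cyl x (int n) \<subseteq> U}" using cyl_refl by blast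
  qed blast
  moreover have "open (\<Union>{cyl x (int n) | x n. cyl x (int n) \<subseteq> U})"
    by (intro open_Union) (auto simp: open_cyl)
  ultimately show "open U" by simp
qed

lemma fls_ball_cover: "\<exists>n::nat. x \<in> fls_ball (- int n)"
  by (rule exI[of _ "nat (- fls_subdegree x)"]) (auto simp: mem_fls_ball)

section \<open>Representatives of cosets and finite unions of cylinders\<close>

definition fls_box :: "int \<Rightarrow> int \<Rightarrow> 'k::field fls set" where
  "fls_box i n = {a. \<forall>j. j < i \<or> n \<le> j \<longrightarrow> a $$ j = 0}"

definition fls_trunc :: "int \<Rightarrow> 'k::field fls \<Rightarrow> 'k fls" where
  "fls_trunc n x = Abs_fls (\<lambda>j. if j < n then x $$ j else 0)"

lemma fls_trunc_nth [simp]: "fls_trunc n x $$ j = (if j < n then x $$ j else 0)"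
  unfolding fls_trunc_def by (rule Abs_fls_nth[of "fls_subdegree x"]) auto

lemma finite_fls_box: "finite (fls_box i n :: 'k::{field,finite} fls set)"
proof (rule inj_on_finite)
  show "inj_on (\<lambda>a. restrict (fls_nth a) {i..<n}) (fls_box i n :: 'k fls set)"
  proof (rule inj_onI)
    fix a b :: "'k fls"
    assume ab: "a \<in> fls_box i n" "b \<in> fls_box i n"
      and eq: "restrict (fls_nth a) {i..<n} = restrict (fls_nth b) {i..<n}"
    show "a = b"
    proof (rule fls_eqI)
      fix j show "a $$ j = b $$ j"
        using ab fun_cong[OF eq, of j] by (cases "j < i \<or> n \<le> j") (auto simp: fls_box_def)
    qed
  qed
  show "(\<lambda>a. restrict (fls_nth a) {i..<n}) ` fls_box i n \<subseteq> {i..<n} \<rightarrow>\<^sub>E (UNIV :: 'k set)"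
    by auto
  show "finite ({i..<n} \<rightarrow>\<^sub>E (UNIV :: 'k set))"
    by (intro finite_PiE) auto
qed

text \<open>Truncation below index \<open>n\<close> stays in the coset and selects from it the one
  element of \<open>fls_box i n\<close>. Integrals over such a set thereby become finite
  sums.\<close>

lemma cyl_decomp:
  assumes S: "S \<subseteq> fls_ball i" and abs: "\<And>x y. x \<in> S \<Longrightarrow> y \<in> cyl x n \<Longrightarrow> y \<in> S"
  shows "S = (\<Union>a\<in>fls_box i n \<inter> S. cyl a n)"
proof (intro equalityI subsetI)
  fix x assume x: "x \<in> S"
  have "fls_trunc n x \<in> S" by (rule abs[OF x]) (simp add: mem_cyl)
  moreover have "fls_trunc n x \<in> fls_box i n"
    using S x by (auto simp: fls_box_def mem_fls_ball)
  moreover have "x \<in> cyl (fls_trunc n x) n" by (simp add: mem_cyl)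
  ultimately show "x \<in> (\<Union>a\<in>fls_box i n \<inter> S. cyl a n)" by blast
qed (use abs in blast)

lemma fls_box_eqI:
  assumes "a \<in> fls_box i n" "b \<in> fls_box i' n" "a \<in> cyl b n" shows "a = b"
proof (rule fls_eqI)
  fix j show "a $$ j = b $$ j"
    using assms by (cases "j < n") (auto simp: fls_box_def mem_cyl)
qed

lemma disjoint_cyl_box: "disjoint_family_on (\<lambda>a. cyl a n) (fls_box i n)"
  unfolding disjoint_family_on_def
proof (intro ballI impI)
  fix a b assume ab: "a \<in> fls_box i n" "b \<in> fls_box i n" "a \<noteq> b"
  show "cyl a n \<inter> cyl b n = {}"
  proof (rule ccontr)
    assume "cyl a n \<inter> cyl b n \<noteq> {}"
    hence "a \<in> cyl b n" by (auto simp: mem_cyl)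
    with fls_box_eqI ab show False by blast
  qed
qed

lemma indicator_cyl_decomp:
  fixes S :: "'k::{field,finite} fls set"
  assumes "S \<subseteq> fls_ball i" and "\<And>x y. x \<in> S \<Longrightarrow> y \<in> cyl x n \<Longrightarrow> y \<in> S"
  shows "indicator S x = (\<Sum>a\<in>fls_box i n \<inter> S. indicator (cyl a n) x :: 'b::semiring_1)"
proof -
  have "indicator (\<Union>a\<in>fls_box i n \<inter> S. cyl a n) x = (\<Sum>a\<in>fls_box i n \<inter> S. indicator (cyl a n) x :: 'b)"
    by (intro indicator_UN_disjoint disjoint_family_on_mono[OF _ disjoint_cyl_box[of n i]])
       (auto simp: finite_fls_box)
  thus ?thesis using cyl_decomp[OF assms] by simp
qed

lemma sets_borel_eq_sigma_open: "sets borel = sigma_sets UNIV {S. open S}"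
  by (simp add: borel_def)

lemma Int_stable_open: "Int_stable {S. open S}"
  by (auto simp: Int_stable_def)

text \<open>Open sets generate the Borel sets and are stable under intersection, so only open sets
  have to be compared. Each of them is an increasing union of finite disjoint unions of
  cylinders.\<close>

lemma measure_eqI_cyl:
  fixes M1 M2 :: "'k::{field,finite} fls measure"
  assumes s: "sets M1 = sets borel" "sets M2 = sets borel"
    and eq: "\<And>a m. emeasure M1 (cyl a m) = emeasure M2 (cyl a m)"
    and fin: "\<And>m. emeasure M1 (fls_ball m) \<noteq> \<infinity>"
  shows "M1 = M2"
proof (rule measure_eqI_generator_eq[where E = "{S. open S}" and \<Omega> = UNIV and A = "\<lambda>i. fls_ball (- int i)"])
  fix X :: "'k fls set" assume "X \<in> {S. open S}"
  hence X: "open X" by simp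
  \<comment> \<open>One number controls both the region and the fineness of the cylinders: each
    \<open>S n\<close> is then a finite union of cylinders, and the sequence increases to
    \<open>X\<close>.\<close>
  define S where "S n = {x\<in>fls_ball (- int n). cyl x (int n) \<subseteq> X}" for n
  have abs: "y \<in> S n" if "x \<in> S n" "y \<in> cyl x (int n)" for x y n
    using that fls_ball_absorb[of "- int n" "int n" x y] cyl_eq[of y x "int n"] by (auto simp: S_def)
  have S: "S n = (\<Union>a\<in>fls_box (- int n) (int n) \<inter> S n. cyl a (int n))" for n
    by (rule cyl_decomp, simp add: S_def Collect_restrict, rule abs)
  have open_S: "open (S n)" for n
  proof -
    have "open (\<Union>a\<in>fls_box (- int n) (int n) \<inter> S n. cyl a (int n))"
      by (intro open_UN ballI open_cyl)
    thus ?thesis by (simp only: S[symmetric])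
  qed
  have em: "emeasure M (S n) = (\<Sum>a\<in>fls_box (- int n) (int n) \<inter> S n. emeasure M (cyl a (int n)))"
    if "sets M = sets borel" for M :: "'k fls measure" and n
  proof -
    have "(\<Sum>a\<in>fls_box (- int n) (int n) \<inter> S n. emeasure M (cyl a (int n))) =
        emeasure M (\<Union>a\<in>fls_box (- int n) (int n) \<inter> S n. cyl a (int n))"
    proof (rule sum_emeasure)
      show "disjoint_family_on (\<lambda>a. cyl a (int n)) (fls_box (- int n) (int n) \<inter> S n)"
        by (rule disjoint_family_on_mono[OF _ disjoint_cyl_box]) blast
    qed (use that open_cyl borel_open in \<open>auto simp: finite_fls_box\<close>)
    thus ?thesis by (simp only: S[symmetric])
  qed
  have inc: "incseq S"
  proof (rule incseq_SucI, rule subsetI)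
    fix n x assume x: "x \<in> S n"
    have "cyl x (int (Suc n)) \<subseteq> cyl x (int n)" by (intro cyl_mono) auto
    thus "x \<in> S (Suc n)" using x by (auto simp: S_def mem_fls_ball)
  qed
  have U: "(\<Union>n. S n) = X"
  proof (intro equalityI subsetI)
    fix x assume "x \<in> X"
    obtain m where m: "x \<in> fls_ball (- int m)" using fls_ball_cover by blast
    obtain n where n: "cyl x (int n) \<subseteq> X" using X \<open>x \<in> X\<close> unfolding open_fls_iff by blast
    have "cyl x (int (max m n)) \<subseteq> cyl x (int n)" by (intro cyl_mono) auto
    hence "x \<in> S (max m n)" using m n by (auto simp: S_def mem_fls_ball)
    thus "x \<in> (\<Union>n. S n)" by blast
  qed (auto simp: S_def)
  have "emeasure M1 (\<Union>n. S n) = (SUP n. emeasure M1 (S n))"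
    using open_S inc s by (intro SUP_emeasure_incseq[symmetric]) auto
  also have "\<dots> = (SUP n. emeasure M2 (S n))"
    by (simp add: em s eq)
  also have "\<dots> = emeasure M2 (\<Union>n. S n)"
    using open_S inc s by (intro SUP_emeasure_incseq) auto
  finally show "emeasure M1 X = emeasure M2 X" by (simp add: U)
next
  show "(\<Union>i. fls_ball (- int i)) = (UNIV :: 'k fls set)" using fls_ball_cover by blast
qed (use s fin open_fls_ball in \<open>auto simp: sets_borel_eq_sigma_open Int_stable_open\<close>)

context gf_coordinates
begin

text \<open>The digit at \<open>m\<close> splits \<open>fls_ball m\<close> into \<open>q\<close>
  translates of \<open>fls_ball (m + 1)\<close>. Invariance thus fixes the ratio of consecutive
  balls, and the normalisation fixes their measures.\<close>

lemma emeasure_cyl_invariant: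
  fixes M :: "'k fls measure"
  assumes sets: "sets M = sets borel"
    and inv: "\<And>a S. S \<in> sets borel \<Longrightarrow> emeasure M ((+) a ` S) = emeasure M S"
    and 1: "emeasure M (fls_ball 0) = 1"
  shows "emeasure M (cyl a m) = ennreal (q powi (- m))"
proof -
  have q: "q > 0" by (rule of_nat_card)
  have ball: "emeasure M (cyl a m) = emeasure M (fls_ball m)" for a m
  proof -
    have "cyl a m = (+) a ` fls_ball m"
    proof (intro equalityI subsetI)
      fix x assume "x \<in> cyl a m"
      hence "x - a \<in> fls_ball m" by (simp add: mem_cyl mem_fls_ball)
      thus "x \<in> (+) a ` fls_ball m" by (intro image_eqI[of _ _ "x - a"]) auto
    qed (auto simp: mem_cyl mem_fls_ball)
    thus ?thesis using inv[OF borel_open[OF open_fls_ball]] by simp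
  qed
  have step: "emeasure M (fls_ball m) = ennreal q * emeasure M (fls_ball (m + 1))" for m
  proof -
    have "fls_ball m = (\<Union>u\<in>(UNIV :: 'k set). cyl (fls_monom m u) (m + 1))"
    proof (intro equalityI subsetI)
      fix x :: "'k fls" assume "x \<in> fls_ball m"
      hence "x \<in> cyl (fls_monom m (x $$ m)) (m + 1)" by (auto simp: mem_cyl mem_fls_ball)
      thus "x \<in> (\<Union>u\<in>UNIV. cyl (fls_monom m u) (m + 1))" by blast
    qed (auto simp: mem_cyl mem_fls_ball)
    hence "emeasure M (fls_ball m) = emeasure M (\<Union>u\<in>UNIV. cyl (fls_monom m u) (m + 1))" by simp
    also have "\<dots> = (\<Sum>u\<in>UNIV. emeasure M (cyl (fls_monom m u) (m + 1)))"
    proof (rule sum_emeasure[symmetric])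
      show "disjoint_family_on (\<lambda>u :: 'k. cyl (fls_monom m u) (m + 1)) UNIV"
        unfolding disjoint_family_on_def
      proof (intro ballI impI)
        fix u v :: 'k assume "u \<noteq> v"
        have "u = v" if "x \<in> cyl (fls_monom m u) (m + 1)" "x \<in> cyl (fls_monom m v) (m + 1)" for x
          using that[unfolded mem_cyl, rule_format, of m] by simp
        with \<open>u \<noteq> v\<close> show "cyl (fls_monom m u) (m + 1) \<inter> cyl (fls_monom m v) (m + 1) = {}" by blast
      qed
    qed (use sets open_cyl borel_open in auto)
    also have "\<dots> = ennreal q * emeasure M (fls_ball (m + 1))"
      by (simp add: ball of_nat_card flip: ennreal_of_nat_eq_real_of_nat)
         (simp add: ennreal_of_nat_eq_real_of_nat of_nat_card)
    finally show ?thesis .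
  qed
  have "emeasure M (fls_ball m) = ennreal (q powi (- m))" for m
  proof (induction m rule: int_induct[where k = 0])
    case base thus ?case using 1 by simp
  next
    case (step1 i)
    have "ennreal q * emeasure M (fls_ball (i + 1)) = ennreal (q powi (- i))"
      using step step1 by metis
    hence "ennreal (1 / q) * (ennreal q * emeasure M (fls_ball (i + 1))) = ennreal (1 / q) * ennreal (q powi (- i))"
      by simp
    hence "emeasure M (fls_ball (i + 1)) = ennreal (1 / q * q powi (- i))"
      using q by (simp add: mult.assoc[symmetric] ennreal_mult[symmetric])
    also have "1 / q * q powi (- i) = q powi (- (i + 1))"
      using q by (simp add: power_int_diff)
    finally show ?case .
  next
    case (step2 i)
    have "emeasure M (fls_ball (i - 1)) = ennreal q * ennreal (q powi (- i))"
      using step[of "i - 1"] step2 by simp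
    also have "\<dots> = ennreal (q * q powi (- i))" using q by (simp add: ennreal_mult)
    also have "q * q powi (- i) = q powi (- (i - 1))"
      using q by (simp add: power_int_diff power_int_minus divide_inverse)
    finally show ?case .
  qed
  thus ?thesis by (simp add: ball)
qed

end

text \<open>Invariance is replaced by its consequence on cylinders, which already determines the
  measure. Image measures, also those coming from the dual group, can then be identified by testing
  cylinders.\<close>

locale haar_field = gf_coordinates +
  fixes \<mu> :: "'a fls measure"
  assumes sets_mu: "sets \<mu> = sets borel"
    and emeasure_cyl: "emeasure \<mu> (cyl a m) = ennreal (q powi (- m))"
begin

lemma space_mu [simp]: "space \<mu> = UNIV"
  using sets_eq_imp_space_eq[OF sets_mu] by simp

lemma measurable_mu [simp]: "measurable \<mu> N = measurable borel N" "measurable N \<mu> = measurable N borel"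
  by (auto intro!: measurable_cong_sets simp: sets_mu)

lemma open_sets_mu: "open S \<Longrightarrow> S \<in> sets \<mu>"
  by (simp add: sets_mu)

lemma cyl_sets [simp, measurable]: "cyl a m \<in> sets \<mu>" "cyl a m \<in> sets borel"
  by (auto intro: open_sets_mu open_cyl borel_open)

lemma fls_ball_sets [simp, measurable]: "fls_ball m \<in> sets \<mu>" "fls_ball m \<in> sets (borel :: 'a fls measure)"
  by (auto intro: open_sets_mu open_fls_ball borel_open)

lemma q_pos: "q > 0" by (rule of_nat_card)

lemma measure_cyl: "measure \<mu> (cyl a m) = q powi (- m)"
  using q_pos by (simp add: measure_def emeasure_cyl)

lemma emeasure_ball: "emeasure \<mu> (fls_ball m) = ennreal (q powi (- m))"
  using emeasure_cyl[of 0 m] by (simp add: cyl_0)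

lemma emeasure_ball_finite: "emeasure \<mu> (fls_ball m) < \<infinity>"
  by (simp add: emeasure_ball)

lemma emeasure_cyl_finite: "emeasure \<mu> (cyl a m) < \<infinity>"
  by (simp add: emeasure_cyl)

lemma q_gt_1: "q > 1"
proof -
  have "card {0, 1 :: 'a} \<le> CARD('a)" by (intro card_mono) auto
  thus ?thesis using of_nat_card(2) by simp
qed

text \<open>The origin lies in balls of arbitrarily small measure. It has to be set aside because no
  wavelet support contains it.\<close>

lemma AE_nonzero: "AE x in \<mu>. x \<noteq> 0"
proof (rule AE_I[where N = "{0}"])
  have "emeasure \<mu> {0} \<le> ennreal ((1 / q) ^ n)" for n
  proof -
    have "emeasure \<mu> {0} \<le> emeasure \<mu> (fls_ball (int n))"
      by (intro emeasure_mono) (auto simp: mem_fls_ball)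
    thus ?thesis by (simp add: emeasure_ball power_int_minus power_one_over inverse_eq_divide)
  qed
  moreover have "(\<lambda>n. ennreal ((1 / q) ^ n)) \<longlonglongrightarrow> ennreal 0"
    using q_gt_1 by (intro tendsto_ennrealI LIMSEQ_realpow_zero) auto
  ultimately have "emeasure \<mu> {0} \<le> ennreal 0"
    by (intro LIMSEQ_le_const) auto
  thus "emeasure \<mu> {0} = 0" by simp
  show "{0} \<in> sets \<mu>" by (simp add: sets_mu)
qed auto

lemma eq_mu_of_cyl:
  assumes "sets M = sets borel" "\<And>a m. emeasure M (cyl a m) = ennreal (q powi (- m))"
  shows "M = \<mu>"
  by (rule measure_eqI_cyl) (use assms(2)[of 0] in \<open>auto simp: assms sets_mu emeasure_cyl cyl_0\<close>)

text \<open>The argument of \<open>\<psi> l\<close> in a wavelet system. Taking \<open>n = 0\<close>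
  or \<open>h = 0\<close> leaves a translation or a dilation, so one substitution rule covers all
  cases.\<close>

definition fls_affine :: "int \<Rightarrow> 'a fls \<Rightarrow> 'a fls \<Rightarrow> 'a fls" where
  "fls_affine n h x = fls_shift n x - h"

lemma vimage_affine_cyl: "fls_affine n h -` cyl a m = cyl (fls_shift (- n) (a + h)) (m + n)"
proof (intro set_eqI iffI)
  fix x assume x: "x \<in> fls_affine n h -` cyl a m"
  show "x \<in> cyl (fls_shift (- n) (a + h)) (m + n)"
    unfolding mem_cyl
  proof (intro allI impI)
    fix j assume "j < m + n"
    hence "fls_affine n h x $$ (j - n) = a $$ (j - n)" using x by (auto simp: mem_cyl)
    thus "x $$ j = fls_shift (- n) (a + h) $$ j" by (simp add: fls_affine_def algebra_simps)
  qed
next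
  fix x assume x: "x \<in> cyl (fls_shift (- n) (a + h)) (m + n)"
  show "x \<in> fls_affine n h -` cyl a m"
    unfolding vimage_eq mem_cyl
  proof (intro allI impI)
    fix j assume "j < m"
    hence "x $$ (j + n) = fls_shift (- n) (a + h) $$ (j + n)" using x by (auto simp: mem_cyl)
    thus "fls_affine n h x $$ j = a $$ j" by (simp add: fls_affine_def algebra_simps)
  qed
qed

lemma measurable_affine [measurable]: "fls_affine n h \<in> measurable borel borel"
proof (rule borel_measurableI)
  fix S :: "'a fls set" assume S: "open S"
  have "open (fls_affine n h -` S)"
    unfolding open_fls_iff
  proof
    fix x assume "x \<in> fls_affine n h -` S"
    then obtain m :: nat where m: "cyl (fls_affine n h x) (int m) \<subseteq> S" using S unfolding open_fls_iff by auto
    have "cyl x (int (nat (int m + n))) \<subseteq> fls_affine n h -` cyl (fls_affine n h x) (int m)"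
      by (auto simp: mem_cyl fls_affine_def)
    with m show "\<exists>k::nat. cyl x (int k) \<subseteq> fls_affine n h -` S" by blast
  qed
  thus "fls_affine n h -` S \<inter> space borel \<in> sets borel" by simp
qed

text \<open>The preimage of a cylinder is a cylinder whose index is larger by \<open>n\<close>, so
  its measure is divided by \<open>q powi n\<close>; the density restores this factor.\<close>

lemma density_distr_affine: "density (distr \<mu> borel (fls_affine n h)) (\<lambda>_. ennreal (q powi n)) = \<mu>"
proof (rule eq_mu_of_cyl)
  fix a m
  have "emeasure (density (distr \<mu> borel (fls_affine n h)) (\<lambda>_. ennreal (q powi n))) (cyl a m) =
      ennreal (q powi n) * ennreal (q powi (- (m + n)))"
    by (simp add: emeasure_density_const emeasure_distr vimage_affine_cyl emeasure_cyl)
  also have "\<dots> = ennreal (q powi (- m))"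
    using q_pos by (simp add: ennreal_mult[symmetric] power_int_add[symmetric])
  finally show "emeasure (density (distr \<mu> borel (fls_affine n h)) (\<lambda>_. ennreal (q powi n))) (cyl a m) = ennreal (q powi (- m))" .
qed simp

lemma integral_affine:
  fixes g :: "'a fls \<Rightarrow> 'b::{banach, second_countable_topology}"
  assumes [measurable]: "g \<in> borel_measurable borel"
  shows "(LINT x|\<mu>. g (fls_affine n h x)) = q powi (- n) *\<^sub>R (LINT x|\<mu>. g x)"
    and "integrable \<mu> (\<lambda>x. g (fls_affine n h x)) \<longleftrightarrow> integrable \<mu> g"
proof -
  have "(LINT x|\<mu>. g x) = (LINT x|density (distr \<mu> borel (fls_affine n h)) (\<lambda>_. ennreal (q powi n)). g x)"
    by (simp only: density_distr_affine)
  also have "\<dots> = (LINT x|distr \<mu> borel (fls_affine n h). (q powi n) *\<^sub>R g x)"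
    using q_pos by (intro integral_density) auto
  also have "\<dots> = q powi n *\<^sub>R (LINT x|\<mu>. g (fls_affine n h x))"
    by (simp add: integral_distr)
  finally show "(LINT x|\<mu>. g (fls_affine n h x)) = q powi (- n) *\<^sub>R (LINT x|\<mu>. g x)"
    using q_pos by (simp add: power_int_minus)
  have "integrable \<mu> g \<longleftrightarrow> integrable (density (distr \<mu> borel (fls_affine n h)) (\<lambda>_. ennreal (q powi n))) g"
    by (simp only: density_distr_affine)
  also have "\<dots> \<longleftrightarrow> integrable (distr \<mu> borel (fls_affine n h)) (\<lambda>x. (q powi n) *\<^sub>R g x)"
    using q_pos by (intro integrable_density) auto
  also have "\<dots> \<longleftrightarrow> integrable \<mu> (\<lambda>x. (q powi n) *\<^sub>R g (fls_affine n h x))"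
    by (rule integrable_distr_eq) auto
  also have "\<dots> \<longleftrightarrow> integrable \<mu> (\<lambda>x. g (fls_affine n h x))"
  proof
    assume "integrable \<mu> (\<lambda>x. (q powi n) *\<^sub>R g (fls_affine n h x))"
    hence "integrable \<mu> (\<lambda>x. (q powi (- n)) *\<^sub>R ((q powi n) *\<^sub>R g (fls_affine n h x)))"
      by (rule integrable_scaleR_right)
    thus "integrable \<mu> (\<lambda>x. g (fls_affine n h x))"
      using q_pos by (simp add: power_int_minus)
  qed auto
  finally show "integrable \<mu> (\<lambda>x. g (fls_affine n h x)) \<longleftrightarrow> integrable \<mu> g" ..
qed

lemma L2_mu_measurable: "f \<in> L2 \<mu> \<Longrightarrow> f \<in> borel_measurable borel"
  using L2_measurable[of f \<mu>] by simp

lemma L2_affine: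
  assumes "f \<in> L2 \<mu>"
  shows "(\<lambda>x. f (fls_affine n h x)) \<in> L2 \<mu>"
    and "L2_norm \<mu> (\<lambda>x. f (fls_affine n h x)) = sqrt (q powi (- n)) * L2_norm \<mu> f"
proof -
  have [measurable]: "f \<in> borel_measurable borel" by (rule L2_mu_measurable[OF assms])
  have "integrable \<mu> (\<lambda>x. (cmod (f (fls_affine n h x)))\<^sup>2)"
    using integral_affine(2)[of "\<lambda>x. (cmod (f x))\<^sup>2" n h] L2_integrable[OF assms] by simp
  thus "(\<lambda>x. f (fls_affine n h x)) \<in> L2 \<mu>" by (simp add: L2_def)
  show "L2_norm \<mu> (\<lambda>x. f (fls_affine n h x)) = sqrt (q powi (- n)) * L2_norm \<mu> f"
    using integral_affine(1)[of "\<lambda>x. (cmod (f x))\<^sup>2" n h] by (simp add: L2_norm_def real_sqrt_mult)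
qed

lemma L2_indicator_bounded:
  assumes S: "S \<in> sets \<mu>" "emeasure \<mu> S < \<infinity>" and f: "f \<in> borel_measurable borel"
    and bd: "\<And>x. x \<in> S \<Longrightarrow> cmod (f x) \<le> C"
  shows "(\<lambda>x. indicator S x * f x) \<in> L2 \<mu>" "integrable \<mu> (\<lambda>x. indicator S x * f x)"
proof -
  have [measurable]: "S \<in> sets borel" using S sets_mu by simp
  note [measurable] = f
  have i: "integrable \<mu> (\<lambda>x. indicator S x * D :: real)" for D
    using S by (intro integrable_mult_left integrable_real_indicator) auto
  have m: "(\<lambda>x. indicator S x * f x) \<in> borel_measurable borel" by measurable
  show "(\<lambda>x. indicator S x * f x) \<in> L2 \<mu>"
    unfolding L2_def mem_Collect_eq
  proof (intro conjI)
    show "integrable \<mu> (\<lambda>x. (cmod (indicator S x * f x))\<^sup>2)"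
    proof (rule Bochner_Integration.integrable_bound[OF i[of "C\<^sup>2"]])
      show "AE x in \<mu>. norm ((cmod (indicator S x * f x))\<^sup>2) \<le> norm (indicator S x * C\<^sup>2)"
        using bd by (auto intro!: AE_I2 power_mono simp: indicator_def norm_mult)
    qed (use m in simp)
  qed (use m in simp)
  show "integrable \<mu> (\<lambda>x. indicator S x * f x)"
  proof (rule Bochner_Integration.integrable_bound[OF i[of "C"]])
    show "AE x in \<mu>. norm (indicator S x * f x) \<le> norm (indicator S x * C)"
    proof (rule AE_I2)
      fix x show "norm (indicator S x * f x) \<le> norm (indicator S x * C)"
        using bd[of x] by (cases "x \<in> S") auto
    qed
  qed (use m in simp)
qed

end

section \<open>Density of the cylinder functions\<close>

lemma L2_dominated_convergence:
  fixes f :: "nat \<Rightarrow> 'a \<Rightarrow> complex"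
  assumes f: "\<And>n. f n \<in> borel_measurable M" and g: "g \<in> borel_measurable M"
    and w: "w \<in> L2 M" and lim: "AE x in M. (\<lambda>n. f n x) \<longlonglongrightarrow> g x"
    and bd: "\<And>n x. cmod (f n x) \<le> cmod (w x)" "\<And>x. cmod (g x) \<le> cmod (w x)"
  shows "(\<lambda>n. L2_norm M (\<lambda>x. f n x - g x)) \<longlonglongrightarrow> 0"
proof -
  note [measurable] = f g
  have "(\<lambda>n. LINT x|M. (cmod (f n x - g x))\<^sup>2) \<longlonglongrightarrow> (LINT x|M. 0)"
  proof (rule integral_dominated_convergence[where w = "\<lambda>x. 4 * (cmod (w x))\<^sup>2"])
    show "integrable M (\<lambda>x. 4 * (cmod (w x))\<^sup>2)" using L2_integrable[OF w] by simp
    show "AE x in M. (\<lambda>n. (cmod (f n x - g x))\<^sup>2) \<longlonglongrightarrow> 0"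
      using lim
    proof eventually_elim
      case (elim x)
      from tendsto_power[OF tendsto_norm[OF LIM_zero[OF elim]], of 2] show ?case by simp
    qed
    fix n
    show "AE x in M. norm ((cmod (f n x - g x))\<^sup>2) \<le> 4 * (cmod (w x))\<^sup>2"
    proof (rule AE_I2)
      fix x
      have "cmod (f n x - g x) \<le> 2 * cmod (w x)"
        using norm_triangle_ineq4[of "f n x" "g x"] bd(1)[of n x] bd(2)[of x] by linarith
      hence "(cmod (f n x - g x))\<^sup>2 \<le> (2 * cmod (w x))\<^sup>2" by (intro power_mono) auto
      thus "norm ((cmod (f n x - g x))\<^sup>2) \<le> 4 * (cmod (w x))\<^sup>2" by (simp add: power_mult_distrib)
    qed
  qed measurable
  from tendsto_real_sqrt[OF this] show ?thesis by (simp add: L2_norm_def)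
qed

text \<open>Approximation is needed simultaneously in \<open>L\<^sub>1\<close>, where the Fourier transform is an integral,
  and in \<open>L\<^sub>2\<close>.\<close>

definition L12 :: "'a measure \<Rightarrow> ('a \<Rightarrow> complex) set" where
  "L12 M = {f \<in> L2 M. integrable M f}"

definition L12_norm :: "'a measure \<Rightarrow> ('a \<Rightarrow> complex) \<Rightarrow> real" where
  "L12_norm M f = L2_norm M f + (LINT x|M. cmod (f x))"

lemma L12_add: "f \<in> L12 M \<Longrightarrow> g \<in> L12 M \<Longrightarrow> (\<lambda>x. f x + g x) \<in> L12 M"
  and L12_diff: "f \<in> L12 M \<Longrightarrow> g \<in> L12 M \<Longrightarrow> (\<lambda>x. f x - g x) \<in> L12 M"
  and L12_cmult: "f \<in> L12 M \<Longrightarrow> (\<lambda>x. a * f x) \<in> L12 M"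
  and L12_zero: "(\<lambda>x. 0) \<in> L12 M"
  by (auto simp: L12_def L2_add L2_diff L2_cmult L2_zero)

lemma L12_sum: "(\<And>i. i \<in> F \<Longrightarrow> f i \<in> L12 M) \<Longrightarrow> (\<lambda>x. \<Sum>i\<in>F. f i x) \<in> L12 M"
  by (auto simp: L12_def intro: L2_sum)

lemma L12_L2: "f \<in> L12 M \<Longrightarrow> f \<in> L2 M" and L12_integrable: "f \<in> L12 M \<Longrightarrow> integrable M f"
  by (auto simp: L12_def)

lemma L12_norm_ge: "L2_norm M f \<le> L12_norm M f" "(LINT x|M. cmod (f x)) \<le> L12_norm M f" "0 \<le> L12_norm M f"
  by (auto simp: L12_norm_def L2_norm_nonneg)

lemma L12_norm_add_le:
  assumes "f \<in> L12 M" "g \<in> L12 M"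
  shows "L12_norm M (\<lambda>x. f x + g x) \<le> L12_norm M f + L12_norm M g"
proof -
  have "(LINT x|M. cmod (f x + g x)) \<le> (LINT x|M. cmod (f x) + cmod (g x))"
    using assms by (intro integral_mono norm_triangle_ineq) (auto simp: L12_def)
  also have "\<dots> = (LINT x|M. cmod (f x)) + (LINT x|M. cmod (g x))"
    using assms by (simp add: L12_def)
  finally show ?thesis
    using L2_norm_add_le[of f M g] assms by (simp add: L12_norm_def L12_def)
qed

lemma L12_norm_cmult: "L12_norm M (\<lambda>x. a * f x) = cmod a * L12_norm M f"
  by (simp add: L12_norm_def L2_norm_cmult norm_mult distrib_left)

lemma L12_norm_triangle:
  assumes "f \<in> L12 M" "g \<in> L12 M" "h \<in> L12 M"
  shows "L12_norm M (\<lambda>x. f x - h x) \<le> L12_norm M (\<lambda>x. f x - g x) + L12_norm M (\<lambda>x. g x - h x)"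
  using L12_norm_add_le[OF L12_diff[OF assms(1,2)] L12_diff[OF assms(2,3)]] by simp

lemma L12_dominated_convergence:
  fixes f :: "nat \<Rightarrow> 'a \<Rightarrow> complex"
  assumes f: "\<And>n. f n \<in> borel_measurable M" and g: "g \<in> borel_measurable M"
    and w: "w \<in> L12 M" and lim: "AE x in M. (\<lambda>n. f n x) \<longlonglongrightarrow> g x"
    and bd: "\<And>n x. cmod (f n x) \<le> cmod (w x)" "\<And>x. cmod (g x) \<le> cmod (w x)"
  shows "(\<lambda>n. L12_norm M (\<lambda>x. f n x - g x)) \<longlonglongrightarrow> 0"
proof -
  note [measurable] = f g
  have "(\<lambda>n. LINT x|M. cmod (f n x - g x)) \<longlonglongrightarrow> (LINT x|M. 0)"
  proof (rule integral_dominated_convergence[where w = "\<lambda>x. 2 * cmod (w x)"])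
    show "integrable M (\<lambda>x. 2 * cmod (w x))" using w by (simp add: L12_def)
    show "AE x in M. (\<lambda>n. cmod (f n x - g x)) \<longlonglongrightarrow> 0"
      using lim
    proof eventually_elim
      case (elim x)
      from tendsto_norm[OF LIM_zero[OF elim]] show ?case by simp
    qed
    fix n
    show "AE x in M. norm (cmod (f n x - g x)) \<le> 2 * cmod (w x)"
    proof (rule AE_I2)
      fix x
      show "norm (cmod (f n x - g x)) \<le> 2 * cmod (w x)"
        using norm_triangle_ineq4[of "f n x" "g x"] bd(1)[of n x] bd(2)[of x] by simp
    qed
  qed measurable
  from tendsto_add[OF L2_dominated_convergence[OF f g _ lim bd] this] w
  show ?thesis by (simp add: L12_norm_def L12_def)
qed

lemma L12_dominated:
  assumes "f \<in> borel_measurable M" "w \<in> L12 M" "\<And>x. cmod (f x) \<le> cmod (w x)"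
  shows "f \<in> L12 M"
  using assms L2_dominated(1)[of f M w] unfolding L12_def
  by (auto intro: Bochner_Integration.integrable_bound[of M w f])

text \<open>The subspace is kept abstract because the density argument is run twice: for locally
  constant functions of bounded support and for the span of the orthonormal system.\<close>

locale L12_subspace =
  fixes M :: "'a measure" and \<S> :: "('a \<Rightarrow> complex) set"
  assumes L12: "f \<in> \<S> \<Longrightarrow> f \<in> L12 M"
    and zero: "(\<lambda>x. 0) \<in> \<S>"
    and add: "f \<in> \<S> \<Longrightarrow> g \<in> \<S> \<Longrightarrow> (\<lambda>x. f x + g x) \<in> \<S>"
    and cmult: "f \<in> \<S> \<Longrightarrow> (\<lambda>x. a * f x) \<in> \<S>"
begin

definition closure12 :: "('a \<Rightarrow> complex) set" where
  "closure12 = {f \<in> L12 M. \<forall>\<epsilon>>0. \<exists>g\<in>\<S>. L12_norm M (\<lambda>x. f x - g x) < \<epsilon>}"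

lemma sum_mem: "(\<And>i. i \<in> F \<Longrightarrow> f i \<in> \<S>) \<Longrightarrow> (\<lambda>x. \<Sum>i\<in>F. f i x) \<in> \<S>"
  by (induction F rule: infinite_finite_induct) (auto simp: zero add)

lemma closure12I:
  assumes "f \<in> L12 M" "\<And>\<epsilon>. \<epsilon> > 0 \<Longrightarrow> \<exists>g\<in>closure12. L12_norm M (\<lambda>x. f x - g x) < \<epsilon>"
  shows "f \<in> closure12"
  unfolding closure12_def
proof (intro CollectI conjI allI impI assms(1))
  fix \<epsilon> :: real assume "\<epsilon> > 0"
  then obtain g where g: "g \<in> closure12" "L12_norm M (\<lambda>x. f x - g x) < \<epsilon> / 2"
    using assms(2)[of "\<epsilon> / 2"] by auto
  then obtain h where h: "h \<in> \<S>" "L12_norm M (\<lambda>x. g x - h x) < \<epsilon> / 2"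
    using \<open>\<epsilon> > 0\<close> unfolding closure12_def by (auto dest!: spec[of _ "\<epsilon> / 2"])
  have "L12_norm M (\<lambda>x. f x - h x) < \<epsilon>"
    using L12_norm_triangle[of f M g h] g h assms(1) L12 by (auto simp: closure12_def)
  with h show "\<exists>h\<in>\<S>. L12_norm M (\<lambda>x. f x - h x) < \<epsilon>" by blast
qed

lemma subset_closure12: "f \<in> \<S> \<Longrightarrow> f \<in> closure12"
  unfolding closure12_def using L12 by (auto intro!: bexI[of _ f] simp: L12_norm_def L2_norm_def)

lemma closure12_cmult:
  assumes "f \<in> closure12" shows "(\<lambda>x. a * f x) \<in> closure12"
  unfolding closure12_def
proof (intro CollectI conjI allI impI)
  show "(\<lambda>x. a * f x) \<in> L12 M" using assms by (auto simp: closure12_def L12_cmult)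
  fix \<epsilon> :: real assume "\<epsilon> > 0"
  hence "\<epsilon> / (cmod a + 1) > 0" by (simp add: add_nonneg_pos)
  then obtain g where g: "g \<in> \<S>" "L12_norm M (\<lambda>x. f x - g x) < \<epsilon> / (cmod a + 1)"
    using assms unfolding closure12_def by blast
  have pos: "cmod a + 1 > 0" by (simp add: add_nonneg_pos)
  have "L12_norm M (\<lambda>x. a * f x - a * g x) = cmod a * L12_norm M (\<lambda>x. f x - g x)"
    using L12_norm_cmult[of M a "\<lambda>x. f x - g x"] by (simp add: right_diff_distrib)
  also have "\<dots> \<le> (cmod a + 1) * L12_norm M (\<lambda>x. f x - g x)"
    by (intro mult_right_mono L12_norm_ge) auto
  also have "\<dots> < (cmod a + 1) * (\<epsilon> / (cmod a + 1))"
    using g(2) pos by (rule mult_strict_left_mono)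
  also have "\<dots> = \<epsilon>" using pos by simp
  finally show "\<exists>g\<in>\<S>. L12_norm M (\<lambda>x. a * f x - g x) < \<epsilon>"
    using cmult[OF g(1)] by (intro bexI[of _ "\<lambda>x. a * g x"])
qed

lemma closure12_add:
  assumes f: "f \<in> closure12" and g: "g \<in> closure12" shows "(\<lambda>x. f x + g x) \<in> closure12"
  unfolding closure12_def
proof (intro CollectI conjI allI impI)
  show "(\<lambda>x. f x + g x) \<in> L12 M" using assms by (auto simp: closure12_def L12_add)
  fix \<epsilon> :: real assume "\<epsilon> > 0"
  hence "\<epsilon> / 2 > 0" by simp
  then obtain f' g' where 1: "f' \<in> \<S>" "L12_norm M (\<lambda>x. f x - f' x) < \<epsilon> / 2"
      and 2: "g' \<in> \<S>" "L12_norm M (\<lambda>x. g x - g' x) < \<epsilon> / 2"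
    using f g unfolding closure12_def by blast
  have "L12_norm M (\<lambda>x. (f x - f' x) + (g x - g' x)) < \<epsilon>"
    using L12_norm_add_le[of "\<lambda>x. f x - f' x" M "\<lambda>x. g x - g' x"] 1 2 f g L12
    by (auto simp: closure12_def L12_diff)
  thus "\<exists>h\<in>\<S>. L12_norm M (\<lambda>x. f x + g x - h x) < \<epsilon>"
    using add[OF 1(1) 2(1)] by (intro bexI[of _ "\<lambda>x. f' x + g' x"]) (auto simp: algebra_simps)
qed

lemma closure12_sum: "(\<And>i. i \<in> F \<Longrightarrow> f i \<in> closure12) \<Longrightarrow> (\<lambda>x. \<Sum>i\<in>F. f i x) \<in> closure12"
  by (induction F rule: infinite_finite_induct) (auto simp: subset_closure12 zero closure12_add)

text \<open>All limits of the density proof pass through this lemma: one majorant lying in both L1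
  and L2 gives convergence in both norms at once.\<close>

lemma closure12_dominated:
  assumes f: "\<And>n. f n \<in> closure12" and g: "g \<in> borel_measurable M"
    and w: "w \<in> L12 M" and lim: "AE x in M. (\<lambda>n::nat. f n x) \<longlonglongrightarrow> g x"
    and bd: "\<And>n x. cmod (f n x) \<le> cmod (w x)" "\<And>x. cmod (g x) \<le> cmod (w x)"
  shows "g \<in> closure12"
proof (rule closure12I)
  show g12: "g \<in> L12 M" by (rule L12_dominated[OF g w bd(2)])
  have "(\<lambda>n. L12_norm M (\<lambda>x. f n x - g x)) \<longlonglongrightarrow> 0"
    using f by (intro L12_dominated_convergence[OF _ g w lim bd])
      (auto simp: closure12_def L12_def dest: L2_measurable)
  moreover have "L12_norm M (\<lambda>x. f n x - g x) = L12_norm M (\<lambda>x. g x - f n x)" for n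
    by (simp add: L12_norm_def norm_minus_commute L2_norm_minus_commute[of M g])
  ultimately have lim0: "(\<lambda>n. L12_norm M (\<lambda>x. g x - f n x)) \<longlonglongrightarrow> 0" by simp
  fix \<epsilon> :: real assume "\<epsilon> > 0"
  from order_tendstoD(2)[OF lim0 this] obtain n where "L12_norm M (\<lambda>x. g x - f n x) < \<epsilon>"
    by (auto simp: eventually_sequentially)
  with f show "\<exists>h\<in>closure12. L12_norm M (\<lambda>x. g x - h x) < \<epsilon>" by blast
qed

end

context haar_field
begin

lemma indicator_L12:
  assumes "S \<in> sets borel" "emeasure \<mu> S < \<infinity>"
  shows "(\<lambda>x. indicator S x) \<in> L12 \<mu>"
  using L2_indicator_bounded[of S "\<lambda>_. 1" 1] assms by (simp add: L12_def sets_mu)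

lemma finite_emeasure_subset_ball:
  assumes "S \<subseteq> fls_ball i" shows "emeasure \<mu> S < \<infinity>"
  using emeasure_mono[OF assms, of \<mu>] emeasure_ball_finite[of i] by (simp add: order_le_less_trans)

end

text \<open>\<open>good\<close> marks cylinders whose indicators are known to lie in
  \<open>\<S>\<close>. They have to exist around every nonzero point and to stay good when shrunk
  and recentred; the point 0 is exempt because wavelet supports accumulate there.\<close>

locale cylinder_span = haar_field p s c \<mu> + L12_subspace \<mu> \<S>
  for p s and c :: "'a::{field,finite} \<Rightarrow> nat \<Rightarrow> nat" and \<mu> \<S> +
  fixes good :: "'a fls \<Rightarrow> int \<Rightarrow> bool"
  assumes good_mono: "good x m \<Longrightarrow> m \<le> n \<Longrightarrow> y \<in> cyl x m \<Longrightarrow> good y n"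
    and good_ex: "x \<noteq> 0 \<Longrightarrow> \<exists>m. good x m"
    and good_indicator: "good x m \<Longrightarrow> (\<lambda>y. indicator (cyl x m) y) \<in> \<S>"
begin

text \<open>The sets \<open>S n\<close> are finite unions of good cylinders and exhaust the given
  set except possibly for 0. Cutting with a ball provides the integrable majorant.\<close>

lemma indicator_open_Int_ball:
  assumes U: "open U"
  shows "(\<lambda>x. indicator (U \<inter> fls_ball (- int R)) x) \<in> closure12"
proof -
  define S where "S n = {x\<in>fls_ball (- int R). good x (int n) \<and> cyl x (int n) \<subseteq> U}" for n
  have abs: "y \<in> S n" if "x \<in> S n" "y \<in> cyl x (int n)" for x y n
    using that fls_ball_absorb[of "- int R" "int n" x y] cyl_eq[of y x "int n"]
      good_mono[of x "int n" "int n" y] by (auto simp: S_def)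
  have sub: "S n \<subseteq> fls_ball (- int R)" for n by (auto simp: S_def)
  have ind: "indicator (S n) x = (\<Sum>a\<in>fls_box (- int R) (int n) \<inter> S n. indicator (cyl a (int n)) x :: complex)" for x n
    by (rule indicator_cyl_decomp[OF sub abs])
  have Sn: "(\<lambda>x. indicator (S n) x) \<in> \<S>" for n
    unfolding ind by (intro sum_mem good_indicator) (auto simp: S_def)
  have lim: "(\<lambda>n. indicator (S n) x :: complex) \<longlonglongrightarrow> indicator (U \<inter> fls_ball (- int R)) x" if nz: "x \<noteq> 0" for x
  proof (cases "x \<in> U \<inter> fls_ball (- int R)")
    case True
    obtain m where m: "good x m" using good_ex[OF nz] by blast
    obtain k :: nat where k: "cyl x (int k) \<subseteq> U" using U True unfolding open_fls_iff by blast
    have "\<forall>\<^sub>F n in sequentially. indicator (S n) x = (1 :: complex)"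
      unfolding eventually_sequentially
    proof (intro exI[of _ "max (nat m) k"] allI impI)
      fix n assume n: "max (nat m) k \<le> n"
      hence "good x (int n)" using good_mono[OF m _ cyl_refl, of "int n"] by linarith
      moreover have "cyl x (int n) \<subseteq> U" using cyl_mono[of "int k" "int n" x x] n k by auto
      ultimately show "indicator (S n) x = (1 :: complex)" using True by (simp add: S_def)
    qed
    thus ?thesis using True by (simp add: tendsto_eventually)
  next
    case False
    hence "x \<notin> S n" for n unfolding S_def using cyl_refl[of x "int n"] by blast
    thus ?thesis using False by simp
  qed
  show ?thesis
  proof (rule closure12_dominated[where f = "\<lambda>n x. indicator (S n) x" and w = "\<lambda>x. indicator (fls_ball (- int R)) x"])
    show "(\<lambda>x. indicator (S n) x) \<in> closure12" for n by (rule subset_closure12[OF Sn])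
    show "(\<lambda>x. indicator (U \<inter> fls_ball (- int R)) x) \<in> borel_measurable \<mu>"
      using borel_open[OF open_Int[OF U open_fls_ball]] by simp
    show "(\<lambda>x. indicator (fls_ball (- int R)) x) \<in> L12 \<mu>"
      by (intro indicator_L12 emeasure_ball_finite) simp
    show "AE x in \<mu>. (\<lambda>n. indicator (S n) x :: complex) \<longlonglongrightarrow> indicator (U \<inter> fls_ball (- int R)) x"
      using AE_nonzero by eventually_elim (rule lim)
  qed (use sub in \<open>auto simp: indicator_def\<close>)
qed

text \<open>Dynkin's argument starting from open sets. It is run inside a fixed ball, so that
  complements and countable disjoint unions keep an integrable majorant.\<close>

lemma indicator_Int_ball:
  assumes "S \<in> sets borel"
  shows "(\<lambda>x. indicator (S \<inter> fls_ball (- int R)) x) \<in> closure12"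
proof (rule sigma_sets_induct_disjoint[of "{S. open S}" UNIV S])
  let ?B = "fls_ball (- int R) :: 'a fls set"
  show "{S :: 'a fls set. open S} \<subseteq> Pow UNIV" by simp
  show "Int_stable {S :: 'a fls set. open S}" by (rule Int_stable_open)
  show "S \<in> sigma_sets UNIV {S. open S}" using assms by (simp add: sets_borel_eq_sigma_open)
  show "(\<lambda>x. indicator (A \<inter> ?B) x) \<in> closure12" if "A \<in> {S. open S}" for A
    using that indicator_open_Int_ball by simp
  show "(\<lambda>x. indicator ({} \<inter> ?B) x) \<in> closure12" by (simp add: subset_closure12 zero)
  show "(\<lambda>x. indicator ((UNIV - A) \<inter> ?B) x) \<in> closure12"
    if "(\<lambda>x. indicator (A \<inter> ?B) x) \<in> closure12" for A
  proof -
    have "(\<lambda>x. indicator (UNIV \<inter> ?B) x + (-1) * indicator (A \<inter> ?B) x) \<in> closure12"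
      by (intro closure12_add closure12_cmult that indicator_open_Int_ball) auto
    moreover have "(\<lambda>x. indicator (UNIV \<inter> ?B) x + (-1) * indicator (A \<inter> ?B) x) =
        (\<lambda>x. indicator ((UNIV - A) \<inter> ?B) x :: complex)"
      by (auto simp: indicator_def)
    ultimately show ?thesis by simp
  qed
  show "(\<lambda>x. indicator ((\<Union>i. A i) \<inter> ?B) x) \<in> closure12"
    if disj: "disjoint_family A" and sets: "range A \<subseteq> sigma_sets UNIV {S. open S}"
      and mem: "\<And>i. (\<lambda>x. indicator (A i \<inter> ?B) x) \<in> closure12" for A :: "nat \<Rightarrow> 'a fls set"
  proof -
    have A [measurable]: "A i \<in> sets borel" for i
      using sets by (auto simp: sets_borel_eq_sigma_open)
    have part: "(\<Sum>i<n. indicator (A i \<inter> ?B) x :: complex) = indicator (\<Union>i<n. A i \<inter> ?B) x" for n x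
      using disj by (intro indicator_UN_disjoint[symmetric]) (auto simp: disjoint_family_on_def)
    show ?thesis
    proof (rule closure12_dominated[where f = "\<lambda>n x. \<Sum>i<n. indicator (A i \<inter> ?B) x" and w = "\<lambda>x. indicator ?B x"])
      show "(\<lambda>x. \<Sum>i<n. indicator (A i \<inter> ?B) x) \<in> closure12" for n
        by (rule closure12_sum[OF mem])
      show "(\<lambda>x. indicator ((\<Union>i. A i) \<inter> ?B) x) \<in> borel_measurable \<mu>" by simp
      show "(\<lambda>x. indicator ?B x) \<in> L12 \<mu>"
        by (intro indicator_L12 emeasure_ball_finite) simp
      show "AE x in \<mu>. (\<lambda>n. \<Sum>i<n. indicator (A i \<inter> ?B) x :: complex) \<longlonglongrightarrow> indicator ((\<Union>i. A i) \<inter> ?B) x"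
      proof (rule AE_I2)
        fix x
        have "(\<Union>i. A i) \<inter> ?B = (\<Union>i. A i \<inter> ?B)" by blast
        moreover have "(\<lambda>n. indicator (\<Union>i<n. A i \<inter> ?B) x :: complex) \<longlonglongrightarrow> indicator (\<Union>i. A i \<inter> ?B) x"
          by (rule LIMSEQ_indicator_UN)
        ultimately show "(\<lambda>n. \<Sum>i<n. indicator (A i \<inter> ?B) x :: complex) \<longlonglongrightarrow> indicator ((\<Union>i. A i) \<inter> ?B) x"
          by (simp add: part)
      qed
    next
      show "cmod (\<Sum>i<n. indicator (A i \<inter> ?B) x) \<le> cmod (indicator ?B x)" for n x
        unfolding part by (auto simp: indicator_def)
    qed (auto simp: indicator_def)
  qed
qed

lemma indicator_mem:
  assumes S: "S \<in> sets borel" "emeasure \<mu> S < \<infinity>"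
  shows "(\<lambda>x. indicator S x) \<in> closure12"
proof (rule closure12_dominated[where f = "\<lambda>n x. indicator (S \<inter> fls_ball (- int n)) x" and w = "\<lambda>x. indicator S x"])
  show "(\<lambda>x. indicator (S \<inter> fls_ball (- int n)) x) \<in> closure12" for n
    by (rule indicator_Int_ball[OF S(1)])
  show "(\<lambda>x. indicator S x) \<in> L12 \<mu>" by (rule indicator_L12[OF S])
  show "AE x in \<mu>. (\<lambda>n. indicator (S \<inter> fls_ball (- int n)) x :: complex) \<longlonglongrightarrow> indicator S x"
  proof (rule AE_I2, rule tendsto_eventually)
    fix x :: "'a fls"
    obtain k where k: "x \<in> fls_ball (- int k)" using fls_ball_cover by blast
    show "\<forall>\<^sub>F n in sequentially. indicator (S \<inter> fls_ball (- int n)) x = (indicator S x :: complex)"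
      unfolding eventually_sequentially using k by (intro exI[of _ k]) (auto simp: indicator_def mem_fls_ball)
  qed
qed (use S in \<open>auto simp: indicator_def\<close>)

text \<open>Simple functions dominated by \<open>2 * f x\<close> approximate \<open>f\<close>.
  Integrability makes their nonzero level sets finite in measure, so the indicators of these sets
  are already available.\<close>

theorem L12_subset_closure12: "f \<in> L12 \<mu> \<Longrightarrow> f \<in> closure12"
proof -
  assume f: "f \<in> L12 \<mu>"
  have fm: "f \<in> borel_measurable \<mu>" by (rule L2_measurable[OF L12_L2[OF f]])
  obtain F where F: "\<And>i. simple_function \<mu> (F i)" "\<And>x. (\<lambda>i. F i x) \<longlonglongrightarrow> f x"
      "\<And>i x. dist (F i x) 0 \<le> 2 * dist (f x) 0"
    using borel_measurable_implies_sequence_metric[OF fm, of 0] by auto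
  have bd: "cmod (F i x) \<le> cmod (2 * f x)" for i x
    using F(3)[of i x] by (simp add: norm_mult)
  have w: "(\<lambda>x. 2 * f x) \<in> L12 \<mu>" by (rule L12_cmult[OF f])
  show "f \<in> closure12"
  proof (rule closure12_dominated[where f = F, OF _ fm w])
    fix i
    have meas: "F i \<in> borel_measurable borel"
      using borel_measurable_simple_function[OF F(1)[of i]] by simp
    have int: "integrable \<mu> (F i)"
      using meas bd w by (intro Bochner_Integration.integrable_bound[of \<mu> "\<lambda>x. 2 * f x" "F i"]) (auto simp: L12_def)
    have fin: "finite (range (F i))" using simple_functionD(1)[OF F(1)[of i]] by simp
    have "F i = (\<lambda>x. \<Sum>y\<in>range (F i) - {0}. y * indicator (F i -` {y}) x)"
    proof
      fix x
      have "(\<Sum>y\<in>range (F i) - {0}. y * indicator (F i -` {y}) x) =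
          (\<Sum>y\<in>range (F i) - {0}. if y = F i x then F i x else 0)"
        by (intro sum.cong) (auto simp: indicator_def)
      also have "\<dots> = F i x" using fin by (subst sum.delta) auto
      finally show "F i x = (\<Sum>y\<in>range (F i) - {0}. y * indicator (F i -` {y}) x)" ..
    qed
    moreover have "(\<lambda>x. \<Sum>y\<in>range (F i) - {0}. y * indicator (F i -` {y}) x) \<in> closure12"
    proof (intro closure12_sum closure12_cmult indicator_mem)
      fix y assume y: "y \<in> range (F i) - {0}"
      show s: "F i -` {y} \<in> sets borel" using measurable_sets[OF meas, of "{y}"] by simp
      have "integrable \<mu> (\<lambda>x. indicator (F i -` {y}) x :: real)"
      proof (rule Bochner_Integration.integrable_bound)
        show "integrable \<mu> (\<lambda>x. 1 / cmod y * cmod (F i x))"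
          by (intro integrable_mult_right integrable_norm int)
        show "(\<lambda>x. indicator (F i -` {y}) x :: real) \<in> borel_measurable \<mu>" using s by simp
      qed (use y in \<open>auto simp: indicator_def\<close>)
      thus "emeasure \<mu> (F i -` {y}) < \<infinity>"
        by (subst (asm) integrable_indicator_iff) auto
    qed
    ultimately show "F i \<in> closure12" by (rule ssubst[where P = "\<lambda>f. f \<in> closure12"])
  next
    show "AE x in \<mu>. (\<lambda>i. F i x) \<longlonglongrightarrow> f x" by (rule AE_I2) (rule F(2))
    show "cmod (F i x) \<le> cmod (2 * f x)" for i x by (rule bd)
  qed (simp add: norm_mult)
qed

lemma L12_approx:
  assumes "f \<in> L12 \<mu>" "\<epsilon> > 0"
  shows "\<exists>g\<in>\<S>. L12_norm \<mu> (\<lambda>x. f x - g x) < \<epsilon>"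
  using L12_subset_closure12[OF assms(1)] assms(2) by (simp add: closure12_def)

end

context haar_field
begin

text \<open>A ball has finite measure, so the inequality \<open>a \<le> 1 + a * a\<close> makes the
  truncation of a square-integrable function integrable.\<close>

lemma L2_truncate:
  assumes f: "f \<in> L2 \<mu>"
  shows "(\<lambda>x. indicator (fls_ball (- int n)) x * f x) \<in> L12 \<mu>"
    and "(\<lambda>n. L2_norm \<mu> (\<lambda>x. indicator (fls_ball (- int n)) x * f x - f x)) \<longlonglongrightarrow> 0"
proof -
  have m [measurable]: "f \<in> borel_measurable borel" by (rule L2_mu_measurable[OF f])
  have L2: "(\<lambda>x. indicator (fls_ball (- int n)) x * f x) \<in> L2 \<mu>" for n
    by (rule L2_dominated(1)[OF _ f]) (auto simp: indicator_def)
  have "integrable \<mu> (\<lambda>x. indicator (fls_ball (- int n)) x * f x)"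
  proof (rule Bochner_Integration.integrable_bound)
    show "integrable \<mu> (\<lambda>x. indicator (fls_ball (- int n)) x + (cmod (f x))\<^sup>2)"
      by (intro Bochner_Integration.integrable_add L2_integrable f integrable_real_indicator emeasure_ball_finite) simp
    show "AE x in \<mu>. norm (indicator (fls_ball (- int n)) x * f x) \<le> norm (indicator (fls_ball (- int n)) x + (cmod (f x))\<^sup>2)"
    proof (rule AE_I2)
      fix x
      have "a \<le> 1 + a\<^sup>2" for a :: real
        using sum_power2_ge_zero[of "a - 1/2" 0] by (simp add: power2_diff power_divide)
      thus "norm (indicator (fls_ball (- int n)) x * f x) \<le> norm (indicator (fls_ball (- int n)) x + (cmod (f x))\<^sup>2)"
        by (auto simp: indicator_def)
    qed
  qed simp
  with L2 show "(\<lambda>x. indicator (fls_ball (- int n)) x * f x) \<in> L12 \<mu>" by (simp add: L12_def)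
  show "(\<lambda>n. L2_norm \<mu> (\<lambda>x. indicator (fls_ball (- int n)) x * f x - f x)) \<longlonglongrightarrow> 0"
  proof (rule L2_dominated_convergence[OF _ _ f])
    show "AE x in \<mu>. (\<lambda>n. indicator (fls_ball (- int n)) x * f x) \<longlonglongrightarrow> f x"
    proof (rule AE_I2, rule tendsto_eventually)
      fix x :: "'a fls"
      obtain k where k: "x \<in> fls_ball (- int k)" using fls_ball_cover by blast
      show "\<forall>\<^sub>F n in sequentially. indicator (fls_ball (- int n)) x * f x = f x"
        unfolding eventually_sequentially using k by (intro exI[of _ k]) (auto simp: indicator_def mem_fls_ball)
    qed
  qed (auto simp: indicator_def)
qed

end

lemma (in cylinder_span) L2_approx:
  assumes f: "f \<in> L2 \<mu>" and "\<epsilon> > 0"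
  shows "\<exists>g\<in>\<S>. L2_norm \<mu> (\<lambda>x. f x - g x) < \<epsilon>"
proof -
  let ?f = "\<lambda>n x. indicator (fls_ball (- int n)) x * f x"
  obtain n where "L2_norm \<mu> (\<lambda>x. ?f n x - f x) < \<epsilon> / 2"
    using order_tendstoD(2)[OF L2_truncate(2)[OF f], of "\<epsilon> / 2"] \<open>\<epsilon> > 0\<close> by (auto simp: eventually_sequentially)
  moreover obtain g where g: "g \<in> \<S>" "L12_norm \<mu> (\<lambda>x. ?f n x - g x) < \<epsilon> / 2"
    using L12_approx[OF L2_truncate(1)[OF f], of "\<epsilon> / 2" n] \<open>\<epsilon> > 0\<close> by auto
  moreover have "?f n \<in> L2 \<mu>" "g \<in> L2 \<mu>"
    using L2_truncate(1)[OF f] L12[OF g(1)] by (auto simp: L12_def)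
  ultimately have "L2_norm \<mu> (\<lambda>x. f x - g x) < \<epsilon>"
    using L2_norm_triangle[OF f, of "?f n" g] L12_norm_ge(1)[of \<mu> "\<lambda>x. ?f n x - g x"]
      L2_norm_minus_commute[of \<mu> f "?f n"] by linarith
  with g show ?thesis by blast
qed

section \<open>The Plancherel theorem\<close>

context haar_field
begin

lemma measurable_pair [measurable]: "pair b \<in> borel_measurable borel"
  by (rule borel_measurable_continuous_onI[OF continuous_on_pair])

lemma fls_affine_simps: "fls_affine 0 h x = x - h" "fls_affine n 0 x = fls_shift n x"
  by (simp_all add: fls_affine_def)

lemma measurable_fls_shift [measurable]: "fls_shift n \<in> measurable borel (borel :: 'a fls measure)"
  using measurable_affine[of n 0] by (simp add: fls_affine_simps cong: measurable_cong)

text \<open>If the character is trivial on \<open>fls_ball m\<close>, it is constant on the coset.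
  Otherwise translation by a one-digit element \<open>d\<close> of that ball preserves the integral
  and multiplies it by \<open>pair b d\<close>, which is not 1.\<close>

lemma integral_pair_cyl:
  "(LINT x|\<mu>. indicator (cyl a m) x * pair b x) =
     (if b \<in> fls_ball (- m) then of_real (q powi (- m)) * pair b a else 0)"
proof (cases "b \<in> fls_ball (- m)")
  case True
  have *: "pair b x = pair b a" if "x \<in> cyl a m" for x
  proof (rule pair_cong)
    fix j assume "b $$ (-1 - j) \<noteq> 0"
    hence "\<not> -1 - j < - m" using True by (auto simp: mem_fls_ball)
    thus "x $$ j = a $$ j" using that by (simp add: mem_cyl)
  qed
  have "(\<lambda>x. indicator (cyl a m) x * pair b x) = (\<lambda>x. of_real (indicator (cyl a m) x) * pair b a)"
  proof
    fix x show "indicator (cyl a m) x * pair b x = of_real (indicator (cyl a m) x) * pair b a"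
      by (cases "x \<in> cyl a m") (simp_all add: * [of x])
  qed
  hence "(LINT x|\<mu>. indicator (cyl a m) x * pair b x) = (LINT x|\<mu>. of_real (indicator (cyl a m) x) * pair b a)"
    by simp
  also have "\<dots> = of_real (q powi (- m)) * pair b a"
    by (simp add: integral_complex_of_real measure_cyl del: of_real_indicator)
  finally show ?thesis using True by simp
next
  case False
  then obtain k where k: "k < - m" "b $$ k \<noteq> 0" by (auto simp: mem_fls_ball)
  obtain u where u: "gf_pair (b $$ k) u \<noteq> 1" using gf_pair_nondegenerate[OF k(2)] by blast
  define d where "d = fls_monom (-1 - k) u"
  have d: "pair b d \<noteq> 1" using u by (simp add: d_def pair_monom)
  have "fls_affine 0 (- d) x \<in> cyl a m \<longleftrightarrow> x \<in> cyl a m" for x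
    using k(1) by (auto simp: fls_affine_simps mem_cyl d_def)
  hence "indicator (cyl a m) (fls_affine 0 (- d) x) * pair b (fls_affine 0 (- d) x) =
      pair b d * (indicator (cyl a m) x * pair b x)" for x
    by (simp add: indicator_def pair_add fls_affine_simps)
  hence "(LINT x|\<mu>. indicator (cyl a m) (fls_affine 0 (- d) x) * pair b (fls_affine 0 (- d) x)) =
      pair b d * (LINT x|\<mu>. indicator (cyl a m) x * pair b x)"
    by simp
  moreover have "(LINT x|\<mu>. indicator (cyl a m) (fls_affine 0 (- d) x) * pair b (fls_affine 0 (- d) x)) =
      (LINT x|\<mu>. indicator (cyl a m) x * pair b x)"
    using integral_affine(1)[of "\<lambda>x. indicator (cyl a m) x * pair b x" 0 "- d"] by simp
  ultimately show ?thesis using d False by simp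
qed

lemma integral_pair_ball:
  "(LINT x|\<mu>. indicator (fls_ball m) x * pair b x) = (if b \<in> fls_ball (- m) then of_real (q powi (- m)) else 0)"
  using integral_pair_cyl[of 0 m b] by (simp add: cyl_0 cong: if_cong)

definition fourier :: "('a fls \<Rightarrow> complex) \<Rightarrow> 'a fls \<Rightarrow> complex" where
  "fourier f b = (LINT x|\<mu>. f x * cnj (pair b x))"

lemma integrable_mult_cnj_pair:
  assumes "integrable \<mu> f" shows "integrable \<mu> (\<lambda>x. f x * cnj (pair b x))"
proof (rule Bochner_Integration.integrable_bound[OF assms])
  have [measurable]: "f \<in> borel_measurable borel"
    using borel_measurable_integrable[OF assms] by simp
  show "(\<lambda>x. f x * cnj (pair b x)) \<in> borel_measurable \<mu>" by simp
qed (simp add: norm_mult norm_pair)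

lemma fourier_diff:
  assumes "integrable \<mu> f" "integrable \<mu> g"
  shows "fourier (\<lambda>x. f x - g x) b = fourier f b - fourier g b"
  using integrable_mult_cnj_pair[OF assms(1)] integrable_mult_cnj_pair[OF assms(2)]
  by (simp add: fourier_def left_diff_distrib)

lemma fourier_add:
  assumes "integrable \<mu> f" "integrable \<mu> g"
  shows "fourier (\<lambda>x. f x + g x) b = fourier f b + fourier g b"
  using integrable_mult_cnj_pair[OF assms(1)] integrable_mult_cnj_pair[OF assms(2)]
  by (simp add: fourier_def distrib_right)

lemma fourier_cmult: "fourier (\<lambda>x. a * f x) b = a * fourier f b"
  by (simp add: fourier_def mult.assoc)

lemma fourier_sum:
  assumes "\<And>i. i \<in> F \<Longrightarrow> integrable \<mu> (f i)"
  shows "fourier (\<lambda>x. \<Sum>i\<in>F. f i x) b = (\<Sum>i\<in>F. fourier (f i) b)"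
  unfolding fourier_def sum_distrib_right
  by (rule Bochner_Integration.integral_sum) (use assms integrable_mult_cnj_pair in auto)

lemma norm_fourier_le:
  assumes "integrable \<mu> f" shows "cmod (fourier f b) \<le> (LINT x|\<mu>. cmod (f x))"
  using integral_norm_bound[of \<mu> "\<lambda>x. f x * cnj (pair b x)"]
  by (simp add: fourier_def norm_mult norm_pair)

lemma fourier_cyl:
  "fourier (\<lambda>x. indicator (cyl a m) x) b = indicator (fls_ball (- m)) b * (of_real (q powi (- m)) * cnj (pair b a))"
proof -
  have "- b \<in> fls_ball (- m) \<longleftrightarrow> b \<in> fls_ball (- m)" by (simp add: mem_fls_ball)
  thus ?thesis
    using integral_pair_cyl[of a m "- b"] by (simp add: fourier_def cnj_pair(2) indicator_def)
qed

text \<open>The Schwartz-Bruhat functions of the local field: bounded support, and locally constant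
  with one fineness \<open>m\<close> for all points.\<close>

definition steps :: "('a fls \<Rightarrow> complex) set" where
  "steps = {g. \<exists>i m. i \<le> m \<and> (\<forall>x. x \<notin> fls_ball i \<longrightarrow> g x = 0) \<and> (\<forall>x y. y \<in> cyl x m \<longrightarrow> g y = g x)}"

lemma steps_expand:
  fixes g :: "'a fls \<Rightarrow> complex"
  assumes im: "i \<le> m" and supp: "\<And>x. x \<notin> fls_ball i \<Longrightarrow> g x = 0"
    and const: "\<And>x y. y \<in> cyl x m \<Longrightarrow> g y = g x"
  shows "g x = (\<Sum>a\<in>fls_box i m. g a * indicator (cyl a m) x)"
proof -
  have "(\<Sum>a\<in>fls_box i m. g a * indicator (cyl a m) x) =
      (\<Sum>a\<in>fls_box i m. if a = fls_trunc m x then g x else 0)"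
  proof (rule sum.cong[OF refl])
    fix a :: "'a fls" assume a: "a \<in> fls_box i m"
    have "x \<in> cyl a m \<longleftrightarrow> a = fls_trunc m x"
    proof
      assume "x \<in> cyl a m"
      with a show "a = fls_trunc m x"
        by (intro fls_eqI) (auto simp: fls_box_def mem_cyl)
    qed (simp add: mem_cyl)
    moreover have "g (fls_trunc m x) = g x" by (rule const) (simp add: mem_cyl)
    ultimately show "g a * indicator (cyl a m) x = (if a = fls_trunc m x then g x else 0)"
      by (auto simp: indicator_def)
  qed
  also have "\<dots> = (if fls_trunc m x \<in> fls_box i m then g x else 0)"
    by (simp add: finite_fls_box)
  also have "\<dots> = g x"
  proof (cases "x \<in> fls_ball i")
    case True
    hence "fls_trunc m x \<in> fls_box i m" by (auto simp: fls_box_def mem_fls_ball)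
    thus ?thesis by simp
  qed (simp add: supp)
  finally show ?thesis ..
qed

lemma stepsE:
  assumes "g \<in> steps"
  obtains i m where "i \<le> m" "g = (\<lambda>x. \<Sum>a\<in>fls_box i m. g a * indicator (cyl a m) x)"
proof -
  obtain i m where im: "i \<le> m" and supp: "\<And>x. x \<notin> fls_ball i \<Longrightarrow> g x = 0"
    and const: "\<And>x y. y \<in> cyl x m \<Longrightarrow> g y = g x"
    using assms unfolding steps_def by blast
  show thesis by (rule that[OF im]) (rule ext, rule steps_expand[OF im supp const])
qed

lemma cyl_L12: "(\<lambda>x. indicator (cyl a m) x) \<in> L12 \<mu>"
  by (intro indicator_L12 emeasure_cyl_finite) simp

lemma cylinder_span_steps: "cylinder_span p s c \<mu> steps (\<lambda>_ _. True)"
proof unfold_locales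
  fix f assume "f \<in> steps"
  then obtain i m where "f = (\<lambda>x. \<Sum>a\<in>fls_box i m. f a * indicator (cyl a m) x)" by (rule stepsE)
  moreover have "(\<lambda>x. \<Sum>a\<in>fls_box i m. f a * indicator (cyl a m) x) \<in> L12 \<mu>"
    by (intro L12_sum L12_cmult cyl_L12)
  ultimately show "f \<in> L12 \<mu>" by (rule ssubst[where P = "\<lambda>f. f \<in> L12 \<mu>"])
next
  fix f g :: "'a fls \<Rightarrow> complex" assume "f \<in> steps" "g \<in> steps"
  then obtain i m i' m' where f: "i \<le> m" "\<And>x. x \<notin> fls_ball i \<Longrightarrow> f x = 0" "\<And>x y. y \<in> cyl x m \<Longrightarrow> f y = f x"
    and g: "i' \<le> m'" "\<And>x. x \<notin> fls_ball i' \<Longrightarrow> g x = 0" "\<And>x y. y \<in> cyl x m' \<Longrightarrow> g y = g x"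
    unfolding steps_def by blast
  show "(\<lambda>x. f x + g x) \<in> steps"
    unfolding steps_def mem_Collect_eq
  proof (rule exI[of _ "min i i'"], rule exI[of _ "max m m'"], intro conjI allI impI)
    fix x :: "'a fls" assume "x \<notin> fls_ball (min i i')"
    hence "x \<notin> fls_ball i" "x \<notin> fls_ball i'" by (auto simp: mem_fls_ball)
    thus "f x + g x = 0" using f(2) g(2) by simp
  next
    fix x y :: "'a fls" assume "y \<in> cyl x (max m m')"
    hence "y \<in> cyl x m" "y \<in> cyl x m'" by (auto simp: mem_cyl)
    thus "f y + g y = f x + g x" using f(3)[of y x] g(3)[of y x] by simp
  qed (use f(1) g(1) in linarith)
next
  fix f :: "'a fls \<Rightarrow> complex" and a assume "f \<in> steps"
  then obtain i m where f: "i \<le> m" "\<And>x. x \<notin> fls_ball i \<Longrightarrow> f x = 0" "\<And>x y. y \<in> cyl x m \<Longrightarrow> f y = f x"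
    unfolding steps_def by blast
  show "(\<lambda>x. a * f x) \<in> steps"
    unfolding steps_def mem_Collect_eq
    by (rule exI[of _ i], rule exI[of _ m], intro conjI allI impI f(1)) (simp add: f(2), metis f(3))
next
  show "(\<lambda>x. 0) \<in> steps" by (auto simp: steps_def)
next
  fix x :: "'a fls" and m
  show "(\<lambda>y. indicator (cyl x m) y) \<in> steps"
    unfolding steps_def mem_Collect_eq
  proof (rule exI[of _ "min m (fls_subdegree x)"], rule exI[of _ m], intro conjI allI impI)
    fix y :: "'a fls" assume "y \<notin> fls_ball (min m (fls_subdegree x))"
    then obtain j where "j < m" "j < fls_subdegree x" "y $$ j \<noteq> 0" by (auto simp: mem_fls_ball)
    hence "y \<notin> cyl x m" by (auto simp: mem_cyl)
    thus "indicator (cyl x m) y = (0 :: complex)" by simp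
  next
    fix y z :: "'a fls" assume "z \<in> cyl y m"
    hence "z \<in> cyl x m \<longleftrightarrow> y \<in> cyl x m" by (simp add: mem_cyl)
    thus "indicator (cyl x m) z = (indicator (cyl x m) y :: complex)" by (simp add: indicator_def)
  qed simp
qed auto

text \<open>The normalised indicators of cosets of \<open>fls_ball m\<close> are orthonormal, and so
  are their transforms. A step function and its transform are therefore orthonormal expansions with
  the same coefficients.\<close>

lemma fourier_steps:
  assumes "g \<in> steps"
  shows "fourier g \<in> L2 \<mu>" and "L2_norm \<mu> (fourier g) = L2_norm \<mu> g"
proof -
  obtain i m where im: "i \<le> m" and g: "g = (\<lambda>x. \<Sum>a\<in>fls_box i m. g a * indicator (cyl a m) x)"
    by (rule stepsE[OF assms])
  \<comment> \<open>The cosets have measure \<open>q powi (- m)\<close>, so \<open>r\<close>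
    normalises their indicators. The transforms live on a ball of measure \<open>q powi m\<close>,
    which calls for the factor \<open>1 / r\<close>.\<close>
  define r where "r = sqrt (q powi m)"
  have r: "r > 0" "r * r = q powi m" using q_pos by (auto simp: r_def)
  have rq: "q powi (- m) = 1 / (r * r)" by (simp add: r(2) power_int_minus inverse_eq_divide)
  define e where "e = (\<lambda>(a :: 'a fls) x. of_real r * indicator (cyl a m) x :: complex)"
  define f where "f = (\<lambda>(a :: 'a fls) b. of_real (1 / r) * (indicator (fls_ball (- m)) b * cnj (pair a b)))"
  have e2: "e a \<in> L2 \<mu>" for a
    unfolding e_def by (intro L2_cmult L12_L2 cyl_L12)
  have f2: "f a \<in> L2 \<mu>" for a
    unfolding f_def by (intro L2_cmult L2_indicator_bounded(1)[where C = 1] emeasure_ball_finite)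
      (auto simp: norm_pair)
  have eo: "biorthogonal \<mu> e e (fls_box i m)"
    unfolding biorthogonal_def
  proof (intro ballI conjI L2_mult_integrable e2)
    fix a b :: "'a fls" assume ab: "a \<in> fls_box i m" "b \<in> fls_box i m"
    show "(LINT x|\<mu>. e a x * cnj (e b x)) = (if a = b then 1 else 0)"
    proof (cases "a = b")
      case True
      have "(\<lambda>x. e a x * cnj (e b x)) = (\<lambda>x. of_real (r * r * indicator (cyl a m) x))"
        using True by (auto simp: e_def indicator_def)
      hence "(LINT x|\<mu>. e a x * cnj (e b x)) = of_real (LINT x|\<mu>. r * r * indicator (cyl a m) x)"
        by (simp only: integral_complex_of_real)
      also have "\<dots> = 1" using r(1) by (simp add: measure_cyl rq)
      finally show ?thesis using True by simp
    next
      case False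
      have "cyl a m \<inter> cyl b m = {}"
        using disjoint_cyl_box[of m i] ab False by (auto simp: disjoint_family_on_def)
      hence "(\<lambda>x. e a x * cnj (e b x)) = (\<lambda>x. 0)" by (auto simp: e_def indicator_def fun_eq_iff)
      thus ?thesis using False by (simp only:) simp
    qed
  qed
  have fo: "biorthogonal \<mu> f f (fls_box i m)"
    unfolding biorthogonal_def
  proof (intro ballI conjI L2_mult_integrable f2)
    fix a b :: "'a fls" assume ab: "a \<in> fls_box i m" "b \<in> fls_box i m"
    have "(\<lambda>x. f a x * cnj (f b x)) = (\<lambda>x. of_real (1 / (r * r)) * (indicator (fls_ball (- m)) x * pair (b - a) x))"
      using pair_add_left[of b "- a"] by (auto simp: f_def indicator_def cnj_pair(2) complex_cnj_divide)
    hence "(LINT x|\<mu>. f a x * cnj (f b x)) = of_real (1 / (r * r)) * (if b - a \<in> fls_ball m then of_real (r * r) else 0)"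
      by (simp add: integral_pair_ball r(2))
    moreover have "b - a \<in> fls_ball m \<longleftrightarrow> a = b"
      using fls_box_eqI[OF ab] by (auto simp: mem_fls_ball mem_cyl)
    ultimately show "(LINT x|\<mu>. f a x * cnj (f b x)) = (if a = b then 1 else 0)"
      using r by auto
  qed
  have ge: "g x = (\<Sum>a\<in>fls_box i m. (g a / of_real r) * e a x)" for x
    by (subst g) (use r in \<open>simp add: e_def\<close>)
  have gf: "fourier g b = (\<Sum>a\<in>fls_box i m. (g a / of_real r) * f a b)" for b
  proof -
    have "fourier g b = (\<Sum>a\<in>fls_box i m. g a * fourier (\<lambda>x. indicator (cyl a m) x) b)"
      by (subst g, subst fourier_sum) (use L12_integrable[OF cyl_L12] in \<open>auto simp: fourier_cmult\<close>)
    also have "\<dots> = (\<Sum>a\<in>fls_box i m. (g a / of_real r) * f a b)"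
      using r(1) arg_cong[OF r(2), of complex_of_real]
      by (intro sum.cong refl) (simp add: fourier_cyl f_def power_int_minus pair_commute inverse_eq_divide)
    finally show ?thesis .
  qed
  show "fourier g \<in> L2 \<mu>"
    unfolding gf[abs_def] by (intro L2_sum L2_cmult f2)
  have "(L2_norm \<mu> (fourier g))\<^sup>2 = (L2_norm \<mu> g)\<^sup>2"
    unfolding gf[abs_def] by (subst (2) ge[abs_def])
      (simp only: orthonormal_sum_norm[OF e2 eo finite_fls_box] orthonormal_sum_norm[OF f2 fo finite_fls_box])
  thus "L2_norm \<mu> (fourier g) = L2_norm \<mu> g"
    by (simp add: L2_norm_nonneg power2_eq_iff_nonneg)
qed

text \<open>Approximation by step functions in L1 makes the transforms converge pointwise, and in L2
  it makes them Cauchy in norm. The pointwise limit is the integral \<open>fourier f\<close>, and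
  the Fatou bound shows that it is the limit in norm too.\<close>

theorem plancherel_L12:
  assumes f: "f \<in> L12 \<mu>"
  shows "fourier f \<in> L2 \<mu>" and "L2_norm \<mu> (fourier f) = L2_norm \<mu> f"
proof -
  interpret S: cylinder_span p s c \<mu> steps "\<lambda>_ _. True" by (rule cylinder_span_steps)
  have "\<forall>n. \<exists>g\<in>steps. L12_norm \<mu> (\<lambda>x. f x - g x) < inverse (real (Suc n))"
    using S.L12_approx[OF f] by simp
  then obtain g where g: "\<And>n. g n \<in> steps" "\<And>n. L12_norm \<mu> (\<lambda>x. f x - g n x) < inverse (real (Suc n))"
    by metis
  have g12: "g n \<in> L12 \<mu>" for n by (rule S.L12[OF g(1)])
  have diff: "(\<lambda>x. g m x - g n x) \<in> steps" for m n
    using S.add[OF g(1)[of m] S.cmult[OF g(1)[of n], of "-1"]] by simp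
  have fd: "fourier (\<lambda>x. g m x - g n x) = (\<lambda>b. fourier (g m) b - fourier (g n) b)" for m n
    by (rule ext, rule fourier_diff) (intro L12_integrable g12)+
  have lim: "(\<lambda>n. fourier (g n) b) \<longlonglongrightarrow> fourier f b" for b
  proof (rule LIM_zero_cancel, rule Lim_null_comparison[OF _ LIMSEQ_inverse_real_of_nat])
    show "\<forall>\<^sub>F n in sequentially. norm (fourier (g n) b - fourier f b) \<le> inverse (real (Suc n))"
    proof (rule always_eventually, rule allI)
      fix n
      have "norm (fourier (g n) b - fourier f b) = cmod (fourier (\<lambda>x. f x - g n x) b)"
        by (subst fourier_diff) (auto simp: norm_minus_commute L12_integrable[OF f] L12_integrable[OF g12])
      also have "\<dots> \<le> (LINT x|\<mu>. cmod (f x - g n x))"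
        by (rule norm_fourier_le) (intro Bochner_Integration.integrable_diff L12_integrable f g12)
      also have "\<dots> \<le> inverse (real (Suc n))"
        using L12_norm_ge(2)[of \<mu> "\<lambda>x. f x - g n x"] g(2)[of n] by linarith
      finally show "norm (fourier (g n) b - fourier f b) \<le> inverse (real (Suc n))" .
    qed
  qed
  have Fg2: "fourier (g n) \<in> L2 \<mu>" for n by (rule fourier_steps(1)[OF g(1)])
  have meas: "fourier f \<in> borel_measurable \<mu>"
    by (rule borel_measurable_LIMSEQ_metric[OF L2_measurable[OF Fg2]]) (rule lim)
  \<comment> \<open>The factor 2 counts two approximation errors, those of \<open>g n\<close> and of
    \<open>g k\<close>; each is at most \<open>inverse (real (Suc n))\<close> once
    \<open>n \<le> k\<close>, and then \<open>k\<close> tends to infinity.\<close>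
  have key: "(\<lambda>b. fourier (g n) b - fourier f b) \<in> L2 \<mu> \<and>
      L2_norm \<mu> (\<lambda>b. fourier (g n) b - fourier f b) \<le> 2 * inverse (real (Suc n))" for n
  proof -
    have ev: "\<forall>\<^sub>F k in sequentially. L2_norm \<mu> (\<lambda>b. fourier (g n) b - fourier (g k) b) \<le> 2 * inverse (real (Suc n))"
      unfolding eventually_sequentially
    proof (intro exI[of _ n] allI impI)
      fix k assume "n \<le> k"
      have "L2_norm \<mu> (\<lambda>b. fourier (g n) b - fourier (g k) b) = L2_norm \<mu> (\<lambda>x. g n x - g k x)"
        using fourier_steps(2)[OF diff[of n k]] by (simp add: fd)
      also have "\<dots> \<le> L2_norm \<mu> (\<lambda>x. g n x - f x) + L2_norm \<mu> (\<lambda>x. f x - g k x)"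
        by (intro L2_norm_triangle L12_L2 f g12)
      also have "L2_norm \<mu> (\<lambda>x. g n x - f x) \<le> inverse (real (Suc n))"
        using L12_norm_ge(1)[of \<mu> "\<lambda>x. f x - g n x"] g(2)[of n] L2_norm_minus_commute[of \<mu> f "g n"] by linarith
      also have "L2_norm \<mu> (\<lambda>x. f x - g k x) \<le> inverse (real (Suc k))"
        using L12_norm_ge(1)[of \<mu> "\<lambda>x. f x - g k x"] g(2)[of k] by linarith
      also have "inverse (real (Suc k)) \<le> inverse (real (Suc n))"
        using \<open>n \<le> k\<close> by (intro le_imp_inverse_le) auto
      finally show "L2_norm \<mu> (\<lambda>b. fourier (g n) b - fourier (g k) b) \<le> 2 * inverse (real (Suc n))" by simp
    qed
    have l: "AE b in \<mu>. (\<lambda>k. fourier (g n) b - fourier (g k) b) \<longlonglongrightarrow> fourier (g n) b - fourier f b"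
      by (intro AE_I2 tendsto_diff tendsto_const lim)
    have m: "(\<lambda>b. fourier (g n) b - fourier f b) \<in> borel_measurable \<mu>"
      using meas L2_measurable[OF Fg2] by (rule borel_measurable_diff[rotated])
    show ?thesis
      using L2_norm_le_of_AE_tendsto[OF L2_diff[OF Fg2 Fg2] m l ev] by simp
  qed
  from L2_diff[OF Fg2[of 0] key[of 0, THEN conjunct1]] show F2: "fourier f \<in> L2 \<mu>" by simp
  have "(\<lambda>n. L2_norm \<mu> (fourier (g n))) \<longlonglongrightarrow> L2_norm \<mu> (fourier f)"
  proof (rule L2_norm_tendsto[OF Fg2 F2], rule Lim_null_comparison)
    show "\<forall>\<^sub>F n in sequentially. norm (L2_norm \<mu> (\<lambda>b. fourier (g n) b - fourier f b)) \<le> 2 * inverse (real (Suc n))"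
      using key by (intro always_eventually allI) (simp add: L2_norm_nonneg)
    show "(\<lambda>n. 2 * inverse (real (Suc n))) \<longlonglongrightarrow> 0"
      using tendsto_mult[OF tendsto_const LIMSEQ_inverse_real_of_nat, of 2] by simp
  qed
  moreover have "(\<lambda>n. L2_norm \<mu> (g n)) \<longlonglongrightarrow> L2_norm \<mu> f"
  proof (rule L2_norm_tendsto[OF L12_L2[OF g12] L12_L2[OF f]], rule Lim_null_comparison[OF _ LIMSEQ_inverse_real_of_nat])
    have "norm (L2_norm \<mu> (\<lambda>x. g n x - f x)) \<le> inverse (real (Suc n))" for n
      using L12_norm_ge(1)[of \<mu> "\<lambda>x. f x - g n x"] g(2)[of n] L2_norm_minus_commute[of \<mu> f "g n"]
        L2_norm_nonneg[of \<mu> "\<lambda>x. g n x - f x"] by simp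
    thus "\<forall>\<^sub>F n in sequentially. norm (L2_norm \<mu> (\<lambda>x. g n x - f x)) \<le> inverse (real (Suc n))"
      by (simp add: always_eventually)
  qed
  ultimately show "L2_norm \<mu> (fourier f) = L2_norm \<mu> f"
    using LIMSEQ_unique by (simp add: fourier_steps(2)[OF g(1)])
qed

text \<open>The inverse transform of a cylinder indicator is explicit: a character cut off to
  \<open>fls_ball (- m)\<close>, times \<open>q powi (- m)\<close>. Hence the transform has dense
  range.\<close>

lemma fourier_steps_surj:
  assumes "h \<in> steps"
  shows "\<exists>g\<in>L12 \<mu>. fourier g = h"
proof -
  obtain i m where im: "i \<le> m" and h: "h = (\<lambda>x. \<Sum>a\<in>fls_box i m. h a * indicator (cyl a m) x)"
    by (rule stepsE[OF assms])
  define e where "e = (\<lambda>a x. indicator (fls_ball (- m)) x * pair a x)"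
  have e: "e a \<in> L12 \<mu>" for a
    unfolding e_def L12_def mem_Collect_eq
    by (intro conjI L2_indicator_bounded[where C = 1] emeasure_ball_finite) (auto simp: norm_pair)
  have fe: "of_real (q powi (- m)) * fourier (e a) b = indicator (cyl a m) b" for a b
  proof -
    have "(\<lambda>x. e a x * cnj (pair b x)) = (\<lambda>x. indicator (fls_ball (- m)) x * pair (a - b) x)"
      using pair_add_left[of a "- b"] by (auto simp: e_def cnj_pair(2))
    moreover have "a - b \<in> fls_ball m \<longleftrightarrow> b \<in> cyl a m" by (auto simp: mem_fls_ball mem_cyl)
    ultimately show ?thesis
      using q_pos by (simp add: fourier_def integral_pair_ball power_int_minus)
  qed
  define g where "g = (\<lambda>x. \<Sum>a\<in>fls_box i m. h a * (of_real (q powi (- m)) * e a x))"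
  have "fourier g b = h b" for b
  proof -
    have "fourier g b = (\<Sum>a\<in>fls_box i m. h a * (of_real (q powi (- m)) * fourier (e a) b))"
      unfolding g_def
      by (subst fourier_sum) (use L12_integrable[OF e] in \<open>auto simp: fourier_cmult\<close>)
    also have "\<dots> = (\<Sum>a\<in>fls_box i m. h a * indicator (cyl a m) b)" by (simp only: fe)
    also have "\<dots> = h b" by (rule fun_cong[OF h, symmetric])
    finally show ?thesis .
  qed
  moreover have "g \<in> L12 \<mu>" unfolding g_def by (intro L12_sum L12_cmult e)
  ultimately show ?thesis by blast
qed

end

section \<open>The Fourier transform on \<open>L\<^sub>2\<close>\<close>

context haar_field
begin

text \<open>The relation \<open>fourier_L2\<close> read in digit coordinates, where Plancherel
  supplies the square-integrability of the transforms of \<open>g n\<close>. It is a relation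
  because the functions matter only up to null sets.\<close>

definition fourier_rel :: "('a fls \<Rightarrow> complex) \<Rightarrow> ('a fls \<Rightarrow> complex) \<Rightarrow> bool" where
  "fourier_rel f F \<longleftrightarrow> f \<in> L2 \<mu> \<and> F \<in> L2 \<mu> \<and>
     (\<exists>g :: nat \<Rightarrow> 'a fls \<Rightarrow> complex. (\<forall>n. g n \<in> L12 \<mu>) \<and>
        (\<lambda>n. L2_norm \<mu> (\<lambda>x. g n x - f x)) \<longlonglongrightarrow> 0 \<and>
        (\<lambda>n. L2_norm \<mu> (\<lambda>b. fourier (g n) b - F b)) \<longlonglongrightarrow> 0)"

lemma fourier_relE:
  assumes "fourier_rel f F"
  obtains g :: "nat \<Rightarrow> 'a fls \<Rightarrow> complex" where "\<And>n. g n \<in> L12 \<mu>"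
    "(\<lambda>n. L2_norm \<mu> (\<lambda>x. g n x - f x)) \<longlonglongrightarrow> 0"
    "(\<lambda>n. L2_norm \<mu> (\<lambda>b. fourier (g n) b - F b)) \<longlonglongrightarrow> 0"
  using assms unfolding fourier_rel_def by blast

lemma fourier_relI:
  fixes g :: "nat \<Rightarrow> 'a fls \<Rightarrow> complex"
  assumes "f \<in> L2 \<mu>" "F \<in> L2 \<mu>" "\<And>n. g n \<in> L12 \<mu>"
    "(\<lambda>n. L2_norm \<mu> (\<lambda>x. g n x - f x)) \<longlonglongrightarrow> 0"
    "(\<lambda>n. L2_norm \<mu> (\<lambda>b. fourier (g n) b - F b)) \<longlonglongrightarrow> 0"
  shows "fourier_rel f F"
  unfolding fourier_rel_def using assms by blast

lemma fourier_rel_L2: "fourier_rel f F \<Longrightarrow> f \<in> L2 \<mu>" "fourier_rel f F \<Longrightarrow> F \<in> L2 \<mu>"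
  by (auto simp: fourier_rel_def)

lemma fourier_rel_norm:
  assumes "fourier_rel f F" shows "L2_norm \<mu> f = L2_norm \<mu> F"
proof -
  obtain g where g: "\<And>n. g n \<in> L12 \<mu>" "(\<lambda>n. L2_norm \<mu> (\<lambda>x. g n x - f x)) \<longlonglongrightarrow> 0"
    "(\<lambda>n. L2_norm \<mu> (\<lambda>b. fourier (g n) b - F b)) \<longlonglongrightarrow> 0"
    using assms by (rule fourier_relE) (rule that)
  have "(\<lambda>n. L2_norm \<mu> (g n)) \<longlonglongrightarrow> L2_norm \<mu> f"
    by (rule L2_norm_tendsto[OF L12_L2[OF g(1)] fourier_rel_L2(1)[OF assms] g(2)])
  moreover have "(\<lambda>n. L2_norm \<mu> (fourier (g n))) \<longlonglongrightarrow> L2_norm \<mu> F"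
    by (rule L2_norm_tendsto[OF plancherel_L12(1)[OF g(1)] fourier_rel_L2(2)[OF assms] g(3)])
  ultimately show ?thesis
    using LIMSEQ_unique by (simp add: plancherel_L12(2)[OF g(1)])
qed

lemma L2_norm_tendsto_0_le:
  assumes "(\<lambda>n. u n) \<longlonglongrightarrow> 0" "\<And>n. L2_norm \<mu> (f n) \<le> u n"
  shows "(\<lambda>n. L2_norm \<mu> (f n)) \<longlonglongrightarrow> 0"
  by (rule Lim_null_comparison[OF _ assms(1)]) (simp add: assms(2) L2_norm_nonneg)

lemma fourier_rel_add:
  assumes f: "fourier_rel f F" and g: "fourier_rel g G"
  shows "fourier_rel (\<lambda>x. f x + g x) (\<lambda>b. F b + G b)"
proof -
  obtain u where u: "\<And>n. u n \<in> L12 \<mu>" "(\<lambda>n. L2_norm \<mu> (\<lambda>x. u n x - f x)) \<longlonglongrightarrow> 0"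
    "(\<lambda>n. L2_norm \<mu> (\<lambda>b. fourier (u n) b - F b)) \<longlonglongrightarrow> 0"
    using f by (rule fourier_relE) (rule that)
  obtain v where v: "\<And>n. v n \<in> L12 \<mu>" "(\<lambda>n. L2_norm \<mu> (\<lambda>x. v n x - g x)) \<longlonglongrightarrow> 0"
    "(\<lambda>n. L2_norm \<mu> (\<lambda>b. fourier (v n) b - G b)) \<longlonglongrightarrow> 0"
    using g by (rule fourier_relE) (rule that)
  show ?thesis
  proof (rule fourier_relI[where g = "\<lambda>n x. u n x + v n x"])
    show "(\<lambda>n. L2_norm \<mu> (\<lambda>x. u n x + v n x - (f x + g x))) \<longlonglongrightarrow> 0"
    proof (rule L2_norm_tendsto_0_le[OF tendsto_add_zero[OF u(2) v(2)]])
      fix n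
      show "L2_norm \<mu> (\<lambda>x. u n x + v n x - (f x + g x)) \<le>
          L2_norm \<mu> (\<lambda>x. u n x - f x) + L2_norm \<mu> (\<lambda>x. v n x - g x)"
        using L2_norm_add_le[OF L2_diff[OF L12_L2[OF u(1)] fourier_rel_L2(1)[OF f]]
            L2_diff[OF L12_L2[OF v(1)] fourier_rel_L2(1)[OF g]], of n n]
        by (simp add: algebra_simps)
    qed
    show "(\<lambda>n. L2_norm \<mu> (\<lambda>b. fourier (\<lambda>x. u n x + v n x) b - (F b + G b))) \<longlonglongrightarrow> 0"
    proof (rule L2_norm_tendsto_0_le[OF tendsto_add_zero[OF u(3) v(3)]])
      fix n
      show "L2_norm \<mu> (\<lambda>b. fourier (\<lambda>x. u n x + v n x) b - (F b + G b)) \<le>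
          L2_norm \<mu> (\<lambda>b. fourier (u n) b - F b) + L2_norm \<mu> (\<lambda>b. fourier (v n) b - G b)"
        using L2_norm_add_le[OF L2_diff[OF plancherel_L12(1)[OF u(1)] fourier_rel_L2(2)[OF f]]
            L2_diff[OF plancherel_L12(1)[OF v(1)] fourier_rel_L2(2)[OF g]], of n n]
        by (simp add: algebra_simps fourier_add[OF L12_integrable[OF u(1)] L12_integrable[OF v(1)]])
    qed
  qed (intro L2_add L12_add fourier_rel_L2[OF f] fourier_rel_L2[OF g] u(1) v(1))+
qed

lemma fourier_rel_cmult:
  assumes f: "fourier_rel f F"
  shows "fourier_rel (\<lambda>x. a * f x) (\<lambda>b. a * F b)"
proof -
  obtain u where u: "\<And>n. u n \<in> L12 \<mu>" "(\<lambda>n. L2_norm \<mu> (\<lambda>x. u n x - f x)) \<longlonglongrightarrow> 0"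
    "(\<lambda>n. L2_norm \<mu> (\<lambda>b. fourier (u n) b - F b)) \<longlonglongrightarrow> 0"
    using f by (rule fourier_relE) (rule that)
  show ?thesis
  proof (rule fourier_relI[where g = "\<lambda>n x. a * u n x"])
    show "(\<lambda>n. L2_norm \<mu> (\<lambda>x. a * u n x - a * f x)) \<longlonglongrightarrow> 0"
      using tendsto_mult[OF tendsto_const u(2), of "cmod a"]
      by (simp add: right_diff_distrib[symmetric] L2_norm_cmult)
    show "(\<lambda>n. L2_norm \<mu> (\<lambda>b. fourier (\<lambda>x. a * u n x) b - a * F b)) \<longlonglongrightarrow> 0"
      using tendsto_mult[OF tendsto_const u(3), of "cmod a"]
      by (simp add: fourier_cmult right_diff_distrib[symmetric] L2_norm_cmult)
  qed (intro L2_cmult L12_cmult fourier_rel_L2[OF f] u(1))+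
qed

lemma fourier_rel_zero: "fourier_rel (\<lambda>x. 0) (\<lambda>b. 0)"
  by (rule fourier_relI[where g = "\<lambda>_ _. 0"]) (auto simp: L2_zero L12_zero L2_norm_def fourier_def)

lemma fourier_rel_sum:
  "(\<And>i. i \<in> I \<Longrightarrow> fourier_rel (f i) (F i)) \<Longrightarrow>
    fourier_rel (\<lambda>x. \<Sum>i\<in>I. a i * f i x) (\<lambda>b. \<Sum>i\<in>I. a i * F i b)"
  by (induction I rule: infinite_finite_induct)
     (simp_all add: fourier_rel_zero fourier_rel_add fourier_rel_cmult)

lemma fourier_rel_diff:
  assumes "fourier_rel f F" "fourier_rel g G"
  shows "fourier_rel (\<lambda>x. f x - g x) (\<lambda>b. F b - G b)"
  using fourier_rel_add[OF assms(1) fourier_rel_cmult[OF assms(2), of "-1"]] by simp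

lemma fourier_rel_inner:
  assumes f: "fourier_rel f F" and g: "fourier_rel g G"
  shows "(LINT x|\<mu>. f x * cnj (g x)) = (LINT b|\<mu>. F b * cnj (G b))"
proof -
  have "L2_norm \<mu> (\<lambda>x. f x + g x) = L2_norm \<mu> (\<lambda>b. F b + G b)"
    by (rule fourier_rel_norm[OF fourier_rel_add[OF f g]])
  moreover have "L2_norm \<mu> (\<lambda>x. f x + \<i> * g x) = L2_norm \<mu> (\<lambda>b. F b + \<i> * G b)"
    by (rule fourier_rel_norm[OF fourier_rel_add[OF f fourier_rel_cmult[OF g]]])
  ultimately show ?thesis
    by (simp add: L2_inner_polarization[OF fourier_rel_L2(1)[OF f] fourier_rel_L2(1)[OF g]]
        L2_inner_polarization[OF fourier_rel_L2(2)[OF f] fourier_rel_L2(2)[OF g]]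
        fourier_rel_norm[OF f] fourier_rel_norm[OF g])
qed

lemma fourier_rel_ex:
  assumes f: "f \<in> L2 \<mu>" shows "\<exists>F. fourier_rel f F"
proof -
  define g where "g = (\<lambda>n x. indicator (fls_ball (- int n)) x * f x)"
  have g: "g n \<in> L12 \<mu>" for n unfolding g_def by (rule L2_truncate(1)[OF f])
  have lim: "(\<lambda>n. L2_norm \<mu> (\<lambda>x. g n x - f x)) \<longlonglongrightarrow> 0" unfolding g_def by (rule L2_truncate(2)[OF f])
  have "\<exists>F\<in>L2 \<mu>. (\<lambda>n. L2_norm \<mu> (\<lambda>x. fourier (g n) x - F x)) \<longlonglongrightarrow> 0"
  proof (rule L2_complete_of_tendsto[OF plancherel_L12(1)[OF g] L12_L2[OF g] f lim])
    fix m n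
    have "(\<lambda>x. fourier (g m) x - fourier (g n) x) = fourier (\<lambda>x. g m x - g n x)"
      by (rule ext) (simp add: fourier_diff L12_integrable[OF g])
    thus "L2_norm \<mu> (\<lambda>x. fourier (g m) x - fourier (g n) x) \<le> L2_norm \<mu> (\<lambda>x. g m x - g n x)"
      by (simp add: plancherel_L12(2)[OF L12_diff[OF g g]])
  qed
  with fourier_relI[OF f _ g lim] show ?thesis by blast
qed

text \<open>Step functions are dense and each of them is a transform, so \<open>F\<close> is a limit
  of transforms, whose preimages are Cauchy by Plancherel.\<close>

lemma fourier_rel_ex_inverse:
  assumes F: "F \<in> L2 \<mu>" shows "\<exists>f. fourier_rel f F"
proof -
  interpret S: cylinder_span p s c \<mu> steps "\<lambda>_ _. True" by (rule cylinder_span_steps)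
  have "\<exists>g\<in>L12 \<mu>. L2_norm \<mu> (\<lambda>b. F b - fourier g b) < inverse (real (Suc n))" for n
  proof -
    obtain h where h: "h \<in> steps" "L2_norm \<mu> (\<lambda>b. F b - h b) < inverse (real (Suc n))"
      using S.L2_approx[OF F, of "inverse (real (Suc n))"] by auto
    obtain g where "g \<in> L12 \<mu>" "fourier g = h" using fourier_steps_surj[OF h(1)] by blast
    with h(2) show ?thesis by blast
  qed
  then obtain g where g: "\<And>n. g n \<in> L12 \<mu>" "\<And>n. L2_norm \<mu> (\<lambda>b. F b - fourier (g n) b) < inverse (real (Suc n))"
    by metis
  have lim: "(\<lambda>n. L2_norm \<mu> (\<lambda>b. fourier (g n) b - F b)) \<longlonglongrightarrow> 0"
    by (rule L2_norm_tendsto_0_le[OF LIMSEQ_inverse_real_of_nat])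
       (use g(2) L2_norm_minus_commute[of \<mu> F] in \<open>simp add: less_imp_le\<close>)
  have "\<exists>f\<in>L2 \<mu>. (\<lambda>n. L2_norm \<mu> (\<lambda>x. g n x - f x)) \<longlonglongrightarrow> 0"
  proof (rule L2_complete_of_tendsto[OF L12_L2[OF g(1)] plancherel_L12(1)[OF g(1)] F lim])
    fix m n
    have "(\<lambda>x. fourier (g m) x - fourier (g n) x) = fourier (\<lambda>x. g m x - g n x)"
      by (rule ext) (simp add: fourier_diff L12_integrable[OF g(1)])
    thus "L2_norm \<mu> (\<lambda>x. g m x - g n x) \<le> L2_norm \<mu> (\<lambda>x. fourier (g m) x - fourier (g n) x)"
      by (simp add: plancherel_L12(2)[OF L12_diff[OF g(1) g(1)]])
  qed
  with fourier_relI[OF _ F g(1) _ lim] show ?thesis by blast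
qed

lemma L12_affine:
  assumes "f \<in> L12 \<mu>" shows "(\<lambda>x. f (fls_affine n h x)) \<in> L12 \<mu>"
  using L2_affine(1)[OF L12_L2[OF assms]] integral_affine(2)[OF L2_mu_measurable[OF L12_L2[OF assms]]] assms
  by (simp add: L12_def)

lemma fourier_affine:
  assumes "f \<in> L12 \<mu>"
  shows "fourier (\<lambda>x. f (fls_affine n h x)) b =
    of_real (q powi (- n)) * cnj (pair (fls_shift (- n) b) h) * fourier f (fls_shift (- n) b)"
proof -
  have [measurable]: "f \<in> borel_measurable borel" by (rule L2_mu_measurable[OF L12_L2[OF assms]])
  let ?b = "fls_shift (- n) b"
  have p: "cnj (pair b x) = cnj (pair ?b h) * cnj (pair ?b (fls_affine n h x))" for x
  proof -
    have "pair ?b (h + fls_affine n h x) = pair b x"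
      by (simp add: fls_affine_def pair_shift)
    thus ?thesis by (metis pair_add complex_cnj_mult)
  qed
  have "fourier (\<lambda>x. f (fls_affine n h x)) b =
      (LINT x|\<mu>. (\<lambda>y. cnj (pair ?b h) * (f y * cnj (pair ?b y))) (fls_affine n h x))"
    unfolding fourier_def by (intro Bochner_Integration.integral_cong refl) (simp add: p mult_ac)
  also have "\<dots> = q powi (- n) *\<^sub>R (LINT y|\<mu>. cnj (pair ?b h) * (f y * cnj (pair ?b y)))"
    by (rule integral_affine(1)) measurable
  finally show ?thesis by (simp add: fourier_def scaleR_conv_of_real)
qed

text \<open>Dilation becomes the opposite dilation and translation becomes modulation. The formula
  for integrable functions extends by continuity, since the factor is bounded and the substitution
  only rescales norms.\<close>

lemma fourier_rel_affine:
  assumes f: "fourier_rel f F"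
  shows "fourier_rel (\<lambda>x. f (fls_affine n h x))
    (\<lambda>b. of_real (q powi (- n)) * cnj (pair (fls_shift (- n) b) h) * F (fls_shift (- n) b))"
proof -
  let ?k = "\<lambda>b. of_real (q powi (- n)) * cnj (pair (fls_shift (- n) b) h)"
  have "(\<lambda>b. of_real (q powi (- n)) * cnj (pair h (fls_shift (- n) b))) \<in> borel_measurable borel"
    by measurable
  hence k: "?k \<in> borel_measurable \<mu>" by (simp add: pair_commute[of _ h])
  have bd: "cmod (?k b) \<le> q powi (- n)" for b
    using q_pos by (simp add: norm_mult norm_pair norm_power_int)
  have shift: "(\<lambda>b. G (fls_shift (- n) b)) \<in> L2 \<mu>"
    "L2_norm \<mu> (\<lambda>b. G (fls_shift (- n) b)) = sqrt (q powi n) * L2_norm \<mu> G" if "G \<in> L2 \<mu>" for G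
    using L2_affine[OF that, of "- n" 0] by (simp_all add: fls_affine_simps)
  obtain g where g: "\<And>n. g n \<in> L12 \<mu>" "(\<lambda>n. L2_norm \<mu> (\<lambda>x. g n x - f x)) \<longlonglongrightarrow> 0"
    "(\<lambda>n. L2_norm \<mu> (\<lambda>b. fourier (g n) b - F b)) \<longlonglongrightarrow> 0"
    using f by (rule fourier_relE) (rule that)
  note f2 = fourier_rel_L2(1)[OF f] and F2 = fourier_rel_L2(2)[OF f]
  show ?thesis
  proof (rule fourier_relI[where g = "\<lambda>i x. g i (fls_affine n h x)"])
    show "(\<lambda>x. f (fls_affine n h x)) \<in> L2 \<mu>" by (rule L2_affine(1)[OF f2])
    show "(\<lambda>b. ?k b * F (fls_shift (- n) b)) \<in> L2 \<mu>"
      by (rule L2_bounded_mult(1)[OF shift(1)[OF F2] k bd])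
    show "(\<lambda>x. g i (fls_affine n h x)) \<in> L12 \<mu>" for i by (rule L12_affine[OF g(1)])
    show "(\<lambda>i. L2_norm \<mu> (\<lambda>x. g i (fls_affine n h x) - f (fls_affine n h x))) \<longlonglongrightarrow> 0"
      using tendsto_mult[OF tendsto_const g(2), of "sqrt (q powi (- n))"]
      by (simp add: L2_affine(2)[OF L2_diff[OF L12_L2[OF g(1)] f2]])
    have "(\<lambda>i. q powi (- n) * (sqrt (q powi n) * L2_norm \<mu> (\<lambda>b. fourier (g i) b - F b))) \<longlonglongrightarrow> 0"
      using tendsto_mult[OF tendsto_const g(3), of "q powi (- n) * sqrt (q powi n)"] by (simp add: mult.assoc)
    thus "(\<lambda>i. L2_norm \<mu> (\<lambda>b. fourier (\<lambda>x. g i (fls_affine n h x)) b - ?k b * F (fls_shift (- n) b))) \<longlonglongrightarrow> 0"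
    proof (rule L2_norm_tendsto_0_le)
      fix i
      have d: "(\<lambda>b. fourier (g i) b - F b) \<in> L2 \<mu>" by (intro L2_diff plancherel_L12 g F2)
      have "L2_norm \<mu> (\<lambda>b. ?k b * (fourier (g i) (fls_shift (- n) b) - F (fls_shift (- n) b)))
          \<le> q powi (- n) * L2_norm \<mu> (\<lambda>b. fourier (g i) (fls_shift (- n) b) - F (fls_shift (- n) b))"
        by (rule L2_bounded_mult(2)[OF shift(1)[OF d] k bd])
      thus "L2_norm \<mu> (\<lambda>b. fourier (\<lambda>x. g i (fls_affine n h x)) b - ?k b * F (fls_shift (- n) b))
          \<le> q powi (- n) * (sqrt (q powi n) * L2_norm \<mu> (\<lambda>b. fourier (g i) b - F b))"
        by (simp add: fourier_affine[OF g(1)] right_diff_distrib shift(2)[OF d])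
    qed
  qed
qed

lemma fourier_rel_biorthogonal:
  assumes f: "\<And>i. i \<in> I \<Longrightarrow> fourier_rel (f i) (F i)" and g: "\<And>i. i \<in> I \<Longrightarrow> fourier_rel (g i) (G i)"
    and "biorthogonal \<mu> F G I"
  shows "biorthogonal \<mu> f g I"
  unfolding biorthogonal_def
proof (intro ballI conjI)
  fix i j assume ij: "i \<in> I" "j \<in> I"
  show "integrable \<mu> (\<lambda>x. f i x * cnj (g j x))"
    by (rule L2_mult_integrable[OF fourier_rel_L2(1)[OF f[OF ij(1)]] fourier_rel_L2(1)[OF g[OF ij(2)]]])
  show "(LINT x|\<mu>. f i x * cnj (g j x)) = (if i = j then 1 else 0)"
    using fourier_rel_inner[OF f[OF ij(1)] g[OF ij(2)]] assms(3) ij by (simp add: biorthogonal_def)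
qed

text \<open>The transform is isometric and exists in both directions: sums found on the Fourier side
  are pulled back, and functions to be approximated are pushed forward.\<close>

lemma fourier_rel_riesz_basis:
  assumes f: "\<And>i. i \<in> I \<Longrightarrow> fourier_rel (f i) (F i)" and F: "riesz_basis \<mu> F I"
  shows "riesz_basis \<mu> f I"
proof -
  obtain A B where AB: "riesz_system \<mu> A B F I" and span: "L2_closed_span \<mu> F I = L2 \<mu>"
    using F by (auto simp: riesz_basis_def)
  have "riesz_system \<mu> A B f I"
    unfolding riesz_system_def
  proof (intro conjI ballI allI impI)
    show "A > 0" "B > 0" using AB by (auto simp: riesz_system_def)
    fix j assume "j \<in> I" thus "f j \<in> L2 \<mu>" using fourier_rel_L2(1)[OF f] by simp
  next
    fix a :: "'b \<Rightarrow> complex" assume "(\<lambda>j. (cmod (a j))\<^sup>2) summable_on I"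
    then obtain S where S: "S \<in> L2 \<mu>"
        "((\<lambda>J. L2_norm \<mu> (\<lambda>x. (\<Sum>j\<in>J. a j * F j x) - S x)) \<longlongrightarrow> 0) (finite_subsets_at_top I)"
        "A * (\<Sum>\<^sub>\<infinity>j\<in>I. (cmod (a j))\<^sup>2) \<le> (L2_norm \<mu> S)\<^sup>2"
        "(L2_norm \<mu> S)\<^sup>2 \<le> B * (\<Sum>\<^sub>\<infinity>j\<in>I. (cmod (a j))\<^sup>2)"
      using AB unfolding riesz_system_def L2_has_sum_def by blast
    obtain T where T: "fourier_rel T S" using fourier_rel_ex_inverse[OF S(1)] by blast
    have "((\<lambda>J. L2_norm \<mu> (\<lambda>x. (\<Sum>j\<in>J. a j * f j x) - T x)) \<longlongrightarrow> 0) (finite_subsets_at_top I)"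
    proof (rule Lim_transform_eventually[OF S(2)], rule eventually_finite_subsets_at_top_weakI)
      fix J assume "J \<subseteq> I"
      hence "fourier_rel (\<lambda>x. (\<Sum>j\<in>J. a j * f j x) - T x) (\<lambda>x. (\<Sum>j\<in>J. a j * F j x) - S x)"
        using f by (intro fourier_rel_diff fourier_rel_sum T) auto
      thus "L2_norm \<mu> (\<lambda>x. (\<Sum>j\<in>J. a j * F j x) - S x) = L2_norm \<mu> (\<lambda>x. (\<Sum>j\<in>J. a j * f j x) - T x)"
        using fourier_rel_norm by simp
    qed
    thus "\<exists>S. L2_has_sum \<mu> (\<lambda>j x. a j * f j x) I S \<and>
             A * (\<Sum>\<^sub>\<infinity>j\<in>I. (cmod (a j))\<^sup>2) \<le> (L2_norm \<mu> S)\<^sup>2 \<and>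
             (L2_norm \<mu> S)\<^sup>2 \<le> B * (\<Sum>\<^sub>\<infinity>j\<in>I. (cmod (a j))\<^sup>2)"
      unfolding L2_has_sum_def using S(3,4) fourier_rel_L2(1)[OF T] fourier_rel_norm[OF T]
      by (intro exI[of _ T]) simp
  qed
  moreover have "L2_closed_span \<mu> f I = L2 \<mu>"
  proof (intro equalityI subsetI)
    fix g assume g: "g \<in> L2 \<mu>"
    obtain G where G: "fourier_rel g G" using fourier_rel_ex[OF g] by blast
    show "g \<in> L2_closed_span \<mu> f I"
      unfolding L2_closed_span_def
    proof (intro CollectI conjI g allI impI)
      fix \<epsilon> :: real assume "\<epsilon> > 0"
      have "G \<in> L2_closed_span \<mu> F I" using span fourier_rel_L2(2)[OF G] by simp
      then obtain J a where J: "finite J" "J \<subseteq> I" "L2_norm \<mu> (\<lambda>x. G x - (\<Sum>j\<in>J. a j * F j x)) < \<epsilon>"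
        using \<open>\<epsilon> > 0\<close> unfolding L2_closed_span_def by blast
      have "fourier_rel (\<lambda>x. g x - (\<Sum>j\<in>J. a j * f j x)) (\<lambda>x. G x - (\<Sum>j\<in>J. a j * F j x))"
        using f J by (intro fourier_rel_diff fourier_rel_sum G) auto
      hence "L2_norm \<mu> (\<lambda>x. g x - (\<Sum>j\<in>J. a j * f j x)) < \<epsilon>"
        using fourier_rel_norm J(3) by simp
      thus "\<exists>J a. finite J \<and> J \<subseteq> I \<and> L2_norm \<mu> (\<lambda>x. g x - (\<Sum>j\<in>J. a j * f j x)) < \<epsilon>"
        using J(1,2) by blast
    qed
  qed (auto simp: L2_closed_span_def)
  ultimately show ?thesis unfolding riesz_basis_def by blast
qed

end

section \<open>Trees as recursions on digits\<close>

lemma dipath_Cons: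
  "vs \<noteq> [] \<Longrightarrow> dipath V E (u # vs) \<longleftrightarrow> u \<in> V \<and> (u, hd vs) \<in> E \<and> dipath V E vs"
  by (cases vs) (auto simp: dipath_def)

lemma dipath_append:
  assumes "xs \<noteq> []" "ys \<noteq> []"
  shows "dipath V E (xs @ ys) \<longleftrightarrow> dipath V E xs \<and> dipath V E ys \<and> (last xs, hd ys) \<in> E"
  using assms by (auto simp: dipath_def successively_append_iff)

lemma dipath_singleton [simp]: "dipath V E [v] \<longleftrightarrow> v \<in> V"
  by (simp add: dipath_def)

lemma dipath_nth_edge: "dipath V E vs \<Longrightarrow> Suc i < length vs \<Longrightarrow> (vs ! i, vs ! Suc i) \<in> E"
  by (simp add: dipath_def successively_conv_nth)

lemma dipath_level:
  assumes "dipath V E vs" "j < length vs" shows "(hd vs, vs ! j) \<in> E ^^ j"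
  using assms(2)
proof (induction j)
  case 0 thus ?case using assms by (simp add: hd_conv_nth dipath_def)
next
  case (Suc j)
  thus ?case using dipath_nth_edge[OF assms(1), of j] by auto
qed

locale N_valid_tree =
  fixes N :: nat and V :: "'v set" and E :: "('v \<times> 'v) set" and r :: 'v and lab :: "'v \<Rightarrow> 'k::{field,finite}"
  assumes valid: "valid_tree N V E r lab" and N: "N \<ge> 1"
begin

lemma root: "r \<in> V" "lab r = 0"
  and edges: "(u, v) \<in> E \<Longrightarrow> u \<in> V \<and> v \<in> V"
  and root_path_ex1: "v \<in> V \<Longrightarrow> \<exists>!vs. dipath V E vs \<and> hd vs = r \<and> last vs = v"
  and level: "j < N \<Longrightarrow> \<exists>v. {w \<in> V. (r, w) \<in> E ^^ j} = {v} \<and> lab v = 0"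
  and word_ex1: "length \<alpha>s = N \<Longrightarrow> \<exists>!vs. dipath V E vs \<and> map lab vs = \<alpha>s"
proof -
  note v = valid[unfolded valid_tree_def rooted_tree_def]
  show "r \<in> V" "lab r = 0" using v by simp_all
  show "u \<in> V \<and> v \<in> V" if "(u, v) \<in> E" using v that by blast
  show "\<exists>!vs. dipath V E vs \<and> hd vs = r \<and> last vs = v" if "v \<in> V" using v that by (elim conjE) (rule bspec)
  show "\<exists>v. {w \<in> V. (r, w) \<in> E ^^ j} = {v} \<and> lab v = 0" if "j < N" using v that by (elim conjE) simp
  show "\<exists>!vs. dipath V E vs \<and> map lab vs = \<alpha>s" if "length \<alpha>s = N"
    using v that by (elim conjE) (drule spec[of _ \<alpha>s], erule mp)
qed

lemma root_path_unique:
  assumes "dipath V E vs" "hd vs = r" "dipath V E ws" "hd ws = r" "last vs = last ws"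
  shows "vs = ws"
proof -
  have "last ws \<in> V" using assms(3) by (auto simp: dipath_def)
  from root_path_ex1[OF this] assms show ?thesis by metis
qed

lemma root_pathE:
  assumes "v \<in> V"
  obtains vs where "dipath V E vs" "hd vs = r" "last vs = v"
  using root_path_ex1[OF assms] by blast

lemma root_path_snoc:
  assumes "(u, v) \<in> E"
  obtains vs where "dipath V E (vs @ [v])" "hd (vs @ [v]) = r" "vs \<noteq> []" "last vs = u"
proof -
  obtain vs where vs: "dipath V E vs" "hd vs = r" "last vs = u"
    using root_pathE edges[OF assms] by metis
  moreover have "vs \<noteq> []" using vs by (auto simp: dipath_def)
  ultimately show thesis
    using that[of vs] assms edges[OF assms] by (simp add: dipath_append)
qed

text \<open>Two parents would give two different paths from the root to \<open>v\<close>.\<close>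

lemma parent_unique:
  assumes "(u, v) \<in> E" "(u', v) \<in> E" shows "u = u'"
proof -
  obtain vs where vs: "dipath V E (vs @ [v])" "hd (vs @ [v]) = r" "vs \<noteq> []" "last vs = u"
    using root_path_snoc[OF assms(1)] .
  obtain ws where ws: "dipath V E (ws @ [v])" "hd (ws @ [v]) = r" "ws \<noteq> []" "last ws = u'"
    using root_path_snoc[OF assms(2)] .
  have "vs @ [v] = ws @ [v]" by (rule root_path_unique) (use vs ws in auto)
  with vs ws show ?thesis by simp
qed

lemma no_edge_to_root: "(u, r) \<notin> E"
proof
  assume "(u, r) \<in> E"
  then obtain vs where vs: "dipath V E (vs @ [r])" "hd (vs @ [r]) = r" "vs \<noteq> []"
    using root_path_snoc by metis
  have "vs @ [r] = [r]" by (rule root_path_unique) (use vs root in auto)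
  with vs show False by simp
qed

lemma parent_ex:
  assumes "v \<in> V" "v \<noteq> r" shows "\<exists>u. (u, v) \<in> E"
proof -
  obtain vs where vs: "dipath V E vs" "hd vs = r" "last vs = v"
    using root_pathE[OF assms(1)] .
  have ne: "vs \<noteq> []" using vs by (auto simp: dipath_def)
  hence eq: "vs = butlast vs @ [v]" using vs by (metis append_butlast_last_id)
  have "butlast vs \<noteq> []"
  proof
    assume "butlast vs = []"
    hence "vs = [v]" using eq by simp
    with vs(2) assms(2) show False by simp
  qed
  with vs(1) eq have "(last (butlast vs), v) \<in> E" by (metis dipath_append list.sel(1) not_Cons_self2)
  thus ?thesis by blast
qed

text \<open>Such a path visits the levels 0 to \<open>N - 1\<close>, each of which is a single node
  labelled 0.\<close>

lemma root_path_labels: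
  assumes "dipath V E vs" "hd vs = r" "length vs = N"
  shows "map lab vs = replicate N 0"
proof (rule nth_equalityI)
  fix j assume "j < length (map lab vs)"
  hence j: "j < N" "j < length vs" using assms by auto
  obtain v where v: "{w \<in> V. (r, w) \<in> E ^^ j} = {v}" "lab v = 0" using level[OF j(1)] by blast
  have "vs ! j \<in> V" using assms(1) j by (auto simp: dipath_def)
  hence "vs ! j \<in> {w \<in> V. (r, w) \<in> E ^^ j}" using dipath_level[OF assms(1) j(2)] assms(2) by simp
  with v have "vs ! j = v" by blast
  thus "map lab vs ! j = replicate N 0 ! j" using v(2) j by simp
qed (use assms in simp)

lemma root_path_exists: "\<exists>vs. dipath V E vs \<and> hd vs = r \<and> length vs = N"
proof -
  obtain v where "(r, v) \<in> E ^^ (N - 1)" using level[of "N - 1"] N by auto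
  then obtain f where f: "f 0 = r" "\<forall>i<N - 1. (f i, f (Suc i)) \<in> E"
    unfolding relpow_fun_conv by blast
  have "f i \<in> V" if "i < N" for i
  proof (cases i)
    case (Suc k)
    hence "(f k, f (Suc k)) \<in> E" using f that by simp
    thus ?thesis using edges Suc by blast
  qed (use f root in simp)
  hence "dipath V E (map f [0..<N])"
    using f N by (auto simp: dipath_def successively_conv_nth)
  moreover have "hd (map f [0..<N]) = r" using f N by (simp add: hd_map)
  ultimately show ?thesis by (intro exI[of _ "map f [0..<N]"]) simp
qed

definition word_path :: "'k list \<Rightarrow> 'v list" where
  "word_path \<alpha>s = (THE vs. dipath V E vs \<and> map lab vs = \<alpha>s)"

lemma word_path:
  assumes "length \<alpha>s = N"
  shows "dipath V E (word_path \<alpha>s)" "map lab (word_path \<alpha>s) = \<alpha>s"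
    and "dipath V E vs \<Longrightarrow> map lab vs = \<alpha>s \<Longrightarrow> vs = word_path \<alpha>s"
proof -
  note ex1 = word_ex1[OF assms]
  show "dipath V E (word_path \<alpha>s)" "map lab (word_path \<alpha>s) = \<alpha>s"
    using theI'[OF ex1] unfolding word_path_def by auto
  show "dipath V E vs \<Longrightarrow> map lab vs = \<alpha>s \<Longrightarrow> vs = word_path \<alpha>s"
    using the1_equality[OF ex1] unfolding word_path_def by simp
qed

lemma word_path_zero: "hd (word_path (replicate N 0)) = r"
proof -
  obtain vs where vs: "dipath V E vs" "hd vs = r" "length vs = N" using root_path_exists by blast
  hence "vs = word_path (replicate N 0)" by (intro word_path(3) root_path_labels) auto
  with vs show ?thesis by simp
qed

text \<open>The default treats the root as if it had a parent labelled 0. This accounts for the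
  annihilator that \<open>tree_set\<close> contains besides the cosets coming from paths.\<close>

definition pred_label :: "'k list \<Rightarrow> 'k" where
  "pred_label \<alpha>s = (if hd (word_path \<alpha>s) = r then 0 else lab (THE u. (u, hd (word_path \<alpha>s)) \<in> E))"

lemma pred_label_zero: "pred_label (replicate N 0) = 0"
  by (simp add: pred_label_def word_path_zero)

lemma pred_label_path:
  assumes "dipath V E (u # vs)" "length vs = N"
  shows "lab u = pred_label (map lab vs)"
proof -
  have ne: "vs \<noteq> []" using assms(2) N by auto
  hence d: "(u, hd vs) \<in> E" "dipath V E vs" using assms(1) by (auto simp: dipath_Cons)
  have vs: "word_path (map lab vs) = vs" using word_path(3)[of "map lab vs" vs] assms d by simp
  have "hd vs \<noteq> r" using d no_edge_to_root by auto
  moreover have "(THE u. (u, hd vs) \<in> E) = u" using d parent_unique by blast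
  ultimately show ?thesis by (simp add: pred_label_def vs)
qed

text \<open>The word has exactly one path, and a path with one more label in front must start at the
  parent of its first node. If that node is the root, there is no parent; the word is then zero and
  only the zero word of length \<open>N + 1\<close> qualifies.\<close>

lemma path_iff_pred_label:
  assumes "length \<alpha>s = N"
  shows "((\<exists>vs. dipath V E vs \<and> length vs = N + 1 \<and> map lab vs = a # \<alpha>s) \<or> a # \<alpha>s = replicate (N + 1) 0)
    \<longleftrightarrow> a = pred_label \<alpha>s"
proof
  assume "(\<exists>vs. dipath V E vs \<and> length vs = N + 1 \<and> map lab vs = a # \<alpha>s) \<or> a # \<alpha>s = replicate (N + 1) 0"
  thus "a = pred_label \<alpha>s"
  proof
    assume "\<exists>vs. dipath V E vs \<and> length vs = N + 1 \<and> map lab vs = a # \<alpha>s"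
    then obtain u vs where "dipath V E (u # vs)" "lab u = a" "map lab vs = \<alpha>s" by (metis map_eq_Cons_D)
    thus ?thesis using pred_label_path[of u vs] assms by auto
  qed (simp add: pred_label_zero)
next
  assume a: "a = pred_label \<alpha>s"
  let ?vs = "word_path \<alpha>s"
  note vs = word_path(1,2)[OF assms]
  show "(\<exists>vs. dipath V E vs \<and> length vs = N + 1 \<and> map lab vs = a # \<alpha>s) \<or> a # \<alpha>s = replicate (N + 1) 0"
  proof (cases "hd ?vs = r")
    case True
    have "length ?vs = N" using vs(2) assms by (metis length_map)
    hence "\<alpha>s = replicate N 0" using root_path_labels[OF vs(1) True] vs(2) by simp
    thus ?thesis using a True by (simp add: pred_label_def)
  next
    case False
    have "hd ?vs \<in> V" "?vs \<noteq> []" using vs(1) by (auto simp: dipath_def)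
    then obtain u where u: "(u, hd ?vs) \<in> E" using parent_ex False by blast
    hence "dipath V E (u # ?vs)" using vs \<open>?vs \<noteq> []\<close> edges by (auto simp: dipath_Cons)
    moreover have "length (u # ?vs) = N + 1" using vs(2) assms by (metis length_map length_Cons Suc_eq_plus1)
    moreover have "lab u = a" using pred_label_path[OF \<open>dipath V E (u # ?vs)\<close>] calculation(2) vs(2) a by simp
    ultimately show ?thesis using vs(2) by (intro disjI1 exI[of _ "u # ?vs"]) simp
  qed
qed

text \<open>A sequence of labels obeying the recursion climbs the tree one level per step, so it vanishes
  once the root has been reached.\<close>

lemma recursion_zero_from_root_path:
  assumes "dipath V E ws" "hd ws = r" "length ws = N + D" "map lab (drop D ws) = drop K us" "length us = K + N"
    and "\<And>i. i < K \<Longrightarrow> us ! i = pred_label (take N (drop (Suc i) us))"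
  shows "i + D < K \<Longrightarrow> us ! i = 0"
  using assms
proof (induction D arbitrary: ws us K i)
  case 0
  have z: "drop K us = replicate N 0" using root_path_labels[of ws] 0 by simp
  \<comment> \<open>The recursion runs from the end of the list towards its front, hence the
    induction on the distance from position \<open>K\<close>.\<close>
  have "us ! (K - n) = 0" if "0 < n" "n \<le> K" for n
    using that
  proof (induction n rule: less_induct)
    case (less n)
    have "take N (drop (Suc (K - n)) us) = replicate N 0"
    proof (rule nth_equalityI)
      fix j assume "j < length (take N (drop (Suc (K - n)) us))"
      hence j: "j < N" "Suc (K - n) + j < K + N" using 0 by auto
      have "us ! (Suc (K - n) + j) = 0"
      proof (cases "Suc (K - n) + j < K")
        case True
        have "us ! (K - (K - (Suc (K - n) + j))) = 0" by (rule less.IH) (use True less.prems in auto)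
        thus ?thesis using True by simp
      next
        case False
        hence "us ! (Suc (K - n) + j) = drop K us ! (Suc (K - n) + j - K)" using 0 by simp
        also have "\<dots> = 0" using z j False by simp
        finally show ?thesis .
      qed
      thus "take N (drop (Suc (K - n)) us) ! j = replicate N 0 ! j" using j 0 by simp
    qed (use 0 less.prems in simp)
    thus ?case using 0(7)[of "K - n"] less.prems by (simp add: pred_label_zero)
  qed
  from this[of "K - i"] 0(1) show ?case by simp
next
  case (Suc D)
  have K: "K > 0" using Suc.prems by simp
  have D: "D < length ws" using Suc.prems N by simp
  have dD: "drop D ws = ws ! D # drop (Suc D) ws" using D by (simp add: Cons_nth_drop_Suc)
  have path: "dipath V E (drop D ws)"
  proof (cases "D = 0")
    case False
    have "dipath V E (take D ws @ drop D ws)" using Suc.prems by simp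
    thus ?thesis using D False by (subst (asm) dipath_append) auto
  qed (use Suc.prems in simp)
  have "lab (ws ! D) = pred_label (map lab (drop (Suc D) ws))"
    using path unfolding dD by (rule pred_label_path) (use Suc.prems in simp)
  also have "\<dots> = us ! (K - 1)"
    using Suc.prems(7)[of "K - 1"] K Suc.prems by simp
  finally have lab: "us ! (K - 1) = lab (ws ! D)" ..
  \<comment> \<open>Dropping the last entry of both lists moves the window of \<open>N\<close>
    labels one level up the tree, so \<open>D\<close> and \<open>K\<close> both decrease by
    one.\<close>
  have "butlast us ! i = 0"
  proof (rule Suc.IH[of i "K - 1" "butlast ws"])
    show "i + D < K - 1" using Suc.prems by simp
    have ws: "ws \<noteq> []" "butlast ws \<noteq> []" using Suc.prems N
      by (auto simp: butlast_conv_take)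
    have "dipath V E (butlast ws @ [last ws])" using Suc.prems ws by simp
    thus "dipath V E (butlast ws)" using ws by (subst (asm) dipath_append) auto
    show "hd (butlast ws) = r" using Suc.prems(3) ws by (metis hd_append2 append_butlast_last_id)
    show "length (butlast ws) = N + D" using Suc.prems by simp
    show "length (butlast us) = K - 1 + N" using Suc.prems K by simp
    have us: "drop (K - 1) us = us ! (K - 1) # drop K us"
      using Cons_nth_drop_Suc[of "K - 1" us] K N Suc.prems by simp
    have "map lab (drop D (butlast ws)) = butlast (map lab (drop D ws))"
      by (simp only: drop_butlast map_butlast)
    also have "\<dots> = butlast (drop (K - 1) us)"
      using Suc.prems by (simp only: dD list.map lab[symmetric] us)
    also have "\<dots> = drop (K - 1) (butlast us)" by (simp only: drop_butlast)
    finally show "map lab (drop D (butlast ws)) = drop (K - 1) (butlast us)" .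
    fix j assume j: "j < K - 1"
    have "take N (drop (Suc j) (butlast us)) = take N (drop (Suc j) us)"
      using j Suc.prems by (simp add: butlast_conv_take drop_take min_def)
    thus "butlast us ! j = pred_label (take N (drop (Suc j) (butlast us)))"
      using Suc.prems(7)[of j] j Suc.prems(6) by (simp add: nth_butlast)
  qed
  thus ?case using Suc.prems by (simp add: nth_butlast)
qed

text \<open>The finiteness of the field bounds the height: there are finitely many words of length
  \<open>N\<close>, and \<open>H\<close> is a bound for the depths at which their paths
  start.\<close>

lemma recursion_height:
  "\<exists>H. \<forall>K us. length us = K + N \<longrightarrow> (\<forall>i<K. us ! i = pred_label (take N (drop (Suc i) us))) \<longrightarrow>
     (\<forall>i. i + H < K \<longrightarrow> us ! i = 0)"
proof -
  have "\<exists>D ws. dipath V E ws \<and> hd ws = r \<and> length ws = N + D \<and> map lab (drop D ws) = \<alpha>s"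
    if "length \<alpha>s = N" for \<alpha>s
  proof -
    let ?vs = "word_path \<alpha>s"
    note vs = word_path(1,2)[OF that]
    have ne: "?vs \<noteq> []" "hd ?vs \<in> V" using vs(1) by (auto simp: dipath_def)
    obtain ps where ps: "dipath V E ps" "hd ps = r" "last ps = hd ?vs" using root_pathE[OF ne(2)] .
    have pne: "ps \<noteq> []" using ps by (auto simp: dipath_def)
    \<comment> \<open>The path \<open>ps\<close> from the root ends at the node where
      \<open>?vs\<close> starts, and this shared node is counted once. So \<open>?vs\<close> starts
      at depth \<open>length ps - 1\<close>.\<close>
    have eq: "ps @ tl ?vs = butlast ps @ ?vs"
      using pne ne ps by (metis append.assoc append_Cons append_Nil append_butlast_last_id hd_Cons_tl)
    have "dipath V E (ps @ tl ?vs)"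
    proof (cases "tl ?vs = []")
      case False
      have "dipath V E (hd ?vs # tl ?vs)" using vs ne by simp
      with False ps pne show ?thesis by (simp add: dipath_Cons dipath_append)
    qed (use ps in simp)
    moreover have "hd (ps @ tl ?vs) = r" using pne ps by simp
    moreover have "length (butlast ps @ ?vs) = N + (length ps - 1)"
      using vs(2) that by (metis length_append length_butlast length_map add.commute)
    moreover have "map lab (drop (length ps - 1) (butlast ps @ ?vs)) = \<alpha>s" using vs by simp
    ultimately show ?thesis unfolding eq by blast
  qed
  then obtain D where D: "\<And>\<alpha>s. length \<alpha>s = N \<Longrightarrow>
      \<exists>ws. dipath V E ws \<and> hd ws = r \<and> length ws = N + D \<alpha>s \<and> map lab (drop (D \<alpha>s) ws) = \<alpha>s"
    by metis
  define H where "H = Max (D ` {\<alpha>s. length \<alpha>s = N})"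
  have fin: "finite {\<alpha>s :: 'k list. length \<alpha>s = N}"
    using finite_lists_length_eq[of "UNIV :: 'k set" N] by simp
  have DH: "D \<alpha>s \<le> H" if "length \<alpha>s = N" for \<alpha>s
    unfolding H_def using fin that by (intro Max_ge) auto
  show ?thesis
  proof (intro exI[of _ H] allI impI)
    fix K and us :: "'k list" and i
    assume us: "length us = K + N" "\<forall>i<K. us ! i = pred_label (take N (drop (Suc i) us))" "i + H < K"
    have l: "length (drop K us) = N" using us by simp
    obtain ws where ws: "dipath V E ws" "hd ws = r" "length ws = N + D (drop K us)"
        "map lab (drop (D (drop K us)) ws) = drop K us" using D[OF l] by blast
    show "us ! i = 0"
      by (rule recursion_zero_from_root_path[OF ws us(1)]) (use us DH[OF l] in auto)
  qed
qed

end

section \<open>The orthonormal system on the Fourier side\<close>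

lemma H0_iff: "h \<in> H0 \<longleftrightarrow> (\<forall>j\<ge>0. h $$ j = 0)"
proof
  assume "h \<in> H0"
  then obtain \<nu> a where h: "h = (\<Sum>j=1..\<nu>. fls_monom (- int j) (a j))"
    unfolding H0_def fls_monom_def by blast
  show "\<forall>j\<ge>0. h $$ j = 0"
    unfolding h sum_fls_nth by (auto intro!: sum.neutral)
next
  assume *: "\<forall>j\<ge>0. h $$ j = 0"
  define \<nu> where "\<nu> = nat (- fls_subdegree h)"
  have "h = (\<Sum>j=1..\<nu>. fls_monom (- int j) (h $$ (- int j)))"
  proof (rule fls_eqI)
    fix k
    have "(\<Sum>j=1..\<nu>. fls_monom (- int j) (h $$ (- int j))) $$ k =
        (\<Sum>j\<in>{1..\<nu>}. if j = nat (- k) then (if k < 0 then h $$ k else 0) else 0)"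
      unfolding sum_fls_nth by (intro sum.cong) auto
    also have "\<dots> = h $$ k"
    proof (cases "nat (- k) \<in> {1..\<nu>}")
      case False
      hence "k \<ge> 0 \<or> k < fls_subdegree h" by (auto simp: \<nu>_def)
      hence "h $$ k = 0" using * by auto
      thus ?thesis using False by auto
    qed auto
    finally show "h $$ k = (\<Sum>j=1..\<nu>. fls_monom (- int j) (h $$ (- int j))) $$ k" ..
  qed
  thus "h \<in> H0" unfolding H0_def fls_monom_def
    by (intro CollectI exI[of _ \<nu>] exI[of _ "\<lambda>j. h $$ (- int j)"] conjI TrueI)
qed

text \<open>The part of \<open>x\<close> on which the pairing with elements of \<open>H0\<close>
  depends.\<close>

definition fls_pos :: "'k::field fls \<Rightarrow> 'k fls" where
  "fls_pos x = x - fls_trunc 0 x"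

lemma fls_pos_nth [simp]: "fls_pos x $$ j = (if j < 0 then 0 else x $$ j)"
  by (simp add: fls_pos_def)

lemma fls_pos_in_ball: "fls_pos x \<in> fls_ball 0"
  by (simp add: mem_fls_ball)

context haar_field
begin

lemma pair_diff_left: "pair (b - d) x = pair b x * cnj (pair d x)"
  by (simp only: diff_conv_add_uminus pair_add_left cnj_pair(2))

lemma pair_H0_cong:
  assumes "h \<in> H0" "\<And>j. j \<ge> 0 \<Longrightarrow> x $$ j = y $$ j"
  shows "pair x h = pair y h"
proof (rule pair_cong_left)
  fix j assume "h $$ (-1 - j) \<noteq> 0"
  hence "\<not> -1 - j \<ge> 0" using assms(1) by (auto simp: H0_iff)
  thus "x $$ j = y $$ j" using assms(2) by simp
qed

lemma integral_pair_absorbing: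
  assumes S: "S \<subseteq> fls_ball i" and abs: "\<And>x y. x \<in> S \<Longrightarrow> y \<in> cyl x m \<Longrightarrow> y \<in> S"
  shows "(LINT x|\<mu>. indicator S x * pair b x) =
    (\<Sum>a\<in>fls_box i m \<inter> S. if b \<in> fls_ball (- m) then of_real (q powi (- m)) * pair b a else 0)"
proof -
  have "(LINT x|\<mu>. indicator S x * pair b x) =
      (LINT x|\<mu>. (\<Sum>a\<in>fls_box i m \<inter> S. indicator (cyl a m) x * pair b x))"
    by (simp only: indicator_cyl_decomp[OF S abs] sum_distrib_right)
  also have "\<dots> = (\<Sum>a\<in>fls_box i m \<inter> S. LINT x|\<mu>. indicator (cyl a m) x * pair b x)"
    by (intro Bochner_Integration.integral_sum L2_indicator_bounded(2)[where C = 1] emeasure_cyl_finite)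
       (auto simp: norm_pair)
  finally show ?thesis by (simp only: integral_pair_cyl)
qed

text \<open>One integral over \<open>fls_ball (- m)\<close> is evaluated twice: coset by coset
  modulo \<open>fls_ball 0\<close>, which gives the sum, and as a whole, which gives the
  orthogonality relation. Passing from \<open>x\<close> to \<open>fls_pos x\<close> makes the
  character trivial on \<open>fls_ball 0\<close>.\<close>

lemma sum_pair_box:
  assumes m: "m \<ge> 0"
  shows "(\<Sum>h\<in>fls_box (- m) 0. pair x h) = (if \<forall>j. 0 \<le> j \<and> j < m \<longrightarrow> x $$ j = 0 then of_real (q powi m) else 0)"
proof -
  let ?b = "fls_pos x"
  have box: "fls_box (- m) 0 \<inter> fls_ball (- m) = (fls_box (- m) 0 :: 'a fls set)"
    by (auto simp: fls_box_def mem_fls_ball)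
  have "(LINT x|\<mu>. indicator (fls_ball (- m)) x * pair ?b x) =
      (\<Sum>h\<in>fls_box (- m) 0 \<inter> fls_ball (- m). if ?b \<in> fls_ball (- 0) then of_real (q powi (- 0)) * pair ?b h else 0)"
    by (rule integral_pair_absorbing) (use m in \<open>auto intro: fls_ball_absorb[of "- m" 0]\<close>)
  also have "\<dots> = (\<Sum>h\<in>fls_box (- m) 0. pair ?b h)"
    using fls_pos_in_ball[of x] by (simp add: box)
  also have "\<dots> = (\<Sum>h\<in>fls_box (- m) 0. pair x h)"
    by (intro sum.cong refl pair_H0_cong) (auto simp: H0_iff fls_box_def)
  finally have e: "(LINT x|\<mu>. indicator (fls_ball (- m)) x * pair ?b x) = (\<Sum>h\<in>fls_box (- m) 0. pair x h)" .
  have "(\<Sum>h\<in>fls_box (- m) 0. pair x h) = (if ?b \<in> fls_ball m then of_real (q powi m) else 0)"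
    by (simp only: e[symmetric] integral_pair_ball minus_minus)
  moreover have "?b \<in> fls_ball m \<longleftrightarrow> (\<forall>j. 0 \<le> j \<and> j < m \<longrightarrow> x $$ j = 0)"
    by (auto simp: mem_fls_ball)
  ultimately show ?thesis by simp
qed

end

text \<open>The support of the Fourier transform of the scaling function consists of the series in which
  every digit of negative index is the value of \<open>f\<close> at the \<open>N\<close> digits following it. The defects
  measure the failure of this recursion.\<close>

locale digit_recursion = haar_field p s c \<mu>
  for p s and c :: "'a::{field,finite} \<Rightarrow> nat \<Rightarrow> nat" and \<mu> +
  fixes N H :: nat and f :: "'a fls \<Rightarrow> 'a"
  assumes f_cong: "(\<And>j. 0 \<le> j \<Longrightarrow> j < int N \<Longrightarrow> b $$ j = d $$ j) \<Longrightarrow> f b = f d"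
    and f_0: "f 0 = 0"
    and height: "\<lbrakk>\<And>k. k < K \<Longrightarrow> b $$ (-1 - int k) = f (fls_shift (- int k) b);
        - int K \<le> j; j < - int H\<rbrakk> \<Longrightarrow> b $$ j = 0"
begin

definition defect :: "int \<Rightarrow> 'a fls \<Rightarrow> 'a" where
  "defect n b = b $$ (-1 - n) - f (fls_shift (- n) b)"

definition wav_supp :: "'a \<Rightarrow> int \<Rightarrow> 'a fls set" where
  "wav_supp l n = {b. defect n b = l \<and> (\<forall>k>n. defect k b = 0)}"

lemma defect_cong_cyl:
  assumes "b \<in> cyl d m" "int N - n \<le> m" "- n \<le> m"
  shows "defect n b = defect n d"
proof -
  have "f (fls_shift (- n) b) = f (fls_shift (- n) d)"
    using assms by (intro f_cong) (auto simp: mem_cyl)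
  thus ?thesis using assms by (simp add: defect_def mem_cyl)
qed

lemma defect_shift: "defect k (fls_shift (- n) b) = defect (k + n) b"
  by (simp add: defect_def algebra_simps)

text \<open>The window of \<open>N\<close> digits and the digit before it lie below index
  \<open>- m\<close>, so the recursion only reads \<open>f 0 = 0\<close>.\<close>

lemma defect_eq_0_of_ball: "b \<in> fls_ball (- m) \<Longrightarrow> n \<ge> m + int N \<Longrightarrow> defect n b = 0"
proof -
  assume b: "b \<in> fls_ball (- m)" and n: "n \<ge> m + int N"
  have "f (fls_shift (- n) b) = f 0" using b n by (intro f_cong) (auto simp: mem_fls_ball)
  thus ?thesis using b n by (simp add: defect_def f_0 mem_fls_ball)
qed

lemma ball_of_defect_0:
  assumes "\<And>k. k \<ge> 0 \<Longrightarrow> defect k b = 0" shows "b \<in> fls_ball (- int H)"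
  unfolding mem_fls_ball
proof (intro allI impI)
  fix j assume j: "j < - int H"
  show "b $$ j = 0"
  proof (rule height[of "nat (- j)"])
    fix k assume "k < nat (- j)"
    show "b $$ (-1 - int k) = f (fls_shift (- int k) b)"
      using assms[of "int k"] by (simp add: defect_def)
  qed (use j in auto)
qed

text \<open>A dilation moves any given digit to the position \<open>- int H - 1\<close>, where the
  height bound forces it to vanish.\<close>

lemma eq_0_of_defect_0:
  assumes "\<And>k. defect k b = 0" shows "b = 0"
proof (rule fls_eqI)
  fix j
  define n where "n = - j - int H - 1"
  have "fls_shift (- n) b \<in> fls_ball (- int H)"
    by (rule ball_of_defect_0) (simp add: defect_shift assms)
  hence "fls_shift (- n) b $$ (- int H - 1) = 0" by (simp add: mem_fls_ball)
  thus "b $$ j = 0 $$ j" by (simp add: n_def)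
qed

lemma defect_0 [simp]: "defect n 0 = 0"
  by (simp add: defect_def f_0)

text \<open>Defects vanish for all large indices, since they look only at digits before the series
  begins; as some defect is nonzero, there is a last nonzero one.\<close>

lemma wav_supp_cover:
  assumes "b \<noteq> 0" shows "\<exists>l n. l \<noteq> 0 \<and> b \<in> wav_supp l n"
proof -
  obtain k where k: "defect k b \<noteq> 0" using eq_0_of_defect_0 assms by blast
  obtain m :: nat where m: "b \<in> fls_ball (- int m)" using fls_ball_cover by blast
  define S where "S = {n \<in> {k..int m + int N}. defect n b \<noteq> 0}"
  have "k \<le> int m + int N" using defect_eq_0_of_ball[OF m, of k] k by linarith
  moreover have "finite S" by (rule finite_subset[of _ "{k..int m + int N}"]) (auto simp: S_def)
  ultimately have S: "finite S" "k \<in> S" using k by (simp_all add: S_def)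
  define n where "n = Max S"
  have n: "n \<in> S" unfolding n_def using S by (intro Max_in) auto
  have "defect j b = 0" if "j > n" for j
  proof (rule ccontr)
    assume j: "defect j b \<noteq> 0"
    hence "j < int m + int N" using defect_eq_0_of_ball[OF m, of j] by linarith
    hence "j \<in> S" using j n that by (auto simp: S_def)
    hence "j \<le> n" unfolding n_def using S by (intro Max_ge) auto
    with that show False by simp
  qed
  with n have "b \<in> wav_supp (defect n b) n" by (simp add: wav_supp_def)
  thus ?thesis using n by (auto simp: S_def)
qed

lemma wav_supp_disjoint:
  assumes "b \<in> wav_supp l n" "b \<in> wav_supp l' n'" "l \<noteq> 0" "l' \<noteq> 0"
  shows "n = n' \<and> l = l'"
proof -
  have "\<not> n < n'" "\<not> n' < n" using assms by (auto simp: wav_supp_def)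
  thus ?thesis using assms by (auto simp: wav_supp_def)
qed

lemma wav_supp_shift: "b \<in> wav_supp l n \<longleftrightarrow> fls_shift (- n) b \<in> wav_supp l 0"
  unfolding wav_supp_def mem_Collect_eq defect_shift
proof (intro conj_cong iffI allI impI)
  fix k :: int assume "\<forall>k>n. defect k b = 0" "k > 0" thus "defect (k + n) b = 0" by simp
next
  fix k :: int assume *: "\<forall>k>0. defect (k + n) b = 0" "k > n"
  from *(1)[rule_format, of "k - n"] *(2) show "defect k b = 0" by simp
qed auto

lemma zero_not_in_wav_supp: "l \<noteq> 0 \<Longrightarrow> 0 \<notin> wav_supp l n"
  by (simp add: wav_supp_def)

lemma wav_supp_absorb:
  assumes b: "b \<in> wav_supp l n" and d: "d \<in> cyl b m" and m: "m \<ge> int N - n" "m \<ge> - n"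
  shows "d \<in> wav_supp l n"
proof -
  have "defect k d = defect k b" if "k \<ge> n" for k
    by (rule defect_cong_cyl[OF d]) (use m that in auto)
  thus ?thesis using b by (simp add: wav_supp_def)
qed

text \<open>The defect at index 0 is arbitrary, so the height bound applies only after one dilation;
  this is the extra 1.\<close>

lemma wav_supp_0_subset: "wav_supp l 0 \<subseteq> fls_ball (- (int H + 1))"
proof
  fix b assume b: "b \<in> wav_supp l 0"
  have "fls_shift (- 1) b \<in> fls_ball (- int H)"
    by (rule ball_of_defect_0) (use b in \<open>simp add: defect_shift wav_supp_def\<close>)
  thus "b \<in> fls_ball (- (int H + 1))"
    unfolding mem_fls_ball
  proof (intro allI impI)
    fix j assume *: "\<forall>j < - int H. fls_shift (- 1) b $$ j = 0" "j < - (int H + 1)"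
    from *(1)[rule_format, of "j + 1"] *(2) show "b $$ j = 0" by simp
  qed
qed

lemma wav_supp_subset: "wav_supp l n \<subseteq> fls_ball (- (int H + 1) - n)"
proof
  fix b assume "b \<in> wav_supp l n"
  hence s: "fls_shift (- n) b \<in> fls_ball (- (int H + 1))" using wav_supp_shift wav_supp_0_subset by blast
  show "b \<in> fls_ball (- (int H + 1) - n)"
    unfolding mem_fls_ball
  proof (intro allI impI)
    fix j assume "j < - (int H + 1) - n"
    hence "fls_shift (- n) b $$ (j + n) = 0" using s unfolding mem_fls_ball by (elim allE[of _ "j + n"]) auto
    thus "b $$ j = 0" by simp
  qed
qed

lemma wav_supp_sets [measurable]: "wav_supp l n \<in> sets borel"
proof -
  have "open (wav_supp l n)"
    unfolding open_fls_iff
  proof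
    fix b assume b: "b \<in> wav_supp l n"
    have "cyl b (int (nat (int N - n) + nat (- n))) \<subseteq> wav_supp l n"
      using wav_supp_absorb[OF b] by auto
    thus "\<exists>m::nat. cyl b (int m) \<subseteq> wav_supp l n" by blast
  qed
  thus ?thesis by (rule borel_open)
qed

lemma emeasure_wav_supp: "emeasure \<mu> (wav_supp l n) < \<infinity>"
  by (rule finite_emeasure_subset_ball[OF wav_supp_subset])

section \<open>Free digits and integrals over the supports\<close>

lemma wav_supp_0_eqI:
  assumes b: "b \<in> wav_supp l 0" and d: "d \<in> wav_supp l 0"
    and eq: "\<And>j. 0 \<le> j \<Longrightarrow> j < int M \<Longrightarrow> b $$ j = d $$ j" and M: "M \<ge> N"
  shows "b \<in> cyl d (int M)"
proof -
  \<comment> \<open>The digits are compared one by one downwards: both series have defect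
    \<open>l\<close> at index 0 and defect 0 at all larger indices, so equal windows force equal
    next digits.\<close>
  have "\<forall>j. - int k \<le> j \<and> j < int M \<longrightarrow> b $$ j = d $$ j" for k
  proof (induction k)
    case (Suc k)
    have "f (fls_shift (- int k) b) = f (fls_shift (- int k) d)"
      using Suc M by (intro f_cong) simp
    moreover have "defect (int k) b = defect (int k) d"
      using b d by (cases "k = 0") (auto simp: wav_supp_def)
    ultimately have k: "b $$ (-1 - int k) = d $$ (-1 - int k)" by (simp add: defect_def)
    show ?case
    proof (intro allI impI)
      fix j assume "- int (Suc k) \<le> j \<and> j < int M"
      hence "j = -1 - int k \<or> - int k \<le> j \<and> j < int M" by auto
      thus "b $$ j = d $$ j" using k Suc by metis
    qed
  qed (use eq in auto)
  hence "b $$ j = d $$ j" if "j < int M" for j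
    using that by (elim meta_allE[of _ "nat (- j)"]) auto
  thus ?thesis by (simp add: mem_cyl)
qed

text \<open>The recursion is run \<open>H + N\<close> steps downwards. By the height bound the last
  \<open>N\<close> digits obtained are zero, and from a window of zeros the recursion continues with
  zeros, so the series can stop there.\<close>

lemma defect_0_extension: "\<exists>z. (\<forall>j\<ge>0. z $$ j = a $$ j) \<and> (\<forall>k\<ge>0. defect k z = 0)"
proof -
  have "\<exists>z. (\<forall>j\<ge>0. z $$ j = a $$ j) \<and> (\<forall>j < - int K. z $$ j = 0) \<and> (\<forall>k<K. defect (int k) z = 0)" for K
  proof (induction K)
    case 0
    show ?case by (rule exI[of _ "fls_pos a"]) simp
  next
    case (Suc K)
    then obtain z where z: "\<forall>j\<ge>0. z $$ j = a $$ j" "\<forall>j < - int K. z $$ j = 0" "\<forall>k<K. defect (int k) z = 0"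
      by blast
    define w where "w = z + fls_monom (-1 - int K) (f (fls_shift (- int K) z))"
    have w: "w $$ j = z $$ j" if "j \<noteq> -1 - int K" for j using that by (simp add: w_def)
    have fw: "f (fls_shift (- int k) w) = f (fls_shift (- int k) z)" if "k \<le> K" for k
      by (rule f_cong) (use that in \<open>simp add: w\<close>)
    show ?case
    proof (intro exI[of _ w] conjI allI impI)
      fix k assume "k < Suc K"
      show "defect (int k) w = 0"
      proof (cases "k = K")
        case True
        have "w $$ (-1 - int K) = f (fls_shift (- int K) z)" using z(2) by (simp add: w_def)
        thus ?thesis using True fw[of K] by (simp add: defect_def)
      next
        case False
        hence "defect (int k) z = 0" "k \<le> K" using z(3) \<open>k < Suc K\<close> by auto
        thus ?thesis using fw[of k] w[of "-1 - int k"] False by (simp add: defect_def)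
      qed
    qed (use z w in auto)
  qed
  then obtain z where z: "\<forall>j\<ge>0. z $$ j = a $$ j" "\<forall>j < - int (H + N). z $$ j = 0"
      "\<forall>k<H + N. defect (int k) z = 0" by blast
  have "z $$ j = 0" if "j < - int H" for j
  proof (cases "j < - int (H + N)")
    case False
    show ?thesis
    proof (rule height[of "H + N"])
      fix k assume "k < H + N"
      thus "z $$ (-1 - int k) = f (fls_shift (- int k) z)" using z(3) by (simp add: defect_def)
    qed (use that False in auto)
  qed (use z in simp)
  hence "z \<in> fls_ball (- int H)" by (simp add: mem_fls_ball)
  hence "defect k z = 0" if "k \<ge> 0" for k
    using defect_eq_0_of_ball[of z "int H" k] z(3)[rule_format, of "nat k"] that by (cases "k < int (H + N)") auto
  with z show ?thesis by blast
qed

lemma wav_supp_0_ex: "\<exists>y\<in>wav_supp l 0. \<forall>j\<ge>0. y $$ j = a $$ j"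
proof -
  \<comment> \<open>The prescribed digits are moved up by one and preceded by the digit
    \<open>l + f a\<close>. Extended without defects and moved back, the series has defect exactly
    \<open>l\<close> at index 0.\<close>
  define a' where "a' = fls_shift (- 1) (fls_pos a + fls_monom (-1) (l + f a))"
  obtain z where z: "\<And>j. j \<ge> 0 \<Longrightarrow> z $$ j = a' $$ j" "\<And>k. k \<ge> 0 \<Longrightarrow> defect k z = 0"
    using defect_0_extension[of a'] by blast
  define y where "y = fls_shift 1 z"
  have y: "y $$ j = a $$ j" if "j \<ge> 0" for j
    using z(1)[of "j + 1"] that by (simp add: y_def a'_def)
  have "f y = f a" using y by (intro f_cong) simp
  moreover have "y $$ (-1) = l + f a" using z(1)[of 0] by (simp add: y_def a'_def)
  ultimately have "defect 0 y = l" by (simp add: defect_def)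
  moreover have "defect k y = 0" if "k > 0" for k
  proof -
    have "defect k y = defect (k - 1) z" using defect_shift[of k "- 1" z] by (simp add: y_def)
    thus ?thesis using z(2) that by simp
  qed
  ultimately have "y \<in> wav_supp l 0" by (simp add: wav_supp_def)
  with y show ?thesis by blast
qed

text \<open>Forgetting the negative digits matches the cosets of \<open>fls_ball (int N)\<close> in
  the support with those in \<open>fls_ball 0\<close>, and \<open>h\<close> does not see these
  digits. The integral is therefore the one over \<open>fls_ball 0\<close>; in particular the
  support has measure 1.\<close>

lemma integral_pair_wav_supp:
  assumes h: "h \<in> H0"
  shows "(LINT y|\<mu>. indicator (wav_supp l 0) y * pair y h) = (if h = 0 then 1 else 0)"
proof -
  let ?i = "- (int H + 1)"
  let ?F = "\<lambda>a. if h \<in> fls_ball (- int N) then of_real (q powi (- int N)) * pair h a else 0"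
  let ?T = "fls_box ?i (int N) \<inter> wav_supp l 0"
  have abs: "y \<in> wav_supp l 0" if "x \<in> wav_supp l 0" "y \<in> cyl x (int N)" for x y
    by (rule wav_supp_absorb[OF that]) auto
  have tr: "fls_trunc (int N) y \<in> wav_supp l 0" if "y \<in> wav_supp l 0" for y
    by (rule abs[OF that]) (simp add: mem_cyl)
  have "(LINT y|\<mu>. indicator (wav_supp l 0) y * pair y h) = (LINT y|\<mu>. indicator (wav_supp l 0) y * pair h y)"
    by (simp add: pair_commute[of _ h])
  also have "\<dots> = sum ?F ?T"
    by (rule integral_pair_absorbing[OF wav_supp_0_subset abs])
  also have "\<dots> = sum ?F (fls_box 0 (int N))"
  proof (rule sum.reindex_bij_betw[symmetric, THEN trans, OF _ sum.cong[OF refl], symmetric])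
    show "bij_betw fls_pos ?T (fls_box 0 (int N))"
      unfolding bij_betw_def
    proof
      show "inj_on fls_pos ?T"
      proof (rule inj_onI)
        fix x y assume x: "x \<in> ?T" and y: "y \<in> ?T" and eq: "fls_pos x = fls_pos y"
        have "x $$ j = y $$ j" if "j \<ge> 0" for j
          using arg_cong[OF eq, of "\<lambda>z. z $$ j"] that by simp
        hence "x \<in> cyl y (int N)" using x y by (intro wav_supp_0_eqI) auto
        thus "x = y" using x y fls_box_eqI by blast
      qed
      show "fls_pos ` ?T = fls_box 0 (int N)"
      proof (intro equalityI subsetI)
        fix a :: "'a fls" assume a: "a \<in> fls_box 0 (int N)"
        obtain y where y: "y \<in> wav_supp l 0" "\<forall>j\<ge>0. y $$ j = a $$ j" using wav_supp_0_ex by blast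
        have "fls_trunc (int N) y \<in> ?T"
          using tr[OF y(1)] subsetD[OF wav_supp_0_subset y(1)] by (auto simp: fls_box_def mem_fls_ball)
        moreover have "a = fls_pos (fls_trunc (int N) y)"
          using a y(2) by (intro fls_eqI) (auto simp: fls_box_def)
        ultimately show "a \<in> fls_pos ` ?T" by blast
      qed (auto simp: fls_box_def)
    qed
    fix x
    show "?F (fls_pos x) = ?F x"
      using pair_H0_cong[OF h, of "fls_pos x" x] by (simp add: pair_commute[of h])
  qed
  also have "\<dots> = (LINT y|\<mu>. indicator (fls_ball 0) y * pair h y)"
  proof -
    have "fls_box 0 (int N) \<inter> fls_ball 0 = (fls_box 0 (int N) :: 'a fls set)"
      by (auto simp: fls_box_def mem_fls_ball)
    moreover have "(LINT y|\<mu>. indicator (fls_ball 0) y * pair h y) = sum ?F (fls_box 0 (int N) \<inter> fls_ball 0)"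
      by (rule integral_pair_absorbing) (auto intro: fls_ball_absorb[of 0 "int N"])
    ultimately show ?thesis by (simp only:)
  qed
  also have "\<dots> = (if h = 0 then 1 else 0)"
  proof -
    have "h \<in> fls_ball 0 \<longleftrightarrow> h = 0"
    proof
      assume "h \<in> fls_ball 0"
      show "h = 0"
      proof (rule fls_eqI)
        fix j show "h $$ j = 0 $$ j"
          using \<open>h \<in> fls_ball 0\<close> h by (cases "j < 0") (auto simp: mem_fls_ball H0_iff)
      qed
    qed (simp add: mem_fls_ball)
    thus ?thesis by (simp add: integral_pair_ball)
  qed
  finally show ?thesis .
qed

text \<open>The transforms of the wavelets for a mask with values 0 and 1 only: the indicator of the
  support, normalised for its measure \<open>q powi n\<close>, times the character produced by the
  translation by \<open>h\<close>.\<close>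

definition basis_fun :: "'a \<times> int \<times> 'a fls \<Rightarrow> 'a fls \<Rightarrow> complex" where
  "basis_fun = (\<lambda>(l, n, h) b. indicator (wav_supp l n) b *
     (of_real (sqrt (q powi (- n))) * cnj (pair (fls_shift (- n) b) h)))"

lemma measurable_pair_shift: "(\<lambda>b. pair (fls_shift n b) h) \<in> borel_measurable borel"
proof -
  have "(\<lambda>b. pair h (fls_shift n b)) \<in> borel_measurable borel" by measurable
  thus ?thesis by (simp add: pair_commute[of _ h])
qed

lemma basis_fun_L12: "basis_fun i \<in> L12 \<mu>"
proof -
  obtain l n h where i: "i = (l, n, h)" by (cases i)
  have m: "(\<lambda>b. of_real (sqrt (q powi (- n))) * cnj (pair (fls_shift (- n) b) h)) \<in> borel_measurable borel"
    by (intro borel_measurable_times borel_measurable_const borel_measurable_cnj measurable_pair_shift)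
  have bd: "cmod (of_real (sqrt (q powi (- n))) * cnj (pair (fls_shift (- n) b) h)) \<le> sqrt (q powi (- n))" for b
    using q_pos by (simp add: norm_mult norm_pair)
  show ?thesis
    unfolding i basis_fun_def L12_def prod.case mem_Collect_eq
    using L2_indicator_bounded[OF _ emeasure_wav_supp m bd] by (simp add: sets_mu wav_supp_sets)
qed

lemma basis_fun_L2: "basis_fun i \<in> L2 \<mu>"
  by (rule L12_L2[OF basis_fun_L12])

text \<open>Different \<open>l\<close> or \<open>n\<close> give disjoint supports. For equal ones a
  dilation reduces the product to a single character with parameter \<open>h' - h\<close>, again in
  \<open>H0\<close>, on the support with \<open>n = 0\<close>.\<close>

lemma basis_fun_orthonormal: "biorthogonal \<mu> basis_fun basis_fun wavelet_index"
  unfolding biorthogonal_def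
proof (intro ballI conjI L2_mult_integrable basis_fun_L2)
  fix i j :: "'a \<times> int \<times> 'a fls" assume ij: "i \<in> wavelet_index" "j \<in> wavelet_index"
  obtain l n h where i: "i = (l, n, h)" "l \<noteq> 0" "h \<in> H0" using ij(1) by (auto simp: wavelet_index_def)
  obtain l' n' h' where j: "j = (l', n', h')" "l' \<noteq> 0" "h' \<in> H0" using ij(2) by (auto simp: wavelet_index_def)
  show "(LINT x|\<mu>. basis_fun i x * cnj (basis_fun j x)) = (if i = j then 1 else 0)"
  proof (cases "n = n' \<and> l = l'")
    case False
    hence "(\<lambda>x. basis_fun i x * cnj (basis_fun j x)) = (\<lambda>x. 0)"
      using wav_supp_disjoint[of _ l n l' n'] i j by (auto simp: basis_fun_def indicator_def fun_eq_iff)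
    thus ?thesis using False i j by (simp only:) auto
  next
    case True
    define k where "k = h' - h"
    have k: "k \<in> H0" using i j by (simp add: k_def H0_iff)
    have r: "complex_of_real (sqrt (q powi k)) * complex_of_real (sqrt (q powi k)) = of_real (q powi k)" for k
      using q_pos by (simp only: of_real_mult[symmetric] real_sqrt_mult_self) simp
    have "basis_fun i x * cnj (basis_fun j x) = of_real (q powi (- n)) *
        (\<lambda>y. indicator (wav_supp l 0) y * pair y k) (fls_affine (- n) 0 x)" for x
    proof (cases "x \<in> wav_supp l n")
      case x: True
      hence "fls_shift (- n) x \<in> wav_supp l 0" by (simp add: wav_supp_shift[symmetric])
      moreover have "cnj (pair y h) * pair y h' = pair y k" for y
        by (simp add: k_def pair_diff mult.commute)
      ultimately show ?thesis
        using x True by (simp add: basis_fun_def i j fls_affine_simps r mult_ac del: of_real_power_int)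
    next
      case x: False
      hence "fls_shift (- n) x \<notin> wav_supp l 0" by (simp add: wav_supp_shift[symmetric])
      thus ?thesis using x by (simp add: basis_fun_def i fls_affine_simps)
    qed
    hence "(LINT x|\<mu>. basis_fun i x * cnj (basis_fun j x)) =
        of_real (q powi (- n)) * (LINT x|\<mu>. (\<lambda>y. indicator (wav_supp l 0) y * pair y k) (fls_affine (- n) 0 x))"
      by (simp only: integral_mult_right_zero)
    also have "(LINT x|\<mu>. (\<lambda>y. indicator (wav_supp l 0) y * pair y k) (fls_affine (- n) 0 x)) =
        q powi n *\<^sub>R (LINT y|\<mu>. indicator (wav_supp l 0) y * pair y k)"
    proof -
      have [measurable]: "(\<lambda>y. pair y k) \<in> borel_measurable borel"
        using measurable_pair[of k] by (simp add: pair_commute[of _ k])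
      show ?thesis using integral_affine(1)[of "\<lambda>y. indicator (wav_supp l 0) y * pair y k" "- n" 0] by simp
    qed
    also have "\<dots> = of_real (q powi n) * (if k = 0 then 1 else 0)"
      by (simp only: integral_pair_wav_supp[OF k] scaleR_conv_of_real)
    finally show ?thesis using True q_pos by (auto simp: i j k_def power_int_minus)
  qed
qed

definition basis_span :: "('a fls \<Rightarrow> complex) set" where
  "basis_span = {g. \<exists>F a. finite F \<and> F \<subseteq> wavelet_index \<and> g = (\<lambda>x. \<Sum>i\<in>F. a i * basis_fun i x)}"

text \<open>Finite Fourier inversion on the part of \<^term>\<open>wav_supp l n\<close> inside a cylinder.\<close>

lemma indicator_cyl_in_basis_span:
  assumes l: "l \<noteq> 0" and x: "x \<in> wav_supp l n" and m: "m + n \<ge> int N"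
  shows "(\<lambda>y. indicator (cyl x m) y) \<in> basis_span"
proof -
  \<comment> \<open>Dilated to \<open>n = 0\<close>, the cylinder prescribes the digits below
    \<open>M\<close>. Since \<open>M \<ge> N\<close>, the digits 0 to \<open>M - 1\<close> determine
    the others below \<open>M\<close> within the support, so parameters \<open>h\<close> with
    \<open>M\<close> digits suffice.\<close>
  define M where "M = nat (m + n)"
  have M: "int M = m + n" "M \<ge> N" using m by (auto simp: M_def)
  define x0 where "x0 = fls_shift (- n) x"
  have x0: "x0 \<in> wav_supp l 0" using x by (simp add: x0_def wav_supp_shift[symmetric])
  define r where "r = sqrt (q powi (- n))"
  have r: "r > 0" using q_pos by (simp add: r_def)
  define B where "B = (fls_box (- int M) 0 :: 'a fls set)"
  have B: "finite B" "B \<subseteq> H0" by (simp add: B_def finite_fls_box, auto simp: B_def H0_iff fls_box_def)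
  define F where "F = (\<lambda>h. (l, n, h)) ` B"
  \<comment> \<open>These are the Fourier coefficients of the indicator: \<open>r\<close> cancels
    the normalisation of \<open>basis_fun\<close>, and \<open>q powi (- int M)\<close> is the
    reciprocal of the number of elements of \<open>B\<close>.\<close>
  define a where "a = (\<lambda>(l' :: 'a, n' :: int, h). of_real (q powi (- int M) / r) * pair x0 h)"
  have "indicator (cyl x m) y = (\<Sum>i\<in>F. a i * basis_fun i y)" for y
  proof -
    let ?y = "fls_shift (- n) y"
    have "(\<Sum>i\<in>F. a i * basis_fun i y) = (\<Sum>h\<in>B. a (l, n, h) * basis_fun (l, n, h) y)"
      unfolding F_def by (subst sum.reindex) (auto simp: inj_on_def)
    also have "\<dots> = (\<Sum>h\<in>B. indicator (wav_supp l n) y * of_real (q powi (- int M)) * cnj (pair (?y - x0) h))"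
    proof (rule sum.cong[OF refl])
      fix h
      have "cnj (pair (?y - x0) h) = cnj (pair ?y h) * pair x0 h"
        by (simp only: pair_diff_left complex_cnj_mult complex_cnj_cnj)
      thus "a (l, n, h) * basis_fun (l, n, h) y =
          indicator (wav_supp l n) y * of_real (q powi (- int M)) * cnj (pair (?y - x0) h)"
        using r by (simp add: a_def basis_fun_def r_def[symmetric])
    qed
    also have "\<dots> = indicator (wav_supp l n) y * of_real (q powi (- int M)) * cnj (\<Sum>h\<in>B. pair (?y - x0) h)"
      by (simp only: sum_distrib_left cnj_sum)
    also have "\<dots> = indicator (wav_supp l n) y * (if \<forall>j. 0 \<le> j \<and> j < int M \<longrightarrow> ?y $$ j = x0 $$ j then 1 else 0)"
      unfolding B_def using q_pos by (subst sum_pair_box) (auto simp: power_int_minus)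
    also have "\<dots> = indicator (cyl x m) y"
    proof (cases "y \<in> wav_supp l n")
      case True
      have "y \<in> cyl x m \<longleftrightarrow> ?y \<in> cyl x0 (int M)"
      proof
        assume "?y \<in> cyl x0 (int M)"
        hence "?y $$ (j + n) = x0 $$ (j + n)" if "j < m" for j
          using that M(1) unfolding mem_cyl by (elim allE[of _ "j + n"]) simp
        thus "y \<in> cyl x m" by (simp add: mem_cyl x0_def)
      qed (auto simp: mem_cyl x0_def M)
      moreover have "?y \<in> cyl x0 (int M)" if "\<forall>j. 0 \<le> j \<and> j < int M \<longrightarrow> ?y $$ j = x0 $$ j"
        using True x0 M(2) that by (intro wav_supp_0_eqI) (auto simp: wav_supp_shift[symmetric])
      moreover have "\<forall>j. 0 \<le> j \<and> j < int M \<longrightarrow> ?y $$ j = x0 $$ j" if "?y \<in> cyl x0 (int M)"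
        using that by (simp add: mem_cyl)
      ultimately show ?thesis using True by (auto simp: indicator_def)
    next
      case False
      hence "y \<notin> cyl x m" using wav_supp_absorb[OF x, of y m] m by auto
      thus ?thesis using False by simp
    qed
    finally show ?thesis ..
  qed
  moreover have "finite F" "F \<subseteq> wavelet_index" using B l by (auto simp: F_def wavelet_index_def)
  ultimately show ?thesis unfolding basis_span_def by (intro CollectI exI[of _ F] exI[of _ a]) auto
qed

text \<open>The good cylinders are those fine enough to lie inside one support. Around a nonzero
  point they exist because it belongs to a support and the supports absorb small cylinders.\<close>

lemma cylinder_span_basis:
  "cylinder_span p s c \<mu> basis_span (\<lambda>x m. \<exists>l n. l \<noteq> 0 \<and> x \<in> wav_supp l n \<and> m + n \<ge> int N)"
proof unfold_locales
  fix g assume "g \<in> basis_span"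
  then obtain F a where "g = (\<lambda>x. \<Sum>i\<in>F. a i * basis_fun i x)" unfolding basis_span_def by blast
  thus "g \<in> L12 \<mu>" by (simp add: L12_sum L12_cmult basis_fun_L12)
next
  show "(\<lambda>x. 0) \<in> basis_span"
    unfolding basis_span_def by (intro CollectI exI[of _ "{}"]) simp
next
  fix g g' assume "g \<in> basis_span" "g' \<in> basis_span"
  then obtain F a F' a' where F: "finite F" "F \<subseteq> wavelet_index" "g = (\<lambda>x. \<Sum>i\<in>F. a i * basis_fun i x)"
    and F': "finite F'" "F' \<subseteq> wavelet_index" "g' = (\<lambda>x. \<Sum>i\<in>F'. a' i * basis_fun i x)"
    unfolding basis_span_def by blast
  have "g x + g' x = (\<Sum>i\<in>F \<union> F'. ((if i \<in> F then a i else 0) + (if i \<in> F' then a' i else 0)) * basis_fun i x)" for x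
  proof -
    have "g x = (\<Sum>i\<in>F \<union> F'. (if i \<in> F then a i else 0) * basis_fun i x)"
      unfolding F(3) using F(1) F'(1) by (intro sum.mono_neutral_cong_left) auto
    moreover have "g' x = (\<Sum>i\<in>F \<union> F'. (if i \<in> F' then a' i else 0) * basis_fun i x)"
      unfolding F'(3) using F(1) F'(1) by (intro sum.mono_neutral_cong_left) auto
    ultimately show ?thesis by (simp only: distrib_right sum.distrib)
  qed
  thus "(\<lambda>x. g x + g' x) \<in> basis_span"
    unfolding basis_span_def mem_Collect_eq using F F'
    by (intro exI[of _ "F \<union> F'"] exI[of _ "\<lambda>i. (if i \<in> F then a i else 0) + (if i \<in> F' then a' i else 0)"]) auto
next
  fix g and z :: complex assume "g \<in> basis_span"
  then obtain F a where F: "finite F" "F \<subseteq> wavelet_index" "g = (\<lambda>x. \<Sum>i\<in>F. a i * basis_fun i x)"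
    unfolding basis_span_def by blast
  show "(\<lambda>x. z * g x) \<in> basis_span"
    unfolding basis_span_def mem_Collect_eq using F
    by (intro exI[of _ F] exI[of _ "\<lambda>i. z * a i"]) (simp add: sum_distrib_left mult.assoc)
next
  fix x y :: "'a fls" and m m' :: int
  assume *: "\<exists>l n. l \<noteq> 0 \<and> x \<in> wav_supp l n \<and> int N \<le> m + n" "m \<le> m'" "y \<in> cyl x m"
  then obtain l n where "l \<noteq> 0" "x \<in> wav_supp l n" "int N \<le> m + n" by blast
  moreover from this have "y \<in> wav_supp l n" using wav_supp_absorb[of x l n y m] *(3) by simp
  ultimately show "\<exists>l n. l \<noteq> 0 \<and> y \<in> wav_supp l n \<and> int N \<le> m' + n" using *(2) by force
next
  fix x :: "'a fls" assume "x \<noteq> 0"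
  then obtain l n where "l \<noteq> 0" "x \<in> wav_supp l n" using wav_supp_cover by blast
  thus "\<exists>m l n. l \<noteq> 0 \<and> x \<in> wav_supp l n \<and> int N \<le> m + n"
    by (intro exI[of _ "int N - n"] exI[of _ l] exI[of _ n]) simp
qed (use indicator_cyl_in_basis_span in blast)

lemma basis_fun_complete: "L2_closed_span \<mu> basis_fun wavelet_index = L2 \<mu>"
proof (intro equalityI subsetI)
  interpret S: cylinder_span p s c \<mu> basis_span "\<lambda>x m. \<exists>l n. l \<noteq> 0 \<and> x \<in> wav_supp l n \<and> m + n \<ge> int N"
    by (rule cylinder_span_basis)
  fix g assume g: "g \<in> L2 \<mu>"
  show "g \<in> L2_closed_span \<mu> basis_fun wavelet_index"
    unfolding L2_closed_span_def
  proof (intro CollectI conjI g allI impI)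
    fix \<epsilon> :: real assume "\<epsilon> > 0"
    then obtain g' where "g' \<in> basis_span" "L2_norm \<mu> (\<lambda>x. g x - g' x) < \<epsilon>"
      using S.L2_approx[OF g] by blast
    thus "\<exists>F a. finite F \<and> F \<subseteq> wavelet_index \<and> L2_norm \<mu> (\<lambda>x. g x - (\<Sum>j\<in>F. a j * basis_fun j x)) < \<epsilon>"
      unfolding basis_span_def by blast
  qed
qed (auto simp: L2_closed_span_def)

end

section \<open>Masks\<close>

definition fls_scaling :: "('k::field fls \<Rightarrow> complex) \<Rightarrow> 'k fls \<Rightarrow> complex" where
  "fls_scaling M b = (\<Prod>n. M (fls_shift (- int n) b))"

text \<open>A character of index 0 has its digit at position -1, so division by it subtracts
  \<open>fls_monom (-1) l\<close>.\<close>

definition fls_wavelet :: "('k::field fls \<Rightarrow> complex) \<Rightarrow> 'k \<Rightarrow> 'k fls \<Rightarrow> complex" where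
  "fls_wavelet M l b = M (b - fls_monom (-1) l) * fls_scaling M (fls_shift (-1) b)"

locale mask = digit_recursion p s c \<mu> N H f
  for p s and c :: "'a::{field,finite} \<Rightarrow> nat \<Rightarrow> nat" and \<mu> N H f +
  fixes M :: "'a fls \<Rightarrow> complex" and A B :: real
  assumes A_pos: "0 < A" and A_le_B: "A \<le> B"
    and M_measurable [measurable]: "M \<in> borel_measurable borel"
    and M_ball: "b \<in> fls_ball (int N) \<Longrightarrow> M b = 1"
    and M_nonzero_iff: "M b \<noteq> 0 \<longleftrightarrow> b $$ (-1) = f b"
    and M_bounds: "M b \<noteq> 0 \<Longrightarrow> A \<le> (cmod (M b))\<^sup>2 \<and> (cmod (M b))\<^sup>2 \<le> B"
begin

lemma B_pos: "0 < B"
  using A_pos A_le_B by linarith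

lemma M_shift_nonzero_iff: "M (fls_shift (- k) b) \<noteq> 0 \<longleftrightarrow> defect k b = 0"
  by (simp add: M_nonzero_iff defect_def)

text \<open>The translation changes only the digit at -1, which \<open>f\<close> does not
  read.\<close>

lemma M_translate_nonzero_iff: "M (b - fls_monom (-1) l) \<noteq> 0 \<longleftrightarrow> defect 0 b = l"
proof -
  have "f (b - fls_monom (-1) l) = f b" by (rule f_cong) simp
  thus ?thesis by (auto simp: M_nonzero_iff defect_def algebra_simps)
qed

lemma M_shift_eq_1: "b \<in> fls_ball (- int m) \<Longrightarrow> n \<ge> m + N \<Longrightarrow> M (fls_shift (- int n) b) = 1"
  by (rule M_ball) (auto simp: mem_fls_ball)

text \<open>From the dilation with index \<open>m + N\<close> on, the series lies in
  \<open>fls_ball (int N)\<close>, where the mask is 1; the infinite product is in fact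
  finite.\<close>

lemma scaling_eq_prod:
  assumes "b \<in> fls_ball (- int m)" "K \<ge> m + N"
  shows "fls_scaling M b = (\<Prod>n<K. M (fls_shift (- int n) b))"
  unfolding fls_scaling_def
  by (rule prodinf_finite, simp, rule M_shift_eq_1[OF assms(1)]) (use assms(2) in simp)

lemma scaling_nonzero_iff: "fls_scaling M b \<noteq> 0 \<longleftrightarrow> (\<forall>k\<ge>0. defect k b = 0)"
proof -
  obtain m where m: "b \<in> fls_ball (- int m)" using fls_ball_cover by blast
  have "fls_scaling M b \<noteq> 0 \<longleftrightarrow> (\<forall>n<m + N. defect (int n) b = 0)"
    by (auto simp: scaling_eq_prod[OF m order_refl] M_shift_nonzero_iff[symmetric])
  also have "\<dots> \<longleftrightarrow> (\<forall>k\<ge>0. defect k b = 0)"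
  proof (intro iffI allI impI)
    fix k :: int assume *: "\<forall>n<m + N. defect (int n) b = 0" "k \<ge> 0"
    show "defect k b = 0"
    proof (cases "k \<ge> int m + int N")
      case False
      thus ?thesis using *(1)[rule_format, of "nat k"] *(2) by simp
    qed (rule defect_eq_0_of_ball[OF m])
  qed simp
  finally show ?thesis .
qed

lemma scaling_nonzero_ball: "fls_scaling M b \<noteq> 0 \<Longrightarrow> b \<in> fls_ball (- int H)"
  by (rule ball_of_defect_0) (simp add: scaling_nonzero_iff)

text \<open>A nonzero product forces \<open>b\<close> into \<open>fls_ball (- int H)\<close>, so the
  same number \<open>H + N\<close> of factors serves all such \<open>b\<close>. Here the height of
  the tree yields uniform constants.\<close>

lemma scaling_bounds:
  assumes "fls_scaling M b \<noteq> 0"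
  shows "A ^ (H + N) \<le> (cmod (fls_scaling M b))\<^sup>2" "(cmod (fls_scaling M b))\<^sup>2 \<le> B ^ (H + N)"
proof -
  have eq: "fls_scaling M b = (\<Prod>n<H + N. M (fls_shift (- int n) b))"
    by (rule scaling_eq_prod[OF scaling_nonzero_ball[OF assms] order_refl])
  have bd: "A \<le> (cmod (M (fls_shift (- int n) b)))\<^sup>2 \<and> (cmod (M (fls_shift (- int n) b)))\<^sup>2 \<le> B" for n
    using assms by (intro M_bounds) (simp add: M_shift_nonzero_iff scaling_nonzero_iff)
  have n: "(cmod (fls_scaling M b))\<^sup>2 = (\<Prod>n<H + N. (cmod (M (fls_shift (- int n) b)))\<^sup>2)"
    by (simp add: eq prod_norm[symmetric] prod_power_distrib)
  have "(\<Prod>n<H + N. A) \<le> (\<Prod>n<H + N. (cmod (M (fls_shift (- int n) b)))\<^sup>2)"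
    using bd A_pos by (intro prod_mono) auto
  thus "A ^ (H + N) \<le> (cmod (fls_scaling M b))\<^sup>2" by (simp add: n)
  have "(\<Prod>n<H + N. (cmod (M (fls_shift (- int n) b)))\<^sup>2) \<le> (\<Prod>n<H + N. B)"
    using bd by (intro prod_mono) auto
  thus "(cmod (fls_scaling M b))\<^sup>2 \<le> B ^ (H + N)" by (simp add: n)
qed

lemma measurable_scaling [measurable]: "fls_scaling M \<in> borel_measurable borel"
proof (rule borel_measurable_LIMSEQ_metric)
  show "(\<lambda>b. \<Prod>n<K. M (fls_shift (- int n) b)) \<in> borel_measurable borel" for K by measurable
  fix b :: "'a fls"
  obtain m where m: "b \<in> fls_ball (- int m)" using fls_ball_cover by blast
  show "(\<lambda>K. \<Prod>n<K. M (fls_shift (- int n) b)) \<longlonglongrightarrow> fls_scaling M b"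
    by (rule tendsto_eventually)
       (auto simp: eventually_sequentially scaling_eq_prod[OF m] intro!: exI[of _ "m + N"])
qed

lemma cmod_scaling_le: "cmod (fls_scaling M b) \<le> sqrt (B ^ (H + N))"
  using scaling_bounds(2)[of b] B_pos by (cases "fls_scaling M b = 0") (auto intro: real_le_rsqrt)

lemma scaling_L2: "fls_scaling M \<in> L2 \<mu>"
proof -
  have "(\<lambda>b. indicator (fls_ball (- int H)) b * fls_scaling M b) \<in> L2 \<mu>"
    by (rule L2_indicator_bounded(1)[OF _ emeasure_ball_finite measurable_scaling cmod_scaling_le]) simp
  moreover have "(\<lambda>b. indicator (fls_ball (- int H)) b * fls_scaling M b) = fls_scaling M"
    using scaling_nonzero_ball by (auto simp: indicator_def fun_eq_iff)
  ultimately show ?thesis by simp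
qed

section \<open>Wavelets as a weighted orthonormal basis\<close>

lemma measurable_wavelet [measurable]: "fls_wavelet M l \<in> borel_measurable borel"
proof -
  have "(\<lambda>b. M (fls_affine 0 (fls_monom (-1) l) b)) \<in> borel_measurable borel" by measurable
  hence [measurable]: "(\<lambda>b. M (b - fls_monom (-1) l)) \<in> borel_measurable borel" by (simp add: fls_affine_simps)
  have "(\<lambda>b. M (b - fls_monom (-1) l) * fls_scaling M (fls_shift (-1) b)) \<in> borel_measurable borel" by measurable
  thus ?thesis by (simp add: fls_wavelet_def[abs_def])
qed

text \<open>The translated mask requires defect \<open>l\<close> at index 0, and the dilated scaling
  function requires vanishing defects from index 1 on.\<close>

lemma wavelet_nonzero_iff: "fls_wavelet M l b \<noteq> 0 \<longleftrightarrow> b \<in> wav_supp l 0"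
proof -
  have "(\<forall>k\<ge>0. defect (k + 1) b = 0) \<longleftrightarrow> (\<forall>k>0. defect k b = 0)"
  proof (intro iffI allI impI)
    fix k :: int assume *: "\<forall>k\<ge>0. defect (k + 1) b = 0" "k > 0"
    thus "defect k b = 0" using *(1)[rule_format, of "k - 1"] by simp
  qed simp
  moreover have "fls_wavelet M l b \<noteq> 0 \<longleftrightarrow> M (b - fls_monom (-1) l) \<noteq> 0 \<and> fls_scaling M (fls_shift (- 1) b) \<noteq> 0"
    by (simp add: fls_wavelet_def)
  ultimately show ?thesis
    by (simp only: M_translate_nonzero_iff scaling_nonzero_iff defect_shift wav_supp_def mem_Collect_eq)
qed

lemma wavelet_bounds:
  assumes "fls_wavelet M l b \<noteq> 0"
  shows "A ^ (H + N + 1) \<le> (cmod (fls_wavelet M l b))\<^sup>2" "(cmod (fls_wavelet M l b))\<^sup>2 \<le> B ^ (H + N + 1)"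
proof -
  have nz: "M (b - fls_monom (-1) l) \<noteq> 0" "fls_scaling M (fls_shift (-1) b) \<noteq> 0"
    using assms by (auto simp: fls_wavelet_def)
  have eq: "(cmod (fls_wavelet M l b))\<^sup>2 =
      (cmod (M (b - fls_monom (-1) l)))\<^sup>2 * (cmod (fls_scaling M (fls_shift (-1) b)))\<^sup>2"
    by (simp add: fls_wavelet_def norm_mult power_mult_distrib)
  show "A ^ (H + N + 1) \<le> (cmod (fls_wavelet M l b))\<^sup>2"
    unfolding eq using M_bounds[OF nz(1)] scaling_bounds(1)[OF nz(2)] A_pos
    by (simp only: power_add power_one_right mult.commute[of _ A]) (intro mult_mono, auto)
  show "(cmod (fls_wavelet M l b))\<^sup>2 \<le> B ^ (H + N + 1)"
    unfolding eq using M_bounds[OF nz(1)] scaling_bounds(2)[OF nz(2)] B_pos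
    by (simp only: power_add power_one_right mult.commute[of _ B]) (intro mult_mono, auto)
qed

lemma wavelet_L2: "fls_wavelet M l \<in> L2 \<mu>"
proof -
  have bd: "cmod (fls_wavelet M l b) \<le> sqrt (B ^ (H + N + 1))" for b
    using wavelet_bounds(2)[of l b] B_pos by (cases "fls_wavelet M l b = 0") (auto intro: real_le_rsqrt)
  have "(\<lambda>b. indicator (wav_supp l 0) b * fls_wavelet M l b) \<in> L2 \<mu>"
    by (rule L2_indicator_bounded(1)[OF _ emeasure_wav_supp measurable_wavelet bd]) (simp add: sets_mu wav_supp_sets)
  moreover have "(\<lambda>b. indicator (wav_supp l 0) b * fls_wavelet M l b) = fls_wavelet M l"
    using wavelet_nonzero_iff by (auto simp: indicator_def fun_eq_iff)
  ultimately show ?thesis by simp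
qed

text \<open>The supports of the dilated wavelets partition the nonzero series, so a single function
  restricts to all of them. Its value at \<open>0\<close> is irrelevant but must respect the bounds.\<close>

definition weight :: "'a fls \<Rightarrow> complex" where
  "weight b = (if b = 0 then of_real (sqrt (A ^ (H + N + 1)))
     else case SOME (l, n). l \<noteq> 0 \<and> b \<in> wav_supp l n of (l, n) \<Rightarrow> fls_wavelet M l (fls_shift (- n) b))"

lemma weight_on_supp:
  assumes "l \<noteq> 0" "b \<in> wav_supp l n"
  shows "weight b = fls_wavelet M l (fls_shift (- n) b)"
proof -
  have "(SOME (l, n). l \<noteq> 0 \<and> b \<in> wav_supp l n) = (l, n)"
    by (rule some_equality) (use assms wav_supp_disjoint in auto)
  moreover have "b \<noteq> 0" using assms zero_not_in_wav_supp by auto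
  ultimately show ?thesis by (simp add: weight_def)
qed

lemma weight_bounds: "A ^ (H + N + 1) \<le> (cmod (weight b))\<^sup>2" "(cmod (weight b))\<^sup>2 \<le> B ^ (H + N + 1)"
proof -
  have "A ^ (H + N + 1) \<le> (cmod (weight b))\<^sup>2 \<and> (cmod (weight b))\<^sup>2 \<le> B ^ (H + N + 1)"
  proof (cases "b = 0")
    case True
    have "(cmod (weight b))\<^sup>2 = A ^ (H + N + 1)" using True A_pos by (simp add: weight_def)
    thus ?thesis using A_pos A_le_B power_mono[of A B "H + N + 1"] by simp
  next
    case False
    then obtain l n where ln: "l \<noteq> 0" "b \<in> wav_supp l n" using wav_supp_cover by blast
    have "fls_wavelet M l (fls_shift (- n) b) \<noteq> 0"
      using ln(2) by (simp add: wavelet_nonzero_iff wav_supp_shift[symmetric])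
    thus ?thesis using wavelet_bounds weight_on_supp[OF ln] by simp
  qed
  thus "A ^ (H + N + 1) \<le> (cmod (weight b))\<^sup>2" "(cmod (weight b))\<^sup>2 \<le> B ^ (H + N + 1)" by auto
qed

text \<open>The supports and the point 0 form a countable measurable cover, and on each support the
  weight is a dilated wavelet.\<close>

lemma measurable_weight: "weight \<in> borel_measurable borel"
proof (rule measurable_piecewise_restrict)
  let ?C = "insert {0} ((\<lambda>(l, n). wav_supp l n) ` ((UNIV - {0}) \<times> UNIV))"
  show "countable ?C" by (intro countable_insert countable_image countable_SIGMA) auto
  show "space borel \<subseteq> \<Union> ?C" using wav_supp_cover by fastforce
  fix S assume S: "S \<in> ?C"
  show "S \<inter> space borel \<in> sets borel" using S wav_supp_sets by auto
  show "weight \<in> measurable (restrict_space borel S) borel"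
  proof (cases "S = {0}")
    case True
    have "weight \<in> measurable (restrict_space borel S) borel \<longleftrightarrow>
        (\<lambda>_. weight 0) \<in> measurable (restrict_space borel S) borel"
      by (rule measurable_cong) (use True in \<open>simp add: space_restrict_space\<close>)
    thus ?thesis by simp
  next
    case False
    then obtain l n where ln: "l \<noteq> 0" "S = wav_supp l n" using S by auto
    have "weight \<in> measurable (restrict_space borel S) borel \<longleftrightarrow>
        (\<lambda>b. fls_wavelet M l (fls_shift (- n) b)) \<in> measurable (restrict_space borel S) borel"
      by (rule measurable_cong) (use ln weight_on_supp in \<open>auto simp: space_restrict_space\<close>)
    moreover have "(\<lambda>b. fls_wavelet M l (fls_shift (- n) b)) \<in> borel_measurable borel" by measurable
    ultimately show ?thesis using measurable_restrict_space1 by blast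
  qed
qed

lemma riesz_basis_weight: "riesz_basis \<mu> (\<lambda>i x. weight x * basis_fun i x) wavelet_index"
proof (rule riesz_basis_orthonormal_mult[OF basis_fun_L2 basis_fun_orthonormal basis_fun_complete])
  show "weight \<in> borel_measurable \<mu>" using measurable_weight by simp
  show "A ^ (H + N + 1) > 0" using A_pos by simp
qed (rule weight_bounds)+

text \<open>This recognises the transform of the member \<open>(l, n, h)\<close> of the wavelet
  system as weight times basis function; outside the support both sides vanish.\<close>

lemma weight_mult_basis_fun:
  assumes "l \<noteq> 0"
  shows "weight b * basis_fun (l, n, h) b =
    of_real (sqrt (q powi (- n))) * cnj (pair (fls_shift (- n) b) h) * fls_wavelet M l (fls_shift (- n) b)"
proof (cases "b \<in> wav_supp l n")
  case True
  thus ?thesis using weight_on_supp[OF assms True] by (simp add: basis_fun_def)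
next
  case False
  hence "fls_wavelet M l (fls_shift (- n) b) = 0" using wavelet_nonzero_iff wav_supp_shift by blast
  thus ?thesis using False by (simp add: basis_fun_def)
qed

lemma powr_eq_sqrt_q: "real p powr (real_of_int n * real s / 2) = sqrt (q powi n)"
proof -
  have "q = real p powr real s" using p_pos by (simp add: q_def powr_realpow)
  moreover have "q powi n = q powr real_of_int n" using q_pos by (simp add: powr_real_of_int')
  ultimately have "sqrt (q powi n) = ((real p powr real s) powr real_of_int n) powr (1 / 2)"
    using q_pos by (simp add: powr_half_sqrt)
  thus ?thesis by (simp add: powr_powr mult.commute)
qed

text \<open>The factor \<open>sqrt (q powi n)\<close> of the system and the factor
  \<open>q powi (- n)\<close> of the substitution combine to the normalisation
  \<open>sqrt (q powi (- n))\<close> of \<open>basis_fun\<close>.\<close>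

lemma fourier_rel_wavelet_system:
  assumes \<psi>: "\<And>l. l \<noteq> 0 \<Longrightarrow> fourier_rel (\<psi> l) (fls_wavelet M l)" and i: "i \<in> wavelet_index"
  shows "fourier_rel (wavelet_system p s \<psi> i) (\<lambda>b. weight b * basis_fun i b)"
proof -
  obtain l n h where i: "i = (l, n, h)" "l \<noteq> 0" using i by (auto simp: wavelet_index_def)
  have "sqrt (q powi n) * q powi (- n) = sqrt (q powi (- n))"
  proof -
    have "sqrt (q powi (- n)) * sqrt (q powi (- n)) = q powi (- n)" using q_pos by simp
    moreover have "sqrt (q powi n) * sqrt (q powi (- n)) = 1"
      using q_pos by (simp add: real_sqrt_mult[symmetric] power_int_minus)
    ultimately show ?thesis by (metis mult.assoc mult_1)
  qed
  hence "complex_of_real (sqrt (q powi n)) * of_real (q powi (- n)) = of_real (sqrt (q powi (- n)))"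
    by (metis of_real_mult)
  hence "(\<lambda>b. weight b * basis_fun i b) = (\<lambda>b. of_real (sqrt (q powi n)) *
      (of_real (q powi (- n)) * cnj (pair (fls_shift (- n) b) h) * fls_wavelet M l (fls_shift (- n) b)))"
    by (simp only: i weight_mult_basis_fun[OF i(2)] mult.assoc[symmetric])
  moreover have "wavelet_system p s \<psi> i = (\<lambda>x. of_real (sqrt (q powi n)) * \<psi> l (fls_affine n h x))"
    by (simp add: wavelet_system_def i powr_eq_sqrt_q fls_affine_def)
  ultimately show ?thesis
    using fourier_rel_cmult[OF fourier_rel_affine[OF \<psi>[OF i(2)]]] by (simp only:)
qed

lemma riesz_basis_wavelet_system:
  assumes "\<And>l. l \<noteq> 0 \<Longrightarrow> fourier_rel (\<psi> l) (fls_wavelet M l)"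
  shows "riesz_basis \<mu> (wavelet_system p s \<psi>) wavelet_index"
  by (rule fourier_rel_riesz_basis[OF fourier_rel_wavelet_system[OF assms] riesz_basis_weight])

text \<open>By the convention \<open>inverse 0 = 0\<close> the dual mask is a single formula with
  the same zeros, hence again a mask for the same recursion. All results apply to it with constants
  \<open>1 / B\<close> and \<open>1 / A\<close>.\<close>

lemma mask_dual: "mask p s c \<mu> N H f (\<lambda>b. inverse (cnj (M b))) (1 / B) (1 / A)"
proof unfold_locales
  show "0 < 1 / B" "1 / B \<le> 1 / A" using A_pos A_le_B by (auto intro: frac_le)
  show "(\<lambda>b. inverse (cnj (M b))) \<in> borel_measurable borel" by measurable
  fix b
  show "inverse (cnj (M b)) = 1" if "b \<in> fls_ball (int N)" using M_ball[OF that] by simp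
  show "inverse (cnj (M b)) \<noteq> 0 \<longleftrightarrow> b $$ (-1) = f b" using M_nonzero_iff[of b] by simp
  assume "inverse (cnj (M b)) \<noteq> 0"
  hence nz: "M b \<noteq> 0" by simp
  hence "(cmod (M b))\<^sup>2 > 0" by simp
  thus "1 / B \<le> (cmod (inverse (cnj (M b))))\<^sup>2 \<and> (cmod (inverse (cnj (M b))))\<^sup>2 \<le> 1 / A"
    using M_bounds[OF nz] A_pos B_pos
    by (auto simp: norm_divide power_divide inverse_eq_divide intro!: frac_le)
qed

lemma dual_wavelet: "fls_wavelet (\<lambda>b. inverse (cnj (M b))) l b = inverse (cnj (fls_wavelet M l b))"
proof -
  interpret D: mask p s c \<mu> N H f "\<lambda>b. inverse (cnj (M b))" "1 / B" "1 / A" by (rule mask_dual)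
  have "fls_scaling (\<lambda>b. inverse (cnj (M b))) b = inverse (cnj (fls_scaling M b))" for b
  proof -
    obtain m where m: "b \<in> fls_ball (- int m)" using fls_ball_cover by blast
    show ?thesis
      by (simp add: scaling_eq_prod[OF m order_refl] D.scaling_eq_prod[OF m order_refl] prod_inversef[unfolded o_def])
  qed
  thus ?thesis by (simp add: fls_wavelet_def)
qed

text \<open>At nonzero points each weight is the inverse of the conjugate of the other, so the
  weights cancel and orthonormality of \<open>basis_fun\<close> remains. At 0 the basis functions
  vanish.\<close>

lemma biorthogonal_wavelet_systems:
  assumes \<psi>: "\<And>l. l \<noteq> 0 \<Longrightarrow> fourier_rel (\<psi> l) (fls_wavelet M l)"
    and \<psi>': "\<And>l. l \<noteq> 0 \<Longrightarrow> fourier_rel (\<psi>' l) (fls_wavelet (\<lambda>b. inverse (cnj (M b))) l)"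
  shows "biorthogonal \<mu> (wavelet_system p s \<psi>) (wavelet_system p s \<psi>') wavelet_index"
proof -
  interpret D: mask p s c \<mu> N H f "\<lambda>b. inverse (cnj (M b))" "1 / B" "1 / A" by (rule mask_dual)
  have w: "weight b * cnj (D.weight b) = 1" if nz: "b \<noteq> 0" for b
  proof -
    obtain l n where ln: "l \<noteq> 0" "b \<in> wav_supp l n" using wav_supp_cover[OF nz] by blast
    have "fls_wavelet M l (fls_shift (- n) b) \<noteq> 0"
      using ln(2) by (simp add: wavelet_nonzero_iff wav_supp_shift[symmetric])
    thus ?thesis by (simp add: weight_on_supp[OF ln] D.weight_on_supp[OF ln] dual_wavelet)
  qed
  show ?thesis
  proof (rule fourier_rel_biorthogonal[OF fourier_rel_wavelet_system[OF \<psi>] D.fourier_rel_wavelet_system[OF \<psi>']])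
    show "biorthogonal \<mu> (\<lambda>i b. weight b * basis_fun i b) (\<lambda>i b. D.weight b * basis_fun i b) wavelet_index"
      unfolding biorthogonal_def
    proof (intro ballI conjI)
      fix i j :: "'a \<times> int \<times> 'a fls" assume ij: "i \<in> wavelet_index" "j \<in> wavelet_index"
      have "(weight b * basis_fun i b) * cnj (D.weight b * basis_fun j b) = basis_fun i b * cnj (basis_fun j b)" for b
      proof (cases "b = 0")
        case True
        obtain l n h where "i = (l, n, h)" "l \<noteq> 0" using ij(1) by (auto simp: wavelet_index_def)
        hence "basis_fun i 0 = 0" by (simp add: basis_fun_def zero_not_in_wav_supp)
        thus ?thesis using True by simp
      next
        case False
        have "(weight b * basis_fun i b) * cnj (D.weight b * basis_fun j b) =
            (weight b * cnj (D.weight b)) * (basis_fun i b * cnj (basis_fun j b))" by simp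
        thus ?thesis by (simp only: w[OF False] mult_1)
      qed
      thus "integrable \<mu> (\<lambda>b. (weight b * basis_fun i b) * cnj (D.weight b * basis_fun j b))"
        "(LINT b|\<mu>. (weight b * basis_fun i b) * cnj (D.weight b * basis_fun j b)) = (if i = j then 1 else 0)"
        using basis_fun_orthonormal ij unfolding biorthogonal_def by (simp_all only:)
    qed
  qed
qed

end

section \<open>Transfer to the dual group\<close>

lemma compact_subset_fls_ball:
  assumes "compact (C :: 'k::field fls set)" shows "\<exists>m::nat. C \<subseteq> fls_ball (- int m)"
proof -
  have cover: "C \<subseteq> (\<Union>n::nat. fls_ball (- int n))" using fls_ball_cover by blast
  obtain F where F: "finite F" "C \<subseteq> (\<Union>n\<in>F. fls_ball (- int n))"
    by (rule compactE_image[OF assms open_fls_ball cover])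
  define m where "m = \<Sum>F"
  have "fls_ball (- int n) \<subseteq> (fls_ball (- int m) :: 'k fls set)" if "n \<in> F" for n
  proof -
    have "n \<le> m" unfolding m_def using member_le_sum[of n F "\<lambda>n. n"] F(1) that by simp
    thus ?thesis by (auto simp: mem_fls_ball)
  qed
  with F(2) show ?thesis by blast
qed

context gf_coordinates
begin

text \<open>A subbasic open set tests a character on a compact set, which lies in some
  \<open>fls_ball (- int m)\<close>; on that ball the character does not change when
  \<open>b\<close> is altered only in digits of index at least \<open>m\<close>.\<close>

lemma continuous_on_to_char: "continuous_on UNIV to_char"
proof -
  have "open (to_char -` S)" if "open S" for S
  proof -
    have "generate_topology {{\<xi>. char_app \<xi> ` C \<subseteq> W} | C W. compact C \<and> open W} S"
      using that by (simp add: open_character_def)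
    thus ?thesis
    proof induction
      case (Int a b)
      thus ?case by (simp add: open_Int)
    next
      case (UN K)
      have "to_char -` \<Union>K = (\<Union>k\<in>K. to_char -` k)" by blast
      thus ?case using UN by (simp add: open_UN)
    next
      case (Basis S)
      then obtain C W where S: "S = {\<xi>. char_app \<xi> ` C \<subseteq> W}" "compact C" by blast
      obtain m :: nat where m: "C \<subseteq> fls_ball (- int m)" using compact_subset_fls_ball[OF S(2)] by blast
      show "open (to_char -` S)"
        unfolding open_fls_iff
      proof (intro ballI exI[of _ m] subsetI)
        fix b d assume b: "b \<in> to_char -` S" and d: "d \<in> cyl b (int m)"
        have "pair d x = pair b x" if "x \<in> C" for x
        proof (rule pair_cong_left)
          fix j assume "x $$ (-1 - j) \<noteq> 0"
          hence "\<not> -1 - j < - int m" using m that by (auto simp: mem_fls_ball)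
          thus "d $$ j = b $$ j" using d by (simp add: mem_cyl)
        qed
        hence "pair d ` C = pair b ` C" by (rule image_cong[OF refl])
        thus "d \<in> to_char -` S" using b by (simp add: S)
      qed
    qed simp
  qed
  thus ?thesis by (simp add: continuous_on_open_vimage)
qed

definition of_char :: "'k character \<Rightarrow> 'k fls" where
  "of_char = inv to_char"

lemma to_char_of_char [simp]: "to_char (of_char \<xi>) = \<xi>"
  by (simp add: of_char_def surj_f_inv_f[OF surj_to_char])

lemma of_char_to_char [simp]: "of_char (to_char b) = b"
  by (simp add: of_char_def inv_f_f[OF inj_to_char])

lemma vimage_of_char: "of_char -` S = to_char ` S"
proof (intro equalityI subsetI)
  fix \<xi> assume "\<xi> \<in> of_char -` S"
  thus "\<xi> \<in> to_char ` S" by (intro image_eqI[of _ _ "of_char \<xi>"]) auto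
qed auto

lemma measurable_to_char [measurable]: "to_char \<in> measurable borel borel"
  by (rule borel_measurable_continuous_onI[OF continuous_on_to_char])

text \<open>Membership is a conjunction of conditions on values at one-digit elements. Each is
  closed, because points are compact and so evaluation at a point is continuous in the compact-open
  topology.\<close>

lemma closed_to_char_cyl: "closed (to_char ` cyl a m)"
proof -
  have "to_char ` cyl a m = {\<xi>. \<forall>j u. j < m \<longrightarrow> char_app \<xi> (fls_monom (-1 - j) u) = gf_pair (a $$ j) u}"
  proof (intro set_eqI iffI)
    fix \<xi> assume \<xi>: "\<xi> \<in> {\<xi>. \<forall>j u. j < m \<longrightarrow> char_app \<xi> (fls_monom (-1 - j) u) = gf_pair (a $$ j) u}"
    have app: "char_app \<xi> = pair (of_char \<xi>)" using char_app_to_char[of "of_char \<xi>"] unfolding to_char_of_char .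
    have "of_char \<xi> $$ j = a $$ j" if "j < m" for j
    proof -
      have "gf_pair (of_char \<xi> $$ j) u = gf_pair (a $$ j) u" for u
        using \<xi> that by (simp add: app pair_monom)
      thus ?thesis using gf_pair_eq_iff by blast
    qed
    hence "of_char \<xi> \<in> cyl a m" by (simp add: mem_cyl)
    thus "\<xi> \<in> to_char ` cyl a m" by (intro image_eqI[of _ _ "of_char \<xi>"]) simp_all
  qed (auto simp: pair_monom mem_cyl)
  moreover have cl: "closed {\<xi> :: 'k character. char_app \<xi> x = z}" for x z
  proof -
    have "open {\<xi> :: 'k character. char_app \<xi> ` {x} \<subseteq> - {z}}"
      unfolding open_character_def
      by (intro generate_topology.Basis CollectI exI[of _ "{x}"] exI[of _ "- {z}"] conjI) auto
    moreover have "{\<xi> :: 'k character. char_app \<xi> ` {x} \<subseteq> - {z}} = - {\<xi>. char_app \<xi> x = z}" by auto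
    ultimately show ?thesis by (simp add: closed_def)
  qed
  have "closed {\<xi>. j < m \<longrightarrow> char_app \<xi> (fls_monom (-1 - j) u) = gf_pair (a $$ j) u}" for j u
    by (cases "j < m") (simp_all add: cl)
  hence "closed {\<xi>. \<forall>j u. j < m \<longrightarrow> char_app \<xi> (fls_monom (-1 - j) u) = gf_pair (a $$ j) u}"
    by (intro closed_Collect_all)
  ultimately show ?thesis by simp
qed

text \<open>An open set of the field is a countable union of cylinders, and their images under
  \<open>to_char\<close> are closed. Measurability is obtained in this way without continuity of
  \<open>of_char\<close>.\<close>

lemma measurable_of_char [measurable]: "of_char \<in> measurable borel borel"
proof (rule borel_measurableI)
  fix U :: "'k fls set" assume U: "open U"
  have "U = (\<Union>n. \<Union>a\<in>fls_box (- int n) (int n) \<inter> {a. cyl a (int n) \<subseteq> U}. cyl a (int n))"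
  proof (intro equalityI subsetI)
    fix x assume "x \<in> U"
    obtain k where k: "x \<in> fls_ball (- int k)" using fls_ball_cover by blast
    obtain n where n: "cyl x (int n) \<subseteq> U" using U \<open>x \<in> U\<close> unfolding open_fls_iff by blast
    define m where "m = max k n"
    have x: "x \<in> cyl (fls_trunc (int m) x) (int m)" by (simp add: mem_cyl)
    have "cyl (fls_trunc (int m) x) (int m) \<subseteq> cyl x (int n)" by (auto simp: mem_cyl m_def)
    moreover have "fls_trunc (int m) x \<in> fls_box (- int m) (int m)"
      using k by (auto simp: fls_box_def mem_fls_ball m_def)
    ultimately show "x \<in> (\<Union>n. \<Union>a\<in>fls_box (- int n) (int n) \<inter> {a. cyl a (int n) \<subseteq> U}. cyl a (int n))"
      using x n by blast
  qed auto
  hence "of_char -` U =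
      of_char -` (\<Union>n. \<Union>a\<in>fls_box (- int n) (int n) \<inter> {a. cyl a (int n) \<subseteq> U}. cyl a (int n))"
    by (rule arg_cong)
  hence "of_char -` U =
      (\<Union>n. \<Union>a\<in>fls_box (- int n) (int n) \<inter> {a. cyl a (int n) \<subseteq> U}. to_char ` cyl a (int n))"
    by (simp only: vimage_UN vimage_of_char)
  moreover have "(\<Union>n. \<Union>a\<in>fls_box (- int n) (int n) \<inter> {a. cyl a (int n) \<subseteq> U}. to_char ` cyl a (int n)) \<in> sets borel"
    by (intro sets.countable_UN' sets.countable_UN countable_finite finite_Int disjI1 finite_fls_box)
       (auto intro: borel_closed closed_to_char_cyl finite_fls_box countable_finite)
  ultimately show "of_char -` U \<inter> space borel \<in> sets borel" by simp
qed

end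

locale haar_duality = gf_coordinates p s c + haar_field p s c \<mu>
  for p s and c :: "'a::{field,finite} \<Rightarrow> nat \<Rightarrow> nat" and \<mu> +
  fixes \<nu> :: "'a character measure"
  assumes sets_nu: "sets \<nu> = sets borel"
    and nu_invariant: "S \<in> sets borel \<Longrightarrow> emeasure \<nu> ((*) \<xi> ` S) = emeasure \<nu> S"
    and nu_ball: "emeasure \<nu> (annihilator (fls_ball 0)) = 1"
begin

lemma measurable_nu [simp]: "measurable \<nu> N = measurable borel N"
  by (rule measurable_cong_sets) (simp_all add: sets_nu)

lemma space_nu [simp]: "space \<nu> = UNIV"
  using sets_eq_imp_space_eq[OF sets_nu] by simp

text \<open>The transported measure is translation invariant because \<open>to_char\<close> is a
  homomorphism, and it gives \<open>fls_ball 0\<close> measure 1 because this ball is mapped onto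
  its own annihilator. These two facts determine it on cylinders.\<close>

lemma distr_of_char: "distr \<nu> borel of_char = \<mu>"
proof (rule eq_mu_of_cyl)
  have em: "emeasure (distr \<nu> borel of_char) S = emeasure \<nu> (to_char ` S)" if "S \<in> sets borel" for S
    using that by (simp add: emeasure_distr vimage_of_char)
  have meas: "to_char ` S \<in> sets borel" if "S \<in> sets borel" for S
    using measurable_sets[OF measurable_of_char that] by (simp add: vimage_of_char)
  fix a m
  show "emeasure (distr \<nu> borel of_char) (cyl a m) = ennreal (q powi (- m))"
  proof (rule emeasure_cyl_invariant)
    have "to_char ` fls_ball 0 = (annihilator (fls_ball 0) :: 'a character set)"
    proof (intro equalityI subsetI)
      fix \<xi> :: "'a character" assume "\<xi> \<in> annihilator (fls_ball 0)"
      hence "of_char \<xi> \<in> fls_ball 0" using to_char_in_annihilator[of "of_char \<xi>" 0] by simp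
      thus "\<xi> \<in> to_char ` fls_ball 0" by (intro image_eqI[of _ _ "of_char \<xi>"]) simp_all
    qed (auto simp: to_char_in_annihilator)
    thus "emeasure (distr \<nu> borel of_char) (fls_ball 0) = 1" by (simp add: em nu_ball)
    fix d and S :: "'a fls set" assume S: "S \<in> sets borel"
    have tr: "(+) d ` S = fls_affine 0 d -` S"
    proof (intro equalityI subsetI)
      fix x assume "x \<in> fls_affine 0 d -` S"
      thus "x \<in> (+) d ` S" by (intro image_eqI[of _ _ "x - d"]) (simp_all add: fls_affine_simps)
    qed (auto simp: fls_affine_simps)
    have dS: "(+) d ` S \<in> sets borel"
      using measurable_sets[OF measurable_affine S, of 0 d] by (simp add: tr)
    have "to_char ` (+) d ` S = (*) (to_char d) ` to_char ` S"
      by (simp add: image_image to_char_add)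
    thus "emeasure (distr \<nu> borel of_char) ((+) d ` S) = emeasure (distr \<nu> borel of_char) S"
      by (simp add: em S dS nu_invariant meas)
  qed simp
qed simp

lemma measurable_nu_iff: "F \<in> borel_measurable \<nu> \<longleftrightarrow> (\<lambda>b. F (to_char b)) \<in> borel_measurable borel"
proof
  assume "F \<in> borel_measurable \<nu>"
  hence [measurable]: "F \<in> borel_measurable borel" by simp
  show "(\<lambda>b. F (to_char b)) \<in> borel_measurable borel" by measurable
next
  assume [measurable]: "(\<lambda>b. F (to_char b)) \<in> borel_measurable borel"
  have "(\<lambda>\<xi>. (\<lambda>b. F (to_char b)) (of_char \<xi>)) \<in> borel_measurable borel" by measurable
  thus "F \<in> borel_measurable \<nu>" by simp
qed

lemma L2_nu_iff: "F \<in> L2 \<nu> \<longleftrightarrow> (\<lambda>b. F (to_char b)) \<in> L2 \<mu>"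
proof (cases "F \<in> borel_measurable \<nu>")
  case True
  hence [measurable]: "(\<lambda>b. F (to_char b)) \<in> borel_measurable borel" using measurable_nu_iff by blast
  have "integrable (distr \<nu> borel of_char) (\<lambda>b. (cmod (F (to_char b)))\<^sup>2) \<longleftrightarrow> integrable \<nu> (\<lambda>\<xi>. (cmod (F \<xi>))\<^sup>2)"
    by (subst integrable_distr_eq) simp_all
  with True measurable_nu_iff show ?thesis by (simp add: L2_def distr_of_char)
next
  case False
  thus ?thesis using measurable_nu_iff[of F] by (auto simp: L2_def)
qed

lemma L2_norm_nu:
  assumes "(\<lambda>b. F (to_char b)) \<in> borel_measurable borel"
  shows "L2_norm \<nu> F = L2_norm \<mu> (\<lambda>b. F (to_char b))"
proof -
  note [measurable] = assms
  have "(LINT b|distr \<nu> borel of_char. (cmod (F (to_char b)))\<^sup>2) = (LINT \<xi>|\<nu>. (cmod (F \<xi>))\<^sup>2)"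
    by (subst integral_distr) simp_all
  thus ?thesis by (simp add: L2_norm_def distr_of_char)
qed

lemma fourier_L1_to_char: "fourier_L1 \<mu> f (to_char b) = fourier f b"
  by (simp add: fourier_L1_def fourier_def)

lemma fourier_L2_iff: "fourier_L2 \<mu> \<nu> f F \<longleftrightarrow> fourier_rel f (\<lambda>b. F (to_char b))"
proof (cases "f \<in> L2 \<mu> \<and> F \<in> L2 \<nu>")
  case False
  thus ?thesis by (auto simp: fourier_L2_def fourier_rel_def L2_nu_iff)
next
  case True
  hence F: "(\<lambda>b. F (to_char b)) \<in> L2 \<mu>" by (simp add: L2_nu_iff)
  have g: "integrable \<mu> g \<and> g \<in> L2 \<mu> \<and> fourier_L1 \<mu> g \<in> L2 \<nu> \<longleftrightarrow> g \<in> L12 \<mu>" for g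
    using plancherel_L12(1)[of g] by (auto simp: L2_nu_iff fourier_L1_to_char L12_def)
  have n: "L2_norm \<nu> (\<lambda>\<xi>. fourier_L1 \<mu> g \<xi> - F \<xi>) = L2_norm \<mu> (\<lambda>b. fourier g b - F (to_char b))"
    if "g \<in> L12 \<mu>" for g
  proof -
    have [measurable]: "fourier g \<in> borel_measurable borel" "(\<lambda>b. F (to_char b)) \<in> borel_measurable borel"
      by (rule L2_mu_measurable[OF plancherel_L12(1)[OF that]], rule L2_mu_measurable[OF F])
    show ?thesis by (subst L2_norm_nu) (simp_all add: fourier_L1_to_char)
  qed
  have "(\<exists>g :: nat \<Rightarrow> 'a fls \<Rightarrow> complex. (\<forall>n. g n \<in> L12 \<mu>) \<and>
        (\<lambda>n. L2_norm \<mu> (\<lambda>x. g n x - f x)) \<longlonglongrightarrow> 0 \<and>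
        (\<lambda>n. L2_norm \<nu> (\<lambda>\<xi>. fourier_L1 \<mu> (g n) \<xi> - F \<xi>)) \<longlonglongrightarrow> 0) \<longleftrightarrow>
      (\<exists>g :: nat \<Rightarrow> 'a fls \<Rightarrow> complex. (\<forall>n. g n \<in> L12 \<mu>) \<and>
        (\<lambda>n. L2_norm \<mu> (\<lambda>x. g n x - f x)) \<longlonglongrightarrow> 0 \<and>
        (\<lambda>n. L2_norm \<mu> (\<lambda>b. fourier (g n) b - F (to_char b))) \<longlonglongrightarrow> 0)"
    by (intro ex_cong1 conj_cong refl) (simp add: n)
  thus ?thesis using True F unfolding fourier_L2_def fourier_rel_def g by simp
qed

lemma fourier_L2_exists: "(\<lambda>b. F (to_char b)) \<in> L2 \<mu> \<Longrightarrow> \<exists>f. fourier_L2 \<mu> \<nu> f F"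
  using fourier_rel_ex_inverse by (simp add: fourier_L2_iff)

end

section \<open>Masks and trees in digit coordinates\<close>

context gf_coordinates
begin

lemma scaling_hat_to_char: "scaling_hat m (to_char b) = fls_scaling (\<lambda>b. m (to_char b)) b"
  by (simp add: scaling_hat_def fls_scaling_def char_dilate_to_char)

lemma wavelet_hat_to_char: "wavelet_hat p s c m l (to_char b) = fls_wavelet (\<lambda>b. m (to_char b)) l b"
proof -
  have "b - fls_monom (-1) l = b + fls_monom (-1 - 0) (- l)" by (rule fls_eqI) simp
  hence "to_char b * rchar p s c 0 (- l) = to_char (b - fls_monom (-1) l)"
    by (simp only: to_char_add to_char_monom)
  thus ?thesis
    by (simp add: wavelet_hat_def shifted_mask_def fls_wavelet_def char_dilate_to_char scaling_hat_to_char)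
qed

lemma dual_mask_to_char: "dual_mask m \<xi> = inverse (cnj (m \<xi>))"
  by (simp add: dual_mask_def inverse_eq_divide)

lemma prod_rchar: "(\<Prod>j\<in>J. rchar p s c (k j) (u j)) = to_char (\<Sum>j\<in>J. fls_monom (-1 - k j) (u j))"
  by (simp add: to_char_sum to_char_monom)

end

locale tree_mask = gf_coordinates p s c + N_valid_tree N V E r lab
  for p s N :: nat and c :: "'k::{field,finite} \<Rightarrow> nat \<Rightarrow> nat" and V :: "'v set" and E r
    and lab :: "'v \<Rightarrow> 'k" +
  fixes m0 :: "'k character \<Rightarrow> complex"
  assumes m0_ball: "\<xi> \<in> annihilator (fls_ball (- int N)) \<Longrightarrow> m0 \<xi> = 1"
    and m0_nonzero: "\<xi> \<in> annihilator (fls_ball 1) \<Longrightarrow> m0 \<xi> \<noteq> 0 \<longleftrightarrow> \<xi> \<in> tree_set p s c N V E lab"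
    and m0_periodic: "m0 (\<xi> * (\<Prod>j=1..n. rchar p s c (int j) (\<alpha> j))) = m0 \<xi>"
begin

definition next_digit :: "'k fls \<Rightarrow> 'k" where
  "next_digit b = pred_label (map (\<lambda>j. b $$ int j) [0..<N])"

lemma next_digit_cong:
  "(\<And>j. 0 \<le> j \<Longrightarrow> j < int N \<Longrightarrow> b $$ j = d $$ j) \<Longrightarrow> next_digit b = next_digit d"
  unfolding next_digit_def by (rule arg_cong[where f = pred_label]) simp

lemma next_digit_0: "next_digit 0 = 0"
  by (simp add: next_digit_def map_replicate_const pred_label_zero)

lemma next_digit_height:
  "\<exists>H. \<forall>K b j. (\<forall>k<K. b $$ (-1 - int k) = next_digit (fls_shift (- int k) b)) \<longrightarrow>
     - int K \<le> j \<longrightarrow> j < - int H \<longrightarrow> b $$ j = 0"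
proof -
  obtain H where H: "\<And>K us i. length us = K + N \<Longrightarrow> \<forall>i<K. us ! i = pred_label (take N (drop (Suc i) us)) \<Longrightarrow>
      i + H < K \<Longrightarrow> us ! i = 0"
    using recursion_height by blast
  have "b $$ j = 0"
    if rec: "\<forall>k<K. b $$ (-1 - int k) = next_digit (fls_shift (- int k) b)" and j: "- int K \<le> j" "j < - int H"
    for K b j
  proof -
    \<comment> \<open>Entry \<open>i\<close> is the digit of index \<open>i - K\<close>, so the list
      runs upwards through the digits from \<open>- K\<close> to \<open>N - 1\<close> and the
      recursion determines its first \<open>K\<close> entries.\<close>
    define us where "us = map (\<lambda>i. b $$ (int i - int K)) [0..<K + N]"
    have "us ! nat (j + int K) = 0"
    proof (rule H)
      show "\<forall>i<K. us ! i = pred_label (take N (drop (Suc i) us))"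
      proof (intro allI impI)
        fix i assume i: "i < K"
        have "take N (drop (Suc i) us) = map (\<lambda>n. fls_shift (- int (K - 1 - i)) b $$ int n) [0..<N]"
          by (rule nth_equalityI) (use i in \<open>auto simp: us_def of_nat_diff algebra_simps\<close>)
        moreover have "b $$ (-1 - int (K - 1 - i)) = us ! i"
          using i by (simp add: us_def of_nat_diff algebra_simps)
        ultimately show "us ! i = pred_label (take N (drop (Suc i) us))"
          using rec[rule_format, of "K - 1 - i"] i by (simp add: next_digit_def)
      qed
    qed (use j in \<open>auto simp: us_def\<close>)
    moreover have "nat (j + int K) < K + N" using j by linarith
    ultimately show ?thesis using j by (simp add: us_def)
  qed
  thus ?thesis by blast
qed

text \<open>Node \<open>j\<close> of a path contributes the digit at \<open>j - 1\<close>, and the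
  factor from the annihilator is free from digit \<open>N\<close> on. So membership prescribes
  exactly the digits from -1 to \<open>N - 1\<close>, as the labels of a path or as zeros.\<close>

lemma tree_set_iff:
  assumes b: "b \<in> fls_ball (- 1)"
  shows "to_char b \<in> tree_set p s c N V E lab \<longleftrightarrow> b $$ (- 1) = next_digit b"
proof -
  let ?w = "map (\<lambda>j. b $$ int j) [0..<N]"
  have word: "b $$ (-1) # ?w = map (\<lambda>j. b $$ (int j - 1)) [0..<N + 1]"
    by (rule nth_equalityI) (auto simp: nth_Cons' of_nat_diff simp del: upt_Suc)
  have 1: "to_char b \<in> annihilator (fls_ball (- int N)) \<longleftrightarrow> b $$ (-1) # ?w = replicate (N + 1) 0"
  proof -
    have "b \<in> fls_ball (int N) \<longleftrightarrow> (\<forall>j<N + 1. b $$ (int j - 1) = 0)"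
    proof
      assume *: "\<forall>j<N + 1. b $$ (int j - 1) = 0"
      show "b \<in> fls_ball (int N)"
        unfolding mem_fls_ball
      proof (intro allI impI)
        fix j assume "j < int N"
        thus "b $$ j = 0"
          using b *[rule_format, of "nat (j + 1)"] by (cases "j < -1") (auto simp: mem_fls_ball)
      qed
    qed (simp add: mem_fls_ball)
    also have "\<dots> \<longleftrightarrow> map (\<lambda>j. b $$ (int j - 1)) [0..<N + 1] = replicate (N + 1) 0"
      by (simp only: list_eq_iff_nth_eq) (auto simp del: upt_Suc replicate_Suc)
    finally show ?thesis by (simp only: word to_char_in_annihilator minus_minus)
  qed
  have 2: "(\<exists>\<xi> vs. to_char b = \<xi> * (\<Prod>j\<le>N. rchar p s c (- int j) (lab (vs ! j))) \<and>
      \<xi> \<in> annihilator (fls_ball (- int N)) \<and> dipath V E vs \<and> length vs = N + 1) \<longleftrightarrow>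
    (\<exists>vs. dipath V E vs \<and> length vs = N + 1 \<and> map lab vs = b $$ (-1) # ?w)"
  proof (rule trans[OF ex_comm], intro ex_cong1)
    fix vs
    define d where "d = (\<Sum>j\<le>N. fls_monom (int j - 1) (lab (vs ! j)))"
    have d: "d $$ i = (if -1 \<le> i \<and> i < int N then lab (vs ! nat (i + 1)) else 0)" for i
    proof -
      have "d $$ i = (\<Sum>j\<in>{..N}. if j = nat (i + 1) then (if i \<ge> -1 then lab (vs ! nat (i + 1)) else 0) else 0)"
        unfolding d_def sum_fls_nth by (intro sum.cong) auto
      thus ?thesis by auto
    qed
    have prod: "(\<Prod>j\<le>N. rchar p s c (- int j) (lab (vs ! j))) = to_char d"
      unfolding prod_rchar d_def by (simp add: algebra_simps)
    have "(\<exists>\<xi>. to_char b = \<xi> * to_char d \<and> \<xi> \<in> annihilator (fls_ball (- int N))) \<longleftrightarrow> b - d \<in> fls_ball (int N)"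
    proof
      assume "\<exists>\<xi>. to_char b = \<xi> * to_char d \<and> \<xi> \<in> annihilator (fls_ball (- int N))"
      then obtain \<xi> where \<xi>: "to_char b = to_char (of_char \<xi> + d)" "of_char \<xi> \<in> fls_ball (int N)"
        using to_char_in_annihilator[of "of_char _" "- int N"] by (auto simp: to_char_add)
      hence "b = of_char \<xi> + d" using inj_to_char by (simp add: inj_def)
      thus "b - d \<in> fls_ball (int N)" using \<xi>(2) by simp
    next
      assume "b - d \<in> fls_ball (int N)"
      thus "\<exists>\<xi>. to_char b = \<xi> * to_char d \<and> \<xi> \<in> annihilator (fls_ball (- int N))"
        by (intro exI[of _ "to_char (b - d)"]) (simp add: to_char_in_annihilator flip: to_char_add)
    qed
    moreover have "b - d \<in> fls_ball (int N) \<longleftrightarrow> map lab vs = b $$ (-1) # ?w" if len: "length vs = N + 1"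
    proof
      assume *: "b - d \<in> fls_ball (int N)"
      have "lab (vs ! j) = b $$ (int j - 1)" if "j < N + 1" for j
      proof -
        have "(b - d) $$ (int j - 1) = 0" using * that unfolding mem_fls_ball by simp
        thus ?thesis using that by (simp add: d)
      qed
      thus "map lab vs = b $$ (-1) # ?w" unfolding word using len by (intro nth_equalityI) (auto simp del: upt_Suc)
    next
      assume *: "map lab vs = b $$ (-1) # ?w"
      have "lab (vs ! j) = b $$ (int j - 1)" if "j < N + 1" for j
      proof -
        have "map lab vs ! j = map (\<lambda>j. b $$ (int j - 1)) [0..<N + 1] ! j" using * word by simp
        thus ?thesis using that len by (simp del: upt_Suc)
      qed
      note nth = this
      show "b - d \<in> fls_ball (int N)"
        unfolding mem_fls_ball
      proof (intro allI impI)
        fix j assume j: "j < int N"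
        show "(b - d) $$ j = 0"
        proof (cases "j < -1")
          case False
          thus ?thesis using j nth[of "nat (j + 1)"] by (simp add: d)
        qed (use b in \<open>simp add: d mem_fls_ball\<close>)
      qed
    qed
    ultimately show "(\<exists>\<xi>. to_char b = \<xi> * (\<Prod>j\<le>N. rchar p s c (- int j) (lab (vs ! j))) \<and>
        \<xi> \<in> annihilator (fls_ball (- int N)) \<and> dipath V E vs \<and> length vs = N + 1) \<longleftrightarrow>
      dipath V E vs \<and> length vs = N + 1 \<and> map lab vs = b $$ (-1) # ?w"
      unfolding prod by (cases "dipath V E vs \<and> length vs = N + 1") auto
  qed
  have "to_char b \<in> tree_set p s c N V E lab \<longleftrightarrow>
      to_char b \<in> annihilator (fls_ball (- int N)) \<or>
      (\<exists>\<xi> vs. to_char b = \<xi> * (\<Prod>j\<le>N. rchar p s c (- int j) (lab (vs ! j))) \<and>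
        \<xi> \<in> annihilator (fls_ball (- int N)) \<and> dipath V E vs \<and> length vs = N + 1)"
    unfolding tree_set_def by simp
  also have "\<dots> \<longleftrightarrow> b $$ (-1) = next_digit b"
    unfolding 1 2 next_digit_def using path_iff_pred_label[of ?w "b $$ (-1)"] by (simp add: disj_commute)
  finally show ?thesis .
qed

text \<open>Periodicity concerns characters of index \<open>j \<ge> 1\<close>, that is digits
  \<open>-1 - j\<close>. All digits below -1 can thus be removed, which brings the character into
  the annihilator of \<open>fls_ball 1\<close>, where the support of the mask is known.\<close>

lemma m0_eq_trunc: "m0 (to_char b) = m0 (to_char (b - fls_trunc (-1) b))"
proof -
  define n where "n = nat (- fls_subdegree b)"
  have "(\<Sum>j=1..n. fls_monom (-1 - int j) (b $$ (-1 - int j))) = fls_trunc (-1) b"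
  proof (rule fls_eqI)
    fix k
    have "(\<Sum>j=1..n. fls_monom (-1 - int j) (b $$ (-1 - int j))) $$ k =
        (\<Sum>j\<in>{1..n}. if j = nat (-1 - k) then (if k < -1 then b $$ k else 0) else 0)"
      unfolding sum_fls_nth by (intro sum.cong) auto
    also have "\<dots> = fls_trunc (-1) b $$ k"
    proof (cases "nat (-1 - k) \<in> {1..n}")
      case False
      hence "k \<ge> -1 \<or> k < fls_subdegree b" by (auto simp: n_def)
      thus ?thesis using False by auto
    qed auto
    finally show "(\<Sum>j=1..n. fls_monom (-1 - int j) (b $$ (-1 - int j))) $$ k = fls_trunc (-1) b $$ k" .
  qed
  hence "to_char (b - fls_trunc (-1) b) * (\<Prod>j=1..n. rchar p s c (int j) (b $$ (-1 - int j))) = to_char b"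
    by (simp add: prod_rchar flip: to_char_add)
  thus ?thesis using m0_periodic[of "to_char (b - fls_trunc (-1) b)" "\<lambda>j. b $$ (-1 - int j)" n] by simp
qed

lemma trunc_facts:
  "b - fls_trunc (-1) b \<in> fls_ball (-1)" "(b - fls_trunc (-1) b) $$ (-1) = b $$ (-1)"
  "next_digit (b - fls_trunc (-1) b) = next_digit b"
  "to_char (b - fls_trunc (-1) b) \<in> annihilator (fls_ball 1)"
  by (auto simp: mem_fls_ball to_char_in_annihilator intro: next_digit_cong)

lemma m0_to_char_nonzero_iff: "m0 (to_char b) \<noteq> 0 \<longleftrightarrow> b $$ (-1) = next_digit b"
  unfolding m0_eq_trunc[of b] m0_nonzero[OF trunc_facts(4)] tree_set_iff[OF trunc_facts(1)] trunc_facts(2,3) ..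

text \<open>The bounds are assumed on the tree set only; periodicity carries them to every character
  at which the mask is nonzero.\<close>

lemma m0_to_char_value:
  assumes "m0 (to_char b) \<noteq> 0"
  shows "\<exists>\<xi>\<in>tree_set p s c N V E lab. m0 (to_char b) = m0 \<xi>"
  using assms m0_nonzero[OF trunc_facts(4)] m0_eq_trunc by metis

end

text \<open>A transform determines a function only up to null sets, so the last conjunct covers
  every choice of \<open>\<psi>\<close> and \<open>\<psi>'\<close>, and the conjuncts on wavelets
  before it ensure that choices exist.\<close>

theorem theorem6p2:
  fixes p s N :: nat
    and c :: "'k::{field,finite} \<Rightarrow> nat \<Rightarrow> nat"
    and \<mu> :: "'k fls measure" and \<nu> :: "'k character measure"
    and V :: "'v set" and E :: "('v \<times> 'v) set" and r :: 'v and lab :: "'v \<Rightarrow> 'k"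
    and A B :: real and m0 :: "'k character \<Rightarrow> complex"
  assumes "prime p" and "s \<ge> 1" and "CARD('k) = p ^ s" and "gf_coords p s c"
    and "haar_measure (+) \<mu>" and "emeasure \<mu> (fls_ball 0) = 1"
    and "haar_measure (*) \<nu>" and "emeasure \<nu> (annihilator (fls_ball 0)) = 1"
    and "N \<ge> 1" and "valid_tree N V E r lab"
    and "0 < A" and "A \<le> B"
    and "m0 \<in> borel_measurable borel"
    and "\<forall>\<xi> \<in> annihilator (fls_ball (- int N)). m0 \<xi> = 1"
    and "\<forall>\<xi> \<in> annihilator (fls_ball 1). m0 \<xi> \<noteq> 0 \<longleftrightarrow> \<xi> \<in> tree_set p s c N V E lab"
    and "\<forall>\<xi> \<in> tree_set p s c N V E lab. A \<le> (cmod (m0 \<xi>))\<^sup>2 \<and> (cmod (m0 \<xi>))\<^sup>2 \<le> B"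
    and "\<forall>\<xi> (n::nat) \<alpha>. m0 (\<xi> * (\<Prod>j=1..n. rchar p s c (int j) (\<alpha> j))) = m0 \<xi>"
  shows
    \<comment> \<open>the functions defined by their Fourier transforms exist\<close>
    "(\<exists>\<phi>. fourier_L2 \<mu> \<nu> \<phi> (scaling_hat m0)) \<and>
     (\<exists>\<phi>'. fourier_L2 \<mu> \<nu> \<phi>' (scaling_hat (dual_mask m0))) \<and>
     (\<forall>l. l \<noteq> 0 \<longrightarrow> (\<exists>\<psi>. fourier_L2 \<mu> \<nu> \<psi> (wavelet_hat p s c m0 l))) \<and>
     (\<forall>l. l \<noteq> 0 \<longrightarrow> (\<exists>\<psi>'. fourier_L2 \<mu> \<nu> \<psi>' (wavelet_hat p s c (dual_mask m0) l))) \<and>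
     (\<forall>\<psi> \<psi>'.
        (\<forall>l. l \<noteq> 0 \<longrightarrow>
           fourier_L2 \<mu> \<nu> (\<psi> l) (wavelet_hat p s c m0 l) \<and>
           fourier_L2 \<mu> \<nu> (\<psi>' l) (wavelet_hat p s c (dual_mask m0) l)) \<longrightarrow>
        biorthogonal \<mu> (wavelet_system p s \<psi>) (wavelet_system p s \<psi>') wavelet_index \<and>
        riesz_basis \<mu> (wavelet_system p s \<psi>) wavelet_index \<and>
        riesz_basis \<mu> (wavelet_system p s \<psi>') wavelet_index)"
proof -
  interpret gf_coordinates p s c by unfold_locales (rule assms)+
  have mu: "sets \<mu> = sets borel" "\<And>a S. S \<in> sets borel \<Longrightarrow> emeasure \<mu> ((+) a ` S) = emeasure \<mu> S"
    using assms(5) by (auto simp: haar_measure_def)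
  interpret haar_field p s c \<mu>
    by unfold_locales (rule mu(1), rule emeasure_cyl_invariant[OF mu assms(6)])
  interpret haar_duality p s c \<mu> \<nu>
    by unfold_locales (use assms(7,8) in \<open>auto simp: haar_measure_def\<close>)
  interpret T: tree_mask p s N c V E r lab m0
    by unfold_locales (use assms in blast)+
  obtain H where H: "\<And>K b j. (\<And>k. k < K \<Longrightarrow> b $$ (-1 - int k) = T.next_digit (fls_shift (- int k) b)) \<Longrightarrow>
      - int K \<le> j \<Longrightarrow> j < - int H \<Longrightarrow> b $$ j = 0"
    using T.next_digit_height by blast
  define M where "M = (\<lambda>b. m0 (to_char b))"
  interpret M: mask p s c \<mu> N H T.next_digit M A B
  proof unfold_locales
    fix b d :: "'k fls" assume "\<And>j. 0 \<le> j \<Longrightarrow> j < int N \<Longrightarrow> b $$ j = d $$ j"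
    thus "T.next_digit b = T.next_digit d" by (rule T.next_digit_cong)
  next
    have [measurable]: "m0 \<in> borel_measurable borel" by (rule assms)
    show "M \<in> borel_measurable borel" unfolding M_def by measurable
  next
    fix b :: "'k fls" assume "b \<in> fls_ball (int N)"
    thus "M b = 1" using assms(14) by (simp add: M_def to_char_in_annihilator)
  next
    fix b :: "'k fls" assume "M b \<noteq> 0"
    thus "A \<le> (cmod (M b))\<^sup>2 \<and> (cmod (M b))\<^sup>2 \<le> B"
      using T.m0_to_char_value[of b] assms(16) by (auto simp: M_def)
  next
    show "M b \<noteq> 0 \<longleftrightarrow> b $$ (-1) = T.next_digit b" for b
      unfolding M_def by (rule T.m0_to_char_nonzero_iff)
  qed (rule T.next_digit_0 assms H; assumption?)+
  interpret D: mask p s c \<mu> N H T.next_digit "\<lambda>b. inverse (cnj (M b))" "1 / B" "1 / A"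
    by (rule M.mask_dual)
  have sc: "(\<lambda>b. scaling_hat m0 (to_char b)) = fls_scaling M"
    "(\<lambda>b. scaling_hat (dual_mask m0) (to_char b)) = fls_scaling (\<lambda>b. inverse (cnj (M b)))"
    by (simp_all add: scaling_hat_to_char dual_mask_to_char M_def)
  have wv: "(\<lambda>b. wavelet_hat p s c m0 l (to_char b)) = fls_wavelet M l"
    "(\<lambda>b. wavelet_hat p s c (dual_mask m0) l (to_char b)) = fls_wavelet (\<lambda>b. inverse (cnj (M b))) l" for l
    by (simp_all add: wavelet_hat_to_char dual_mask_to_char M_def)
  have w: "fourier_L2 \<mu> \<nu> f (wavelet_hat p s c m0 l) \<longleftrightarrow> fourier_rel f (fls_wavelet M l)"
    "fourier_L2 \<mu> \<nu> f (wavelet_hat p s c (dual_mask m0) l) \<longleftrightarrow> fourier_rel f (fls_wavelet (\<lambda>b. inverse (cnj (M b))) l)"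
    for f l by (simp_all only: fourier_L2_iff wv)
  show ?thesis
  proof (intro conjI allI impI)
    show "\<exists>\<phi>. fourier_L2 \<mu> \<nu> \<phi> (scaling_hat m0)"
      by (rule fourier_L2_exists) (simp only: sc M.scaling_L2)
    show "\<exists>\<phi>'. fourier_L2 \<mu> \<nu> \<phi>' (scaling_hat (dual_mask m0))"
      by (rule fourier_L2_exists) (simp only: sc D.scaling_L2)
    fix l :: 'k
    show "\<exists>\<psi>. fourier_L2 \<mu> \<nu> \<psi> (wavelet_hat p s c m0 l)"
      by (rule fourier_L2_exists) (simp only: wv M.wavelet_L2)
    show "\<exists>\<psi>'. fourier_L2 \<mu> \<nu> \<psi>' (wavelet_hat p s c (dual_mask m0) l)"
      by (rule fourier_L2_exists) (simp only: wv D.wavelet_L2)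
  next
    fix \<psi> \<psi>' :: "'k \<Rightarrow> 'k fls \<Rightarrow> complex"
    assume "\<forall>l. l \<noteq> 0 \<longrightarrow> fourier_L2 \<mu> \<nu> (\<psi> l) (wavelet_hat p s c m0 l) \<and>
        fourier_L2 \<mu> \<nu> (\<psi>' l) (wavelet_hat p s c (dual_mask m0) l)"
    hence \<psi>: "\<And>l. l \<noteq> 0 \<Longrightarrow> fourier_rel (\<psi> l) (fls_wavelet M l)"
      "\<And>l. l \<noteq> 0 \<Longrightarrow> fourier_rel (\<psi>' l) (fls_wavelet (\<lambda>b. inverse (cnj (M b))) l)"
      unfolding w by blast+
    show "biorthogonal \<mu> (wavelet_system p s \<psi>) (wavelet_system p s \<psi>') wavelet_index"
      by (rule M.biorthogonal_wavelet_systems[OF \<psi>])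
    show "riesz_basis \<mu> (wavelet_system p s \<psi>) wavelet_index"
      by (rule M.riesz_basis_wavelet_system[OF \<psi>(1)])
    show "riesz_basis \<mu> (wavelet_system p s \<psi>') wavelet_index"
      by (rule D.riesz_basis_wavelet_system[OF \<psi>(2)])
  qed
qed

end
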